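(* Let $(N,g)$ be a compact smooth Riemannian manifold with smooth boundary $\partial N$. There exists a constant $C>0$ depending only on $N$ such that for every $\lambda\geq 1$ and every eigenfunction $e_\lambda$ of the Dirichlet Laplacian $\Delta_N$ with eigenvalue $\lambda^2$, i.e. $\Delta_N e_\lambda=\lambda^2e_\lambda$ in the interior of $N$ and $e_\lambda=0$ on $\partial N$, $$\frac{\lambda\,\|e_\lambda\|_\infty}{C}\leq\|\nabla e_\lambda\|_\infty\leq C\,\lambda\,\|e_\lambda\|_\infty.$$
   Context: $(N,g)$ is an $n$-dimensional compact smooth Riemannian manifold with smooth boundary $\partial N$, and $\Delta_N$ is the positive Dirichlet Laplacian on $N$; in local coordinates $\Delta_N u=-\frac{1}{\sqrt{\det(g_{ij})}}\sum_{i,j}\partial_{x_i}\left(g^{ij}\sqrt{\det(g_{ij})}\,\partial_{x_j}u\right)$, with Dirichlet boundary condition $u=0$ on $\partial N$. The Dirichlet eigenvalues, counted with multiplicity, are $0<\lambda_1^2<\lambda_2^2\leq\lambda_3^2\leq\cdots$. Eigenfunctions are real-valued, smooth on $N$ and not identically zero. $\nabla u$ is the gradient vector field of $u$, with squared pointwise length $\sum_{i,j}g^{ij}\frac{\partial u}{\partial x_i}\frac{\partial u}{\partial x_j}$. $\|\cdot\|_\infty$ is the $L^\infty$ norm on $N$; for a vector field it is the $L^\infty$ norm of its pointwise length. *)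

theory Defs
  imports "HOL-Analysis.Analysis"
begin

text \<open>\<open>C\<^sup>k\<close> on an open set \<open>U\<close>. The derivative is required to be \<open>C\<^sup>k\<close> along every fixed
  direction, which for maps out of a finite-dimensional space is the usual notion.\<close>

primrec Ck_on :: "nat \<Rightarrow> ('b::euclidean_space) set \<Rightarrow> ('b \<Rightarrow> 'c::real_normed_vector) \<Rightarrow> bool" where
  "Ck_on 0 U f \<longleftrightarrow> continuous_on U f"
| "Ck_on (Suc k) U f \<longleftrightarrow>
     (\<exists>f'. (\<forall>x\<in>U. (f has_derivative f' x) (at x)) \<and> (\<forall>v. Ck_on k U (\<lambda>x. f' x v)))"

text \<open>On a set that need not be open, smooth means: locally the restriction of a smooth map
  defined on an open set of the ambient space.\<close>

definition smooth_on :: "('b::euclidean_space) set \<Rightarrow> ('b \<Rightarrow> 'c::real_normed_vector) \<Rightarrow> bool" where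
  "smooth_on S f \<longleftrightarrow>
     (\<forall>x\<in>S. \<exists>W F. open W \<and> x \<in> W \<and> (\<forall>k. Ck_on k W F) \<and> (\<forall>y\<in>S \<inter> W. F y = f y))"

text \<open>Partial derivative of a function on \<open>S\<close>. For \<open>S\<close> relatively open in a half-space this also
  makes sense at the points of \<open>S\<close> on the bounding hyperplane.\<close>

definition pderiv_on :: "(real^'n) set \<Rightarrow> 'n::finite \<Rightarrow> (real^'n \<Rightarrow> real) \<Rightarrow> real^'n \<Rightarrow> real" where
  "pderiv_on S i f x = frechet_derivative f (at x within S) (axis i 1)"

text \<open>The model half-space singles out one coordinate; which one is immaterial, since the
  coordinates can be permuted.\<close>

definition bdry_coord :: "'n::finite" where
  "bdry_coord = (SOME i. True)"

definition half_space :: "(real^'n::finite) set" where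
  "half_space = {x. 0 \<le> x $ bdry_coord}"

text \<open>A chart \<open>(U, \<phi>)\<close> consists of an open set \<open>U\<close> and a map whose values outside \<open>U\<close> are
  irrelevant. The dimension is \<open>CARD('n)\<close>.\<close>

type_synonym ('a, 'n) chart = "'a set \<times> ('a \<Rightarrow> real^'n)"

definition is_chart :: "'a topology \<Rightarrow> ('a, 'n::finite) chart \<Rightarrow> bool" where
  "is_chart N = (\<lambda>(U, \<phi>). openin N U \<and> openin (top_of_set half_space) (\<phi> ` U) \<and>
     homeomorphic_map (subtopology N U) (top_of_set (\<phi> ` U)) \<phi>)"

definition transition :: "('a, 'n::finite) chart \<Rightarrow> ('a, 'n) chart \<Rightarrow> real^'n \<Rightarrow> real^'n" where
  "transition = (\<lambda>(U, \<phi>) (V, \<psi>). \<psi> \<circ> inv_into U \<phi>)"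

definition smooth_manifold_with_boundary :: "'a topology \<Rightarrow> ('a, 'n::finite) chart set \<Rightarrow> bool" where
  "smooth_manifold_with_boundary N A \<longleftrightarrow>
     Hausdorff_space N \<and> second_countable N \<and>
     (\<forall>c\<in>A. is_chart N c) \<and> (\<Union>c\<in>A. fst c) = topspace N \<and>
     (\<forall>(U, \<phi>)\<in>A. \<forall>(V, \<psi>)\<in>A. smooth_on (\<phi> ` (U \<inter> V)) (transition (U, \<phi>) (V, \<psi>)))"

definition mfd_boundary :: "('a, 'n::finite) chart set \<Rightarrow> 'a set" where
  "mfd_boundary A = {p. \<exists>(U, \<phi>)\<in>A. p \<in> U \<and> \<phi> p $ bdry_coord = 0}"

definition mfd_interior :: "'a topology \<Rightarrow> ('a, 'n::finite) chart set \<Rightarrow> 'a set" where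
  "mfd_interior N A = topspace N - mfd_boundary A"

definition smooth_function :: "('a, 'n::finite) chart set \<Rightarrow> ('a \<Rightarrow> real) \<Rightarrow> bool" where
  "smooth_function A u \<longleftrightarrow> (\<forall>(U, \<phi>)\<in>A. smooth_on (\<phi> ` U) (u \<circ> inv_into U \<phi>))"

text \<open>Tensor fields are given by their components in each chart. For a metric \<open>g\<close>, the entry
  \<open>g (U, \<phi>) p $ i $ j\<close> is the coefficient \<open>g\<^sub>i\<^sub>j\<close> at \<open>p\<close> in the coordinates \<open>\<phi>\<close>.\<close>

type_synonym ('a, 'n) metric = "('a, 'n) chart \<Rightarrow> 'a \<Rightarrow> real^'n^'n"

definition jacobian :: "('a, 'n::finite) chart \<Rightarrow> ('a, 'n) chart \<Rightarrow> 'a \<Rightarrow> real^'n^'n" where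
  "jacobian = (\<lambda>(U, \<phi>) (V, \<psi>) p.
     matrix (frechet_derivative (transition (U, \<phi>) (V, \<psi>)) (at (\<phi> p) within \<phi> ` (U \<inter> V))))"

text \<open>Smooth, symmetric, positive definite, and transforming as a covariant 2-tensor.\<close>

definition riemannian_metric :: "('a, 'n::finite) chart set \<Rightarrow> ('a, 'n) metric \<Rightarrow> bool" where
  "riemannian_metric A g \<longleftrightarrow>
     (\<forall>(U, \<phi>)\<in>A.
        (\<forall>i j. smooth_on (\<phi> ` U) (\<lambda>x. g (U, \<phi>) (inv_into U \<phi> x) $ i $ j)) \<and>
        (\<forall>p\<in>U. transpose (g (U, \<phi>) p) = g (U, \<phi>) p \<and>
               (\<forall>v. v \<noteq> 0 \<longrightarrow> 0 < v \<bullet> (g (U, \<phi>) p *v v)))) \<and>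
     (\<forall>c\<in>A. \<forall>d\<in>A. \<forall>p\<in>fst c \<inter> fst d.
        g c p = transpose (jacobian c d p) ** g d p ** jacobian c d p)"

text \<open>Components of the differential and of the gradient \<open>(\<Sum>\<^sub>j g\<^sup>i\<^sup>j \<partial>\<^sub>j u)\<^sub>i\<close> in a chart.\<close>

definition partials :: "('a, 'n::finite) chart \<Rightarrow> ('a \<Rightarrow> real) \<Rightarrow> 'a \<Rightarrow> real^'n" where
  "partials = (\<lambda>(U, \<phi>) u p. \<chi> i. pderiv_on (\<phi> ` U) i (u \<circ> inv_into U \<phi>) (\<phi> p))"

definition gradient ::
    "('a, 'n::finite) metric \<Rightarrow> ('a \<Rightarrow> real) \<Rightarrow> ('a, 'n) chart \<Rightarrow> 'a \<Rightarrow> real^'n" where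
  "gradient g u c p = matrix_inv (g c p) *v partials c u p"

definition tangent_length ::
    "('a, 'n::finite) metric \<Rightarrow> (('a, 'n) chart \<Rightarrow> 'a \<Rightarrow> real^'n) \<Rightarrow> ('a, 'n) chart \<Rightarrow> 'a \<Rightarrow> real" where
  "tangent_length g X c p = sqrt (X c p \<bullet> (g c p *v X c p))"

definition chart_at :: "('a, 'n::finite) chart set \<Rightarrow> 'a \<Rightarrow> ('a, 'n) chart" where
  "chart_at A p = (SOME c. c \<in> A \<and> p \<in> fst c)"

text \<open>The pointwise length \<open>|\<nabla>u|\<close>. The chart used at \<open>p\<close> does not matter, see
  \<open>gradient_length_chart\<close> below.\<close>

definition gradient_length ::
    "('a, 'n::finite) chart set \<Rightarrow> ('a, 'n) metric \<Rightarrow> ('a \<Rightarrow> real) \<Rightarrow> 'a \<Rightarrow> real" where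
  "gradient_length A g u p = tangent_length g (gradient g u) (chart_at A p) p"

text \<open>The positive Laplacian in a chart; \<open>G x\<close> is the metric at the point with coordinates \<open>x\<close>.\<close>

definition laplacian ::
    "('a, 'n::finite) metric \<Rightarrow> ('a, 'n) chart \<Rightarrow> ('a \<Rightarrow> real) \<Rightarrow> 'a \<Rightarrow> real" where
  "laplacian g = (\<lambda>(U, \<phi>) u p.
     let G = (\<lambda>x. g (U, \<phi>) (inv_into U \<phi> x)) in
     - (1 / sqrt (det (G (\<phi> p)))) *
       (\<Sum>i\<in>UNIV. \<Sum>j\<in>UNIV. pderiv_on (\<phi> ` U) i
          (\<lambda>x. matrix_inv (G x) $ i $ j * sqrt (det (G x)) *
               pderiv_on (\<phi> ` U) j (u \<circ> inv_into U \<phi>) x) (\<phi> p)))"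

definition dirichlet_eigenfunction ::
    "'a topology \<Rightarrow> ('a, 'n::finite) chart set \<Rightarrow> ('a, 'n) metric \<Rightarrow> real \<Rightarrow> ('a \<Rightarrow> real) \<Rightarrow> bool" where
  "dirichlet_eigenfunction N A g \<mu> u \<longleftrightarrow>
     smooth_function A u \<and> (\<exists>p\<in>topspace N. u p \<noteq> 0) \<and>
     (\<forall>c\<in>A. \<forall>p\<in>fst c \<inter> mfd_interior N A. laplacian g c u p = \<mu> * u p) \<and>
     (\<forall>p\<in>mfd_boundary A. u p = 0)"

text \<open>The null sets of the Riemannian volume are the sets whose image in every chart is
  Lebesgue-null, and the \<open>L\<^sup>\<infinity>\<close> norm depends on the volume only through its null sets.\<close>

definition null_set :: "('a, 'n::finite) chart set \<Rightarrow> 'a set \<Rightarrow> bool" where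
  "null_set A E \<longleftrightarrow> (\<forall>(U, \<phi>)\<in>A. negligible (\<phi> ` (E \<inter> U)))"

text \<open>As a real number: meaningful for essentially bounded \<open>f\<close>, in particular for functions
  continuous on a compact manifold.\<close>

definition Linf_norm :: "'a topology \<Rightarrow> ('a, 'n::finite) chart set \<Rightarrow> ('a \<Rightarrow> real) \<Rightarrow> real" where
  "Linf_norm N A f = Inf {C. 0 \<le> C \<and> null_set A {p \<in> topspace N. C < \<bar>f p\<bar>}}"

lemma smooth_on_imp_differentiable:
  assumes "smooth_on S f" "x \<in> S"
  shows "f differentiable (at x within S)"
proof -
  obtain W F where W: "open W" "x \<in> W" "\<And>k. Ck_on k W F" "\<forall>y\<in>S \<inter> W. F y = f y"
    using assms unfolding smooth_on_def by blast
  have "Ck_on (Suc 0) W F" using W(3) .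
  then obtain D where D: "(F has_derivative D) (at x)"
    using W(2) by auto
  obtain d where d: "0 < d" "ball x d \<subseteq> W"
    using W(1,2) openE by blast
  have "(f has_derivative D) (at x within S)"
    by (rule has_derivative_transform_within[OF has_derivative_at_withinI[OF D] d(1) assms(2)])
      (use W(4) d(2) in \<open>auto simp: subset_eq dist_commute\<close>)
  then show ?thesis unfolding differentiable_def by blast
qed

lemma half_space_derivative_unique:
  fixes f :: "real^'n::finite \<Rightarrow> 'c::real_normed_vector"
  assumes S: "openin (top_of_set half_space) S" "x \<in> S"
    and f: "(f has_derivative f') (at x within S)" "(f has_derivative f'') (at x within S)"
  shows "f' = f''"
proof (rule frechet_derivative_unique_within[OF f])
  fix i :: "real^'n" and e :: real
  assume i: "i \<in> Basis" and e: "e > 0"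
  obtain r where r: "r > 0" "ball x r \<inter> half_space \<subseteq> S"
    using S unfolding openin_contains_ball by blast
  define d where "d = min e r / 2"
  have d: "0 < d" "d < e" "d < r" using e r(1) unfolding d_def by auto
  obtain k where k: "i = axis k (1::real)"
    using i by (auto simp: Basis_vec_def)
  have "x \<in> half_space" using S openin_imp_subset by blast
  then have "x + d *\<^sub>R i \<in> half_space"
    using d(1) by (auto simp: half_space_def k axis_def)
  moreover have "x + d *\<^sub>R i \<in> ball x r"
    using i d by (simp add: dist_norm)
  ultimately show "\<exists>d. 0 < \<bar>d\<bar> \<and> \<bar>d\<bar> < e \<and> x + d *\<^sub>R i \<in> S"
    using r(2) d by (intro exI[of _ d]) auto
qed

lemma gradient_length_change:
  fixes A :: "('a, 'n::finite) chart set"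
  assumes M: "smooth_manifold_with_boundary N A" and g: "riemannian_metric A g"
    and u: "smooth_function A u"
    and c: "c \<in> A" "p \<in> fst c" and d: "d \<in> A" "p \<in> fst d"
  shows "tangent_length g (gradient g u) c p = tangent_length g (gradient g u) d p"
proof -
  obtain U \<phi> V \<psi> where cd: "c = (U, \<phi>)" "d = (V, \<psi>)" by (cases c, cases d)
  let ?S = "\<phi> ` U" and ?T = "\<psi> ` V" and ?R = "\<phi> ` (U \<inter> V)" and ?t = "transition c d"
  let ?f = "u \<circ> inv_into U \<phi>" and ?h = "u \<circ> inv_into V \<psi>"
  have p: "p \<in> U" "p \<in> V" using c d cd by auto
  have chart: "is_chart N c" "is_chart N d"
  proof -
    have "\<forall>c\<in>A. is_chart N c"
      using M unfolding smooth_manifold_with_boundary_def by (elim conjE)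
    then show "is_chart N c" "is_chart N d" using c(1) d(1) by blast+
  qed
  have oU: "openin N U" "openin N V" using chart unfolding is_chart_def cd by auto
  have oS: "openin (top_of_set half_space) ?S" "openin (top_of_set half_space) ?T"
    using chart unfolding is_chart_def cd by auto
  have hom: "homeomorphic_map (subtopology N U) (top_of_set ?S) \<phi>"
            "homeomorphic_map (subtopology N V) (top_of_set ?T) \<psi>"
    using chart unfolding is_chart_def cd by auto
  have tU: "topspace (subtopology N U) = U" "topspace (subtopology N V) = V"
    using oU by (auto simp: topspace_subtopology dest: openin_subset)
  have inj: "inj_on \<phi> U" "inj_on \<psi> V"
    using hom[THEN homeomorphic_imp_injective_map] by (simp_all only: tU)
  have "openin (subtopology N U) (U \<inter> V)"
    using oU(2) by (rule openin_subtopology_Int2)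
  then have "openin (top_of_set ?S) ?R"
    using homeomorphic_map_openness_eq[OF hom(1)] by simp
  then have oR: "openin (top_of_set half_space) ?R"
    using oS(1) by (rule openin_trans)
  have pR: "\<phi> p \<in> ?R" and pS: "\<phi> p \<in> ?S" and pT: "\<psi> p \<in> ?T" using p by auto
  have RS: "?R \<subseteq> ?S" by auto
  have tp: "?t (\<phi> p) = \<psi> p"
    using p inj by (simp add: transition_def cd)
  have tR: "?t ` ?R \<subseteq> ?T"
    using inj by (auto simp: transition_def cd)
  have comp: "?h (?t y) = ?f y" if "y \<in> ?R" for y
    using that inj by (auto simp: transition_def cd)
  define F where "F = frechet_derivative ?f (at (\<phi> p) within ?S)"
  define H where "H = frechet_derivative ?h (at (\<psi> p) within ?T)"
  define D where "D = frechet_derivative ?t (at (\<phi> p) within ?R)"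
  have dF: "(?f has_derivative F) (at (\<phi> p) within ?S)"
    unfolding F_def
    by (rule frechet_derivative_works[THEN iffD1, OF smooth_on_imp_differentiable[OF _ pS]])
      (use bspec[OF u[unfolded smooth_function_def] c(1)] in \<open>simp add: cd\<close>)
  have dH: "(?h has_derivative H) (at (\<psi> p) within ?T)"
    unfolding H_def
    by (rule frechet_derivative_works[THEN iffD1, OF smooth_on_imp_differentiable[OF _ pT]])
      (use bspec[OF u[unfolded smooth_function_def] d(1)] in \<open>simp add: cd\<close>)
  have "smooth_on ?R ?t"
  proof -
    have "\<forall>(U, \<phi>)\<in>A. \<forall>(V, \<psi>)\<in>A. smooth_on (\<phi> ` (U \<inter> V)) (transition (U, \<phi>) (V, \<psi>))"
      using M unfolding smooth_manifold_with_boundary_def by (elim conjE)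
    from bspec[OF this c(1)] have "\<forall>(V, \<psi>)\<in>A. smooth_on (\<phi> ` (U \<inter> V)) (transition c (V, \<psi>))"
      by (simp add: cd)
    from bspec[OF this d(1)] show ?thesis by (simp add: cd)
  qed
  then have dD: "(?t has_derivative D) (at (\<phi> p) within ?R)"
    unfolding D_def by (rule frechet_derivative_works[THEN iffD1, OF smooth_on_imp_differentiable[OF _ pR]])
  have "(?h \<circ> ?t has_derivative H \<circ> D) (at (\<phi> p) within ?R)"
    using dD has_derivative_subset[OF dH tR] tp by (intro diff_chain_within) auto
  then have "(?f has_derivative H \<circ> D) (at (\<phi> p) within ?R)"
    by (rule has_derivative_transform[rotated 2]) (use pR comp in auto)
  moreover have "(?f has_derivative F) (at (\<phi> p) within ?R)"
    using has_derivative_subset[OF dF RS] .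
  ultimately have FHD: "F = H \<circ> D"
    by (intro half_space_derivative_unique[OF oR pR])
  define J where "J = jacobian c d p"
  have linD: "linear D" and linH: "linear H"
    using dD dH has_derivative_linear by auto
  have J: "D x = J *v x" for x
    unfolding J_def jacobian_def cd using matrix_works[of D x] linD by (simp add: D_def cd linear_matrix_vector_mul_eq)
  have Hp: "H x = partials d u p \<bullet> x" for x
  proof -
    have "H x = H (\<Sum>i\<in>UNIV. (x $ i) *\<^sub>R axis i 1)"
      using basis_expansion[of x] by (simp add: scalar_mult_eq_scaleR)
    also have "\<dots> = (\<Sum>i\<in>UNIV. x $ i * H (axis i 1))"
      using linH by (simp add: linear_sum linear_cmul)
    also have "\<dots> = partials d u p \<bullet> x"
      by (simp add: inner_vec_def partials_def pderiv_on_def cd H_def mult.commute)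
    finally show ?thesis .
  qed
  have part: "partials c u p = transpose J *v partials d u p"
  proof (rule vec_eq_iff[THEN iffD2], rule)
    fix i
    have "partials c u p $ i = F (axis i 1)"
      by (simp add: partials_def pderiv_on_def cd F_def)
    also have "\<dots> = partials d u p \<bullet> (J *v axis i 1)"
      using FHD Hp J by simp
    also have "\<dots> = (transpose J *v partials d u p) \<bullet> axis i 1"
      by (simp add: dot_lmul_matrix transpose_matrix_vector)
    also have "\<dots> = (transpose J *v partials d u p) $ i"
      by (simp add: inner_axis)
    finally show "partials c u p $ i = (transpose J *v partials d u p) $ i" .
  qed
  let ?P = "g c p" and ?Q = "g d p"
  have PQ: "?P = transpose J ** ?Q ** J"
    unfolding J_def
    using bspec[OF bspec[OF bspec[OF conjunct2[OF g[unfolded riemannian_metric_def]] c(1)] d(1)], of p]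
      c(2) d(2) by simp
  have pos: "\<forall>v. v \<noteq> 0 \<longrightarrow> 0 < v \<bullet> (?P *v v)" "\<forall>v. v \<noteq> 0 \<longrightarrow> 0 < v \<bullet> (?Q *v v)"
  proof -
    note * = conjunct1[OF g[unfolded riemannian_metric_def]]
    show "\<forall>v. v \<noteq> 0 \<longrightarrow> 0 < v \<bullet> (?P *v v)"
      using bspec[OF * c(1)] p by (simp add: cd)
    show "\<forall>v. v \<noteq> 0 \<longrightarrow> 0 < v \<bullet> (?Q *v v)"
      using bspec[OF * d(1)] p by (simp add: cd)
  qed
  have inv: "invertible ?P" "invertible ?Q"
    using pos unfolding invertible_left_inverse matrix_left_invertible_ker
    by fastforce+
  have right_inv: "B ** matrix_inv B = mat 1" if "invertible B" for B :: "real^'n^'n"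
    using that unfolding invertible_def matrix_inv_def by (rule someI2_ex) simp
  let ?X = "gradient g u c p" and ?Y = "gradient g u d p"
  have PX: "?P *v ?X = partials c u p" "?Q *v ?Y = partials d u p"
    using right_inv[OF inv(1)] right_inv[OF inv(2)] unfolding gradient_def
    by (simp_all add: matrix_vector_mul_assoc)
  have "invertible J"
  proof -
    have "x = 0" if "J *v x = 0" for x
    proof -
      have "?P *v x = 0"
        using that by (simp add: PQ flip: matrix_vector_mul_assoc)
      then show ?thesis using pos(1) by fastforce
    qed
    then show ?thesis unfolding invertible_left_inverse matrix_left_invertible_ker by blast
  qed
  then have iJ: "invertible (transpose J)" by (simp add: invertible_det_nz det_transpose)
  have "transpose J *v (?Q *v (J *v ?X)) = transpose J *v (?Q *v ?Y)"
    using PX part by (simp add: PQ flip: matrix_vector_mul_assoc)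
  moreover have "inj ((*v) (transpose J))" "inj ((*v) ?Q)"
    using iJ inv(2) by (auto simp flip: matrix_left_invertible_injective invertible_left_inverse)
  ultimately have JX: "J *v ?X = ?Y"
    by (simp add: inj_eq del: transpose_matrix_vector)
  have "?X \<bullet> (?P *v ?X) = ?X \<bullet> (transpose J *v partials d u p)"
    using PX part by simp
  also have "\<dots> = (J *v ?X) \<bullet> partials d u p"
    using dot_lmul_matrix[of "partials d u p" J ?X]
    by (simp add: transpose_matrix_vector inner_commute)
  finally have "?X \<bullet> (?P *v ?X) = ?Y \<bullet> (?Q *v ?Y)"
    using JX PX by simp
  then show ?thesis unfolding tangent_length_def by simp
qed

lemma gradient_length_chart:
  assumes "smooth_manifold_with_boundary N A" "riemannian_metric A g" "smooth_function A u"
    and c: "c \<in> A" "p \<in> fst c"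
  shows "gradient_length A g u p = tangent_length g (gradient g u) c p"
proof -
  have "chart_at A p \<in> A \<and> p \<in> fst (chart_at A p)"
    unfolding chart_at_def by (rule someI[where x = c]) (use c in auto)
  then show ?thesis
    unfolding gradient_length_def
    using c by (intro gradient_length_change[OF assms(1-3)]) auto
qed

end

theory Submission
  imports Defs
begin

text \<open>
  The proof uses only the maximum principle, applied to three auxiliary functions in coordinates.
  Let \<open>\<Gamma>(f) = |\<nabla>f|\<^sup>2 = \<Sum>\<^sub>i\<^sub>j g\<^sup>i\<^sup>j \<partial>\<^sub>if \<partial>\<^sub>jf\<close> and let \<open>L\<close> be the negative of the positive Laplacian, so that
  \<open>L e = -\<lambda>\<^sup>2 e\<close> for an eigenfunction \<open>e\<close>; put \<open>M = max |e|\<close>.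

  Upper bound. Consider \<open>P = \<Gamma>(e) + K \<lambda>\<^sup>2 e\<^sup>2\<close> at a point where it is maximal over the compact manifold.
  If this is an interior point, then \<open>L P \<le> 0\<close> there, whereas Bernstein's computation
  (\<open>bochner_inequality\<close>) gives \<open>L P \<ge> 2 (K - 1) \<lambda>\<^sup>2 \<Gamma>(e) - C \<Gamma>(e) - 2 K \<lambda>\<^sup>4 e\<^sup>2\<close>; for large \<open>K\<close> this yields
  \<open>\<Gamma>(e) \<le> K \<lambda>\<^sup>2 e\<^sup>2\<close> at that point (\<open>bernstein_interior\<close>). If it is a boundary point, then \<open>P = \<Gamma>(e)\<close> is
  the square of the normal derivative, which an explicit quadratic barrier on a half ball of radius
  comparable to \<open>1/\<lambda>\<close> bounds by a multiple of \<open>\<lambda> M\<close> (\<open>boundary_barrier\<close>, \<open>boundary_normal_derivative\<close>).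
  In both cases \<open>\<Gamma>(e) \<le> max P\<close> is at most a constant times \<open>\<lambda>\<^sup>2 M\<^sup>2\<close> everywhere.

  Lower bound. Near a point \<open>q\<close> with \<open>e(q) > 0\<close>, the minimum of \<open>e + \<alpha> \<lambda>\<^sup>2 e(q) |x - q|\<^sup>2\<close> over a (half) ball
  of radius comparable to \<open>1/\<lambda>\<close> is at most \<open>e(q)\<close>, and by the maximum principle it cannot be
  attained at an interior point where \<open>e\<close> is still comparable to \<open>e(q)\<close>. Hence \<open>e\<close> drops by a fixed fraction
  of \<open>e(q)\<close> over a distance comparable to \<open>1/\<lambda>\<close>, so that its gradient is somewhere at least a multiple of
  \<open>\<lambda> e(q)\<close> (\<open>value_le_gradient_bound\<close>). If the ball meets the boundary, the condition \<open>e = 0\<close>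
  there only helps.

  All three estimates are local with locally uniform constants, because the coefficients of \<open>L\<close> in a
  chart extend smoothly across the boundary (\<open>local_coefficients_exist\<close>); compactness makes the
  constants uniform. Eigenfunctions are smooth up to the boundary by definition, so no regularity theory
  enters. Two facts make the coordinate arguments global: the length of the gradient does not
  depend on the chart, so \<open>P\<close> is a function on the manifold, and neither does the boundary
  (\<open>boundary_chart_independent\<close>), so that the equation holds at every point off the hyperplane.
\<close>

section \<open>Smooth real-valued functions on open sets\<close>

lemma Ck_on_Suc_imp: "Ck_on (Suc k) U f \<Longrightarrow> Ck_on k U f"
proof (induction k arbitrary: f)
  case 0
  then have "\<forall>x\<in>U. isCont f x"
    by (auto dest: has_derivative_continuous)
  then show ?case by (simp add: continuous_at_imp_continuous_on)
next
  case (Suc k)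
  obtain f' where f': "\<forall>x\<in>U. (f has_derivative f' x) (at x)" "\<forall>v. Ck_on (Suc k) U (\<lambda>x. f' x v)"
    using Suc.prems by (subst (asm) Ck_on.simps(2)) blast
  have "\<forall>v. Ck_on k U (\<lambda>x. f' x v)" using f'(2) Suc.IH by blast
  then show ?case using f'(1) by (subst Ck_on.simps(2)) blast
qed

lemma Ck_on_subset: "Ck_on k U f \<Longrightarrow> V \<subseteq> U \<Longrightarrow> Ck_on k V f"
proof (induction k arbitrary: f)
  case 0
  then show ?case by (auto intro: continuous_on_subset)
next
  case (Suc k)
  then show ?case by (simp only: Ck_on.simps(2)) (meson subsetD)
qed

lemma Ck_on_cong:
  assumes "Ck_on k U f" "open U" "\<And>x. x \<in> U \<Longrightarrow> f x = g x"
  shows "Ck_on k U g"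
proof (cases k)
  case 0
  then show ?thesis using assms by (simp cong: continuous_on_cong)
next
  case (Suc m)
  obtain f' where f': "\<forall>x\<in>U. (f has_derivative f' x) (at x)" "\<forall>v. Ck_on m U (\<lambda>x. f' x v)"
    using assms(1) unfolding Suc by auto
  have "\<forall>x\<in>U. (g has_derivative f' x) (at x)"
    using f'(1) has_derivative_transform_within_open[OF _ assms(2)] assms(3) by blast
  then show ?thesis using f'(2) Suc by auto
qed

lemma Ck_on_Suc_iff:
  assumes "open U"
  shows "Ck_on (Suc k) U f \<longleftrightarrow> (\<forall>x\<in>U. f differentiable (at x)) \<and>
           (\<forall>v. Ck_on k U (\<lambda>x. frechet_derivative f (at x) v))"
proof
  assume "Ck_on (Suc k) U f"
  then obtain f' where f': "\<forall>x\<in>U. (f has_derivative f' x) (at x)" "\<forall>v. Ck_on k U (\<lambda>x. f' x v)"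
    by auto
  then have "frechet_derivative f (at x) = f' x" if "x \<in> U" for x
    using that frechet_derivative_at by metis
  then show "(\<forall>x\<in>U. f differentiable (at x)) \<and>
           (\<forall>v. Ck_on k U (\<lambda>x. frechet_derivative f (at x) v))"
    using f' assms by (auto simp: differentiable_def intro: Ck_on_cong)
next
  assume "(\<forall>x\<in>U. f differentiable (at x)) \<and>
           (\<forall>v. Ck_on k U (\<lambda>x. frechet_derivative f (at x) v))"
  then show "Ck_on (Suc k) U f"
    by (auto intro!: exI[of _ "\<lambda>x. frechet_derivative f (at x)"] simp: frechet_derivative_works)
qed

text \<open>Being \<open>C\<^sup>k\<close> is a local property. In the definition the derivatives are chosen anew on every
  set; the Frechet derivative is a choice that all neighbourhoods share.\<close>

lemma Ck_on_local:
  assumes "open U" "\<And>x. x \<in> U \<Longrightarrow> \<exists>V. open V \<and> x \<in> V \<and> Ck_on k V f"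
  shows "Ck_on k U f"
  using assms(2)
proof (induction k arbitrary: f)
  case 0
  show ?case unfolding Ck_on.simps
  proof (rule continuous_at_imp_continuous_on, rule ballI)
    fix x assume "x \<in> U"
    then obtain V where "open V" "x \<in> V" "continuous_on V f" using 0 by force
    then show "isCont f x" using continuous_on_eq_continuous_at by blast
  qed
next
  case (Suc k)
  have *: "\<exists>V. open V \<and> x \<in> V \<and> f differentiable (at x) \<and>
      (\<forall>v. Ck_on k V (\<lambda>x. frechet_derivative f (at x) v))" if x: "x \<in> U" for x
  proof -
    obtain V where V: "open V" "x \<in> V" "Ck_on (Suc k) V f" using Suc.prems[OF x] by blast
    then show ?thesis using Ck_on_Suc_iff[OF V(1), of k f] by blast
  qed
  then have "f differentiable (at x)" if "x \<in> U" for x using that by blast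
  moreover have "Ck_on k U (\<lambda>x. frechet_derivative f (at x) v)" for v
    by (rule Suc.IH) (use * in blast)
  ultimately show ?case using Ck_on_Suc_iff[OF assms(1)] by blast
qed

lemma Ck_on_const: "Ck_on k U (\<lambda>x. c)"
proof (induction k arbitrary: c)
  case (Suc k)
  then show ?case by (auto intro!: exI[of _ "\<lambda>x v. 0"])
qed simp

lemma Ck_on_add: "Ck_on k U f \<Longrightarrow> Ck_on k U g \<Longrightarrow> Ck_on k U (\<lambda>x. f x + g x)"
proof (induction k arbitrary: f g)
  case (Suc k)
  obtain f' g' where
    f': "\<forall>x\<in>U. (f has_derivative f' x) (at x)" "\<forall>v. Ck_on k U (\<lambda>x. f' x v)" and
    g': "\<forall>x\<in>U. (g has_derivative g' x) (at x)" "\<forall>v. Ck_on k U (\<lambda>x. g' x v)"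
    using Suc.prems by auto
  show ?case unfolding Ck_on.simps
    by (rule exI[of _ "\<lambda>x v. f' x v + g' x v"]) (use f' g' Suc.IH in \<open>auto intro: has_derivative_add\<close>)
qed (simp add: continuous_on_add)

lemma Ck_on_mult:
  fixes f g :: "'b::euclidean_space \<Rightarrow> real"
  shows "Ck_on k U f \<Longrightarrow> Ck_on k U g \<Longrightarrow> Ck_on k U (\<lambda>x. f x * g x)"
proof (induction k arbitrary: f g)
  case (Suc k)
  obtain f' g' where
    f': "\<forall>x\<in>U. (f has_derivative f' x) (at x)" "\<forall>v. Ck_on k U (\<lambda>x. f' x v)" and
    g': "\<forall>x\<in>U. (g has_derivative g' x) (at x)" "\<forall>v. Ck_on k U (\<lambda>x. g' x v)"
    using Suc.prems by auto
  have "Ck_on k U f" "Ck_on k U g" using Suc.prems Ck_on_Suc_imp by blast+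
  then have "\<forall>v. Ck_on k U (\<lambda>x. f x * g' x v + f' x v * g x)"
    using f'(2) g'(2) Suc.IH by (auto intro!: Ck_on_add)
  moreover have "\<forall>x\<in>U. ((\<lambda>x. f x * g x) has_derivative (\<lambda>v. f x * g' x v + f' x v * g x)) (at x)"
    using f'(1) g'(1) by (auto intro: has_derivative_mult)
  ultimately show ?case unfolding Ck_on.simps
    by (intro exI[of _ "\<lambda>x v. f x * g' x v + f' x v * g x"]) blast
qed (simp add: continuous_on_mult)

lemma Ck_on_inverse:
  fixes f :: "'b::euclidean_space \<Rightarrow> real"
  assumes "\<And>x. x \<in> U \<Longrightarrow> f x \<noteq> 0"
  shows "Ck_on k U f \<Longrightarrow> Ck_on k U (\<lambda>x. inverse (f x))"
proof (induction k)
  case 0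
  then show ?case using assms by (auto intro!: continuous_on_inverse)
next
  case (Suc k)
  obtain f' where f': "\<forall>x\<in>U. (f has_derivative f' x) (at x)" "\<forall>v. Ck_on k U (\<lambda>x. f' x v)"
    using Suc.prems by auto
  have "Ck_on k U (\<lambda>x. inverse (f x))" using Suc Ck_on_Suc_imp by blast
  then have "\<forall>v. Ck_on k U (\<lambda>x. (-1) * (inverse (f x) * f' x v * inverse (f x)))"
    using f'(2) by (intro allI Ck_on_mult Ck_on_const) blast+
  moreover have "\<forall>x\<in>U. ((\<lambda>x. inverse (f x)) has_derivative
      (\<lambda>v. (-1) * (inverse (f x) * f' x v * inverse (f x)))) (at x)"
    using f'(1) assms by (auto dest: has_derivative_inverse)
  ultimately show ?case unfolding Ck_on.simps
    by (intro exI[of _ "\<lambda>x v. (-1) * (inverse (f x) * f' x v * inverse (f x))"]) blast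
qed

lemma Ck_on_sqrt:
  fixes f :: "'b::euclidean_space \<Rightarrow> real"
  assumes "\<And>x. x \<in> U \<Longrightarrow> 0 < f x"
  shows "Ck_on k U f \<Longrightarrow> Ck_on k U (\<lambda>x. sqrt (f x))"
proof (induction k)
  case 0
  then show ?case by (auto intro!: continuous_on_real_sqrt)
next
  case (Suc k)
  obtain f' where f': "\<forall>x\<in>U. (f has_derivative f' x) (at x)" "\<forall>v. Ck_on k U (\<lambda>x. f' x v)"
    using Suc.prems by auto
  have "Ck_on k U (\<lambda>x. sqrt (f x))" using Suc Ck_on_Suc_imp by blast
  then have "Ck_on k U (\<lambda>x. inverse (sqrt (f x)))"
    by (rule Ck_on_inverse[rotated]) (use assms in force)
  then have "\<forall>v. Ck_on k U (\<lambda>x. f' x v * (inverse (sqrt (f x)) * (1/2)))"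
    using f'(2) by (intro allI Ck_on_mult Ck_on_const) blast+
  moreover have "((\<lambda>x. sqrt (f x)) has_derivative
      (\<lambda>v. f' x v * (inverse (sqrt (f x)) * (1/2)))) (at x)" if "x \<in> U" for x
  proof -
    have "(f has_derivative f' x) (at x)" using f'(1) that by blast
    from has_derivative_real_sqrt[where g = f, OF _ this] assms[OF that] show ?thesis by simp
  qed
  ultimately show ?case unfolding Ck_on.simps
    by (intro exI[of _ "\<lambda>x v. f' x v * (inverse (sqrt (f x)) * (1/2))"]) blast
qed

lemma Ck_on_linear:
  fixes f :: "'b::euclidean_space \<Rightarrow> 'c::real_normed_vector"
  assumes "bounded_linear f"
  shows "Ck_on k U f"
proof (cases k)
  case 0
  then show ?thesis using assms linear_continuous_on by simp
next
  case (Suc m)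
  then show ?thesis using assms
    by (auto intro!: exI[of _ "\<lambda>x. f"] bounded_linear_imp_has_derivative Ck_on_const)
qed

text \<open>Smoothness on an open set. The set is required to be open as part of the predicate, so that the
  closure rules below need no separate openness assumption.\<close>

definition smooth_open :: "(real^'n::finite) set \<Rightarrow> (real^'n \<Rightarrow> real) \<Rightarrow> bool" where
  "smooth_open W f \<longleftrightarrow> open W \<and> (\<forall>k. Ck_on k W f)"

text \<open>The \<open>i\<close>-th partial derivative; meaningful at points of differentiability.\<close>

definition pd :: "'n::finite \<Rightarrow> (real^'n \<Rightarrow> real) \<Rightarrow> real^'n \<Rightarrow> real" where
  "pd i f x = frechet_derivative f (at x) (axis i 1)"

lemma smooth_open_open: "smooth_open W f \<Longrightarrow> open W"
  by (simp add: smooth_open_def)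

lemma smooth_open_subset: "smooth_open W f \<Longrightarrow> V \<subseteq> W \<Longrightarrow> open V \<Longrightarrow> smooth_open V f"
  by (auto simp: smooth_open_def intro: Ck_on_subset)

lemma smooth_open_cong:
  "smooth_open W f \<Longrightarrow> (\<And>x. x \<in> W \<Longrightarrow> f x = g x) \<Longrightarrow> smooth_open W g"
  by (auto simp: smooth_open_def intro: Ck_on_cong)

lemma smooth_open_local:
  assumes "open W" "\<And>x. x \<in> W \<Longrightarrow> \<exists>V. x \<in> V \<and> smooth_open V f"
  shows "smooth_open W f"
  unfolding smooth_open_def
proof (intro conjI allI Ck_on_local assms(1))
  fix k x assume "x \<in> W"
  then show "\<exists>V. open V \<and> x \<in> V \<and> Ck_on k V f"
    using assms(2) unfolding smooth_open_def by blast
qed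

named_theorems smooth

lemma smooth_open_const [smooth]: "open W \<Longrightarrow> smooth_open W (\<lambda>x. c)"
  by (simp add: smooth_open_def Ck_on_const)

lemma smooth_open_add [smooth]:
  "smooth_open W f \<Longrightarrow> smooth_open W g \<Longrightarrow> smooth_open W (\<lambda>x. f x + g x)"
  by (simp add: smooth_open_def Ck_on_add)

lemma smooth_open_mult [smooth]:
  "smooth_open W f \<Longrightarrow> smooth_open W g \<Longrightarrow> smooth_open W (\<lambda>x. f x * g x)"
  by (simp add: smooth_open_def Ck_on_mult)

lemma smooth_open_minus [smooth]: "smooth_open W f \<Longrightarrow> smooth_open W (\<lambda>x. - f x)"
  using smooth_open_mult[OF smooth_open_const[of W "-1"], of f] smooth_open_open by fastforce

lemma smooth_open_diff [smooth]:
  "smooth_open W f \<Longrightarrow> smooth_open W g \<Longrightarrow> smooth_open W (\<lambda>x. f x - g x)"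
  using smooth_open_add[OF _ smooth_open_minus[of W g], of f] by simp

lemma smooth_open_sum [smooth]:
  "open W \<Longrightarrow> (\<And>i. i \<in> I \<Longrightarrow> smooth_open W (f i)) \<Longrightarrow> smooth_open W (\<lambda>x. \<Sum>i\<in>I. f i x)"
  by (induction I rule: infinite_finite_induct) (auto intro!: smooth)

lemma smooth_open_prod [smooth]:
  "open W \<Longrightarrow> (\<And>i. i \<in> I \<Longrightarrow> smooth_open W (f i)) \<Longrightarrow> smooth_open W (\<lambda>x. \<Prod>i\<in>I. f i x)"
  by (induction I rule: infinite_finite_induct) (auto intro!: smooth)

lemma smooth_open_inverse [smooth]:
  "smooth_open W f \<Longrightarrow> (\<And>x. x \<in> W \<Longrightarrow> f x \<noteq> 0) \<Longrightarrow> smooth_open W (\<lambda>x. inverse (f x))"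
  by (simp add: smooth_open_def Ck_on_inverse)

lemma smooth_open_divide [smooth]:
  "smooth_open W f \<Longrightarrow> smooth_open W g \<Longrightarrow> (\<And>x. x \<in> W \<Longrightarrow> g x \<noteq> 0) \<Longrightarrow>
    smooth_open W (\<lambda>x. f x / g x)"
  by (simp add: divide_inverse smooth)

lemma smooth_open_sqrt [smooth]:
  "smooth_open W f \<Longrightarrow> (\<And>x. x \<in> W \<Longrightarrow> 0 < f x) \<Longrightarrow> smooth_open W (\<lambda>x. sqrt (f x))"
  by (simp add: smooth_open_def Ck_on_sqrt)

lemma smooth_open_component [smooth]: "open W \<Longrightarrow> smooth_open W (\<lambda>x. x $ i)"
  by (simp add: smooth_open_def Ck_on_linear bounded_linear_vec_nth)

lemma smooth_open_differentiable:
  "smooth_open W f \<Longrightarrow> x \<in> W \<Longrightarrow> f differentiable (at x)"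
  unfolding smooth_open_def using Ck_on_Suc_iff by blast

lemma smooth_open_continuous: "smooth_open W f \<Longrightarrow> continuous_on W f"
  unfolding smooth_open_def using Ck_on.simps(1) by blast

lemma smooth_open_pd [smooth]: "smooth_open W f \<Longrightarrow> smooth_open W (pd i f)"
  unfolding smooth_open_def pd_def[abs_def] using Ck_on_Suc_iff by blast

lemma has_derivative_pd:
  assumes "f differentiable (at x)"
  shows "(f has_derivative (\<lambda>v. \<Sum>i\<in>UNIV. v $ i * pd i f x)) (at x)"
proof -
  have d: "(f has_derivative frechet_derivative f (at x)) (at x)"
    using assms frechet_derivative_works by blast
  then have lin: "linear (frechet_derivative f (at x))" by (rule has_derivative_linear)
  have "frechet_derivative f (at x) v = (\<Sum>i\<in>UNIV. v $ i * pd i f x)" for v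
  proof -
    have "frechet_derivative f (at x) v = frechet_derivative f (at x) (\<Sum>i\<in>UNIV. (v $ i) *\<^sub>R axis i 1)"
      using basis_expansion[of v] by (simp add: scalar_mult_eq_scaleR)
    also have "\<dots> = (\<Sum>i\<in>UNIV. v $ i * pd i f x)"
      using lin by (simp add: linear_sum linear_cmul pd_def)
    finally show ?thesis .
  qed
  then show ?thesis using d by presburger
qed

lemma pd_eqI: "(f has_derivative f') (at x) \<Longrightarrow> pd i f x = f' (axis i 1)"
  unfolding pd_def using frechet_derivative_at by metis

lemma pd_cong:
  assumes "open W" "x \<in> W" "\<And>y. y \<in> W \<Longrightarrow> f y = g y"
  shows "pd i f x = pd i g x"
proof -
  have "(f has_derivative D) (at x) \<longleftrightarrow> (g has_derivative D) (at x)" for D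
    using has_derivative_transform_within_open[OF _ assms(1,2)] assms(3) by metis
  then show ?thesis unfolding pd_def frechet_derivative_def by simp
qed

lemma pd_const [simp]: "pd i (\<lambda>x. c) x = 0"
  by (subst pd_eqI) (rule derivative_eq_intros, auto)

lemma pd_component: "pd i (\<lambda>x. x $ j) x = (if i = j then 1 else 0)"
  by (subst pd_eqI[OF bounded_linear_imp_has_derivative[OF bounded_linear_vec_nth]]) (simp add: axis_def)

lemma pd_add:
  assumes "f differentiable (at x)" "g differentiable (at x)"
  shows "pd i (\<lambda>x. f x + g x) x = pd i f x + pd i g x"
  using assms[unfolded frechet_derivative_works] by (subst pd_eqI[OF has_derivative_add]) (auto simp: pd_def)

lemma pd_diff:
  assumes "f differentiable (at x)" "g differentiable (at x)"
  shows "pd i (\<lambda>x. f x - g x) x = pd i f x - pd i g x"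
  using assms[unfolded frechet_derivative_works] by (subst pd_eqI[OF has_derivative_diff]) (auto simp: pd_def)

lemma pd_mult:
  assumes "f differentiable (at x)" "g differentiable (at x)"
  shows "pd i (\<lambda>x. f x * g x) x = f x * pd i g x + pd i f x * g x"
  using assms[unfolded frechet_derivative_works] by (subst pd_eqI[OF has_derivative_mult]) (auto simp: pd_def)

lemma pd_cmult:
  assumes "f differentiable (at x)"
  shows "pd i (\<lambda>x. c * f x) x = c * pd i f x"
  using pd_mult[of "\<lambda>x. c" x f i] assms by simp

lemma pd_sum:
  assumes "\<And>j. j \<in> J \<Longrightarrow> f j differentiable (at x)"
  shows "pd i (\<lambda>x. \<Sum>j\<in>J. f j x) x = (\<Sum>j\<in>J. pd i (f j) x)"
  using assms[unfolded frechet_derivative_works] by (subst pd_eqI[OF has_derivative_sum]) (auto simp: pd_def)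

text \<open>The mean value theorem, applied twice to a second difference quotient.\<close>

lemma second_difference:
  fixes f :: "real^'n::finite \<Rightarrow> real"
  assumes f: "smooth_open W f" and W: "ball x r \<subseteq> W" and e: "0 < e" "2 * e < r"
  shows "\<exists>z\<in>ball x r. f (x + e *\<^sub>R axis i 1 + e *\<^sub>R axis j 1) - f (x + e *\<^sub>R axis i 1)
            - f (x + e *\<^sub>R axis j 1) + f x = e\<^sup>2 * pd j (pd i f) z"
proof -
  let ?u = "axis i 1 :: real^'n" and ?v = "axis j 1 :: real^'n"
  have in_ball: "x + s *\<^sub>R ?u + t *\<^sub>R ?v \<in> ball x r" if "0 \<le> s" "s \<le> e" "0 \<le> t" "t \<le> e" for s t
  proof -
    have "norm (s *\<^sub>R ?u + t *\<^sub>R ?v) \<le> norm (s *\<^sub>R ?u) + norm (t *\<^sub>R ?v)" by (rule norm_triangle_ineq)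
    also have "\<dots> < r" using that e by simp
    finally have "dist x (x + (s *\<^sub>R ?u + t *\<^sub>R ?v)) < r"
      by (simp only: dist_norm norm_minus_commute[of x]) (simp add: add_diff_cancel_left')
    then show ?thesis by (simp add: add.assoc)
  qed
  have along: "((\<lambda>t. h (p + t *\<^sub>R w)) has_field_derivative frechet_derivative h (at (p + t *\<^sub>R w)) w) (at t)"
    if "h differentiable (at (p + t *\<^sub>R w))" for h :: "real^'n \<Rightarrow> real" and p w t
  proof -
    have "((\<lambda>t. h (p + t *\<^sub>R w)) has_derivative (\<lambda>s. frechet_derivative h (at (p + t *\<^sub>R w)) (s *\<^sub>R w))) (at t)"
      by (rule has_derivative_compose[of "\<lambda>t. p + t *\<^sub>R w" "\<lambda>s. s *\<^sub>R w" t UNIV h])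
         (use that in \<open>auto simp: frechet_derivative_works intro!: derivative_eq_intros\<close>)
    moreover have "linear (frechet_derivative h (at (p + t *\<^sub>R w)))"
      using that by (simp add: linear_frechet_derivative)
    ultimately show ?thesis unfolding has_field_derivative_def by (simp add: linear_cmul mult.commute[of _ "frechet_derivative _ _ _"])
  qed
  have dif: "f differentiable (at (x + s *\<^sub>R ?u + t *\<^sub>R ?v))"
      "pd i f differentiable (at (x + s *\<^sub>R ?u + t *\<^sub>R ?v))"
    if "0 \<le> s" "s \<le> e" "0 \<le> t" "t \<le> e" for s t
    using in_ball[OF that] W f smooth_open_differentiable smooth_open_pd by blast+
  define G where "G s = f (x + e *\<^sub>R ?v + s *\<^sub>R ?u) - f (x + s *\<^sub>R ?u)" for s
  have "\<exists>s>0. s < e \<and> G e - G 0 = (e - 0) * (pd i f (x + e *\<^sub>R ?v + s *\<^sub>R ?u) - pd i f (x + s *\<^sub>R ?u))"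
  proof (rule MVT2[OF e(1)])
    fix s assume "0 \<le> s" "s \<le> e"
    then show "(G has_real_derivative pd i f (x + e *\<^sub>R ?v + s *\<^sub>R ?u) - pd i f (x + s *\<^sub>R ?u)) (at s)"
      unfolding G_def pd_def using dif(1)[of s 0] dif(1)[of s e] e
      by (intro DERIV_diff along) (auto simp: add_ac)
  qed
  then obtain s where s: "0 < s" "s < e"
    "G e - G 0 = e * (pd i f (x + e *\<^sub>R ?v + s *\<^sub>R ?u) - pd i f (x + s *\<^sub>R ?u))" by auto
  define H where "H t = pd i f (x + s *\<^sub>R ?u + t *\<^sub>R ?v)" for t
  have "\<exists>t>0. t < e \<and> H e - H 0 = (e - 0) * pd j (pd i f) (x + s *\<^sub>R ?u + t *\<^sub>R ?v)"
  proof (rule MVT2[OF e(1)])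
    fix t assume "0 \<le> t" "t \<le> e"
    then show "(H has_real_derivative pd j (pd i f) (x + s *\<^sub>R ?u + t *\<^sub>R ?v)) (at t)"
      unfolding H_def pd_def[of j] using dif(2)[of s t] s by (intro along) auto
  qed
  then obtain t where t: "0 < t" "t < e" "H e - H 0 = e * pd j (pd i f) (x + s *\<^sub>R ?u + t *\<^sub>R ?v)" by auto
  show ?thesis
  proof (rule bexI)
    show "x + s *\<^sub>R ?u + t *\<^sub>R ?v \<in> ball x r" using in_ball s t by simp
    have "G e - G 0 = e\<^sup>2 * pd j (pd i f) (x + s *\<^sub>R ?u + t *\<^sub>R ?v)"
      using s(3) t(3) by (simp add: H_def add_ac power2_eq_square)
    then show "f (x + e *\<^sub>R ?u + e *\<^sub>R ?v) - f (x + e *\<^sub>R ?u)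
            - f (x + e *\<^sub>R ?v) + f x = e\<^sup>2 * pd j (pd i f) (x + s *\<^sub>R ?u + t *\<^sub>R ?v)"
      by (simp add: G_def add_ac)
  qed
qed

text \<open>Both mixed derivatives are values, at points near \<open>x\<close>, of the same symmetric second difference
  quotient; continuity then forces them to agree at \<open>x\<close>.\<close>

lemma pd_commute:
  assumes f: "smooth_open W f" and x: "x \<in> W"
  shows "pd i (pd j f) x = pd j (pd i f) x"
proof (rule ccontr)
  assume ne: "pd i (pd j f) x \<noteq> pd j (pd i f) x"
  define d where "d = \<bar>pd i (pd j f) x - pd j (pd i f) x\<bar> / 2"
  have d: "d > 0" using ne by (simp add: d_def)
  have "open W" using f smooth_open_open by blast
  have "isCont (pd i (pd j f)) x" "isCont (pd j (pd i f)) x"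
    using smooth_open_continuous[OF smooth_open_pd[OF smooth_open_pd[OF f]]] x
      continuous_on_eq_continuous_at[OF \<open>open W\<close>] by blast+
  then obtain r1 r2 where r: "r1 > 0" "r2 > 0"
    "\<And>z. dist z x < r1 \<Longrightarrow> dist (pd i (pd j f) z) (pd i (pd j f) x) < d"
    "\<And>z. dist z x < r2 \<Longrightarrow> dist (pd j (pd i f) z) (pd j (pd i f) x) < d"
    using d unfolding continuous_at_eps_delta by metis
  obtain r3 where r3: "r3 > 0" "ball x r3 \<subseteq> W" using \<open>open W\<close> x openE by blast
  define r where "r = min r1 (min r2 r3)"
  have rr: "0 < r" "r \<le> r1" "r \<le> r2" "ball x r \<subseteq> W" using r r3 by (auto simp: r_def)
  define e where "e = r / 3"
  have e: "0 < e" "2 * e < r" using rr by (auto simp: e_def)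
  obtain z1 z2 where z: "z1 \<in> ball x r" "z2 \<in> ball x r" 
    "e\<^sup>2 * pd j (pd i f) z1 = e\<^sup>2 * pd i (pd j f) z2"
    using second_difference[OF f rr(4) e, of i j] second_difference[OF f rr(4) e, of j i]
    by (auto simp: algebra_simps)
  then have "pd j (pd i f) z1 = pd i (pd j f) z2" using e by simp
  moreover have "dist (pd i (pd j f) z2) (pd i (pd j f) x) < d" "dist (pd j (pd i f) z1) (pd j (pd i f) x) < d"
    using z(1,2) rr by (intro r; simp add: dist_commute)+
  moreover have "2 * d = \<bar>pd i (pd j f) x - pd j (pd i f) x\<bar>" by (simp add: d_def)
  ultimately show False unfolding dist_real_def by arith
qed

section \<open>Second order operators and the maximum principle\<close>

lemma quadratic_form_shift:
  fixes a :: "'n::finite \<Rightarrow> 'n \<Rightarrow> real"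
  assumes sym: "\<And>i j. a i j = a j i"
  shows "(\<Sum>i\<in>UNIV. \<Sum>j\<in>UNIV. a i j * (v i + t * of_bool (i = k)) * (v j + t * of_bool (j = k))) =
    (\<Sum>i\<in>UNIV. \<Sum>j\<in>UNIV. a i j * v i * v j) + 2 * t * (\<Sum>i\<in>UNIV. a k i * v i) + t\<^sup>2 * a k k"
proof -
  have "(\<Sum>j\<in>UNIV. a i j * (v i + t * of_bool (i = k)) * (v j + t * of_bool (j = k))) =
    (\<Sum>j\<in>UNIV. a i j * v i * v j) + t * of_bool (i = k) * (\<Sum>j\<in>UNIV. a i j * v j)
     + t * (a i k * v i) + t\<^sup>2 * (of_bool (i = k) * a i k)" for i
  proof -
    have "a i j * (v i + t * of_bool (i = k)) * (v j + t * of_bool (j = k)) =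
       a i j * v i * v j + t * of_bool (i = k) * (a i j * v j)
       + (if j = k then t * (a i j * v i) + t\<^sup>2 * (of_bool (i = k) * a i j) else 0)" for j
      by (simp add: algebra_simps power2_eq_square)
    then show ?thesis by (simp add: sum.distrib sum_distrib_left)
  qed
  then have "(\<Sum>i\<in>UNIV. \<Sum>j\<in>UNIV. a i j * (v i + t * of_bool (i = k)) * (v j + t * of_bool (j = k))) =
    (\<Sum>i\<in>UNIV. (\<Sum>j\<in>UNIV. a i j * v i * v j) + t * of_bool (i = k) * (\<Sum>j\<in>UNIV. a i j * v j)
     + t * (a i k * v i) + t\<^sup>2 * (of_bool (i = k) * a i k))" by simp
  also have "\<dots> = (\<Sum>i\<in>UNIV. \<Sum>j\<in>UNIV. a i j * v i * v j) + t * (\<Sum>j\<in>UNIV. a k j * v j)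
     + t * (\<Sum>i\<in>UNIV. a i k * v i) + t\<^sup>2 * a k k"
  proof -
    have "(\<Sum>i\<in>UNIV. t * of_bool (i = k) * (\<Sum>j\<in>UNIV. a i j * v j)) = 
      (\<Sum>i\<in>UNIV. if i = k then t * (\<Sum>j\<in>UNIV. a i j * v j) else 0)"
      by (intro sum.cong) auto
    also have "\<dots> = t * (\<Sum>j\<in>UNIV. a k j * v j)" by simp
    finally have 1: "(\<Sum>i\<in>UNIV. t * of_bool (i = k) * (\<Sum>j\<in>UNIV. a i j * v j)) = t * (\<Sum>j\<in>UNIV. a k j * v j)" .
    have "(\<Sum>i\<in>UNIV. t\<^sup>2 * (of_bool (i = k) * a i k)) = (\<Sum>i\<in>UNIV. if i = k then t\<^sup>2 * a i k else 0)"
      by (intro sum.cong) auto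
    then have 2: "(\<Sum>i\<in>UNIV. t\<^sup>2 * (of_bool (i = k) * a i k)) = t\<^sup>2 * a k k" by simp
    show ?thesis by (simp only: sum.distrib 1 2) (simp add: sum_distrib_left)
  qed
  also have "\<dots> = (\<Sum>i\<in>UNIV. \<Sum>j\<in>UNIV. a i j * v i * v j) + 2 * t * (\<Sum>i\<in>UNIV. a k i * v i) + t\<^sup>2 * a k k"
    using sym by simp
  finally show ?thesis .
qed

text \<open>A positive semidefinite matrix is a sum of squares of linear forms, by symmetric Gaussian
  elimination of one index after the other.\<close>

lemma psd_sum_of_squares_aux:
  fixes a :: "'n::finite \<Rightarrow> 'n \<Rightarrow> real"
  assumes "finite S"
    and "\<And>i j. a i j = a j i"
    and "\<And>v. 0 \<le> (\<Sum>i\<in>UNIV. \<Sum>j\<in>UNIV. a i j * v i * v j)"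
    and "\<And>i j. i \<notin> S \<Longrightarrow> a i j = 0"
  shows "\<exists>w. \<forall>i j. a i j = (\<Sum>k\<in>S. w k i * w k j)"
  using assms
proof (induction S arbitrary: a rule: finite_induct)
  case empty
  then show ?case by simp
next
  case (insert k S a)
  note sym = insert.prems(1) and psd = insert.prems(2) and zero = insert.prems(3)
  have shift: "0 \<le> (\<Sum>i\<in>UNIV. \<Sum>j\<in>UNIV. a i j * v i * v j) + 2 * t * (\<Sum>i\<in>UNIV. a k i * v i) + t\<^sup>2 * a k k" for v t
    using psd[of "\<lambda>i. v i + t * of_bool (i = k)"] unfolding quadratic_form_shift[OF sym] .
  have "0 \<le> a k k" using shift[of "\<lambda>i. 0" 1] by simp
  show ?case
  proof (cases "a k k = 0")
    case True
    have "a k i = 0" for i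
    proof (rule ccontr)
      assume ne: "a k i \<noteq> 0"
      define t where "t = - (a i i + 1) / (2 * a k i)"
      have 1: "(\<Sum>j\<in>UNIV. a k j * of_bool (j = i)) = a k i"
        by (subst sum.remove[of _ i]) auto
      have "a l j * of_bool (l = i) * of_bool (j = i) = (if j = i then if l = i then a i i else 0 else 0)"
        for l j by simp
      then have 2: "(\<Sum>l\<in>UNIV. \<Sum>j\<in>UNIV. a l j * of_bool (l = i) * of_bool (j = i)) = a i i"
        by simp
      have "0 \<le> a i i + 2 * t * a k i" using shift[of "\<lambda>j. of_bool (j = i)" t] True 1 2 by simp
      also have "\<dots> = -1" using ne by (simp add: t_def field_simps)
      finally show False by simp
    qed
    then have "\<And>i j. i \<notin> S \<Longrightarrow> a i j = 0" using zero by (metis insert_iff)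
    then obtain w where w: "\<forall>i j. a i j = (\<Sum>k\<in>S. w k i * w k j)"
      using insert.IH[of a, OF sym psd] by blast
    have "(\<Sum>m\<in>insert k S. (w(k := \<lambda>i. 0)) m i * (w(k := \<lambda>i. 0)) m j) = (\<Sum>m\<in>S. w m i * w m j)" for i j
      using insert.hyps by (auto intro!: sum.cong)
    then show ?thesis using w by metis
  next
    case False
    then have pos: "0 < a k k" using \<open>0 \<le> a k k\<close> by simp
    define a' where "a' i j = a i j - a k i * a k j / a k k" for i j
    have sym': "a' i j = a' j i" for i j using sym by (simp add: a'_def mult.commute)
    have zero': "a' i j = 0" if "i \<notin> S" for i j
      using that zero[of i] sym[of k i] pos by (cases "i = k") (auto simp: a'_def)
    have psd': "0 \<le> (\<Sum>i\<in>UNIV. \<Sum>j\<in>UNIV. a' i j * v i * v j)" for v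
    proof -
      define q where "q = (\<Sum>i\<in>UNIV. a k i * v i)"
      have "(\<Sum>i\<in>UNIV. \<Sum>j\<in>UNIV. (a k i * a k j / a k k) * v i * v j) = q * q / a k k"
        unfolding q_def sum_product sum_divide_distrib by (intro sum.cong) auto
      then have "(\<Sum>i\<in>UNIV. \<Sum>j\<in>UNIV. a' i j * v i * v j) = (\<Sum>i\<in>UNIV. \<Sum>j\<in>UNIV. a i j * v i * v j) - q * q / a k k"
        by (simp add: a'_def left_diff_distrib sum_subtractf)
      moreover have "0 \<le> (\<Sum>i\<in>UNIV. \<Sum>j\<in>UNIV. a i j * v i * v j) + 2 * (- q / a k k) * q + (- q / a k k)\<^sup>2 * a k k"
        using shift[of v "- q / a k k"] unfolding q_def .
      moreover have "2 * (- q / a k k) * q + (- q / a k k)\<^sup>2 * a k k = - (q * q / a k k)"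
        using pos by (simp add: power2_eq_square field_simps)
      ultimately show ?thesis by linarith
    qed
    obtain w where w: "\<forall>i j. a' i j = (\<Sum>k\<in>S. w k i * w k j)"
      using insert.IH[of a', OF sym' psd' zero'] by blast
    define w' where "w' = w(k := \<lambda>i. a k i / sqrt (a k k))"
    have "(\<Sum>m\<in>insert k S. w' m i * w' m j) = a i j" for i j
    proof -
      have "(\<Sum>m\<in>insert k S. w' m i * w' m j) = w' k i * w' k j + (\<Sum>m\<in>S. w' m i * w' m j)"
        using insert.hyps by simp
      also have "(\<Sum>m\<in>S. w' m i * w' m j) = (\<Sum>m\<in>S. w m i * w m j)"
        using insert.hyps by (intro sum.cong) (auto simp: w'_def)
      also have "w' k i * w' k j = a k i * a k j / a k k"
        using pos by (simp add: w'_def)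
      finally show ?thesis using w[rule_format, of i j] by (simp add: a'_def)
    qed
    then show ?thesis by metis
  qed
qed

lemma psd_sum_of_squares:
  fixes a :: "'n::finite \<Rightarrow> 'n \<Rightarrow> real"
  assumes "\<And>i j. a i j = a j i"
    and "\<And>v. 0 \<le> (\<Sum>i\<in>UNIV. \<Sum>j\<in>UNIV. a i j * v i * v j)"
  shows "\<exists>w. \<forall>i j. a i j = (\<Sum>k\<in>(UNIV::'n set). w k i * w k j)"
  by (rule psd_sum_of_squares_aux[of UNIV a, OF _ assms]) auto

lemma pd_max_eq_0:
  assumes "smooth_open W v" "x \<in> W" "\<And>y. y \<in> W \<Longrightarrow> v y \<le> v x"
  shows "pd i v x = 0"
proof -
  have d: "(v has_derivative (\<lambda>u. \<Sum>i\<in>UNIV. u $ i * pd i v x)) (at x)"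
    using has_derivative_pd smooth_open_differentiable assms by blast
  have "(\<lambda>u. \<Sum>i\<in>UNIV. u $ i * pd i v x) = (\<lambda>u. 0)"
    using differential_zero_maxmin[OF assms(2) smooth_open_open[OF assms(1)] d] assms(3) by blast
  then show ?thesis using pd_eqI[OF d, of i] by metis
qed

lemma has_derivative_along:
  assumes "h differentiable (at (x + t *\<^sub>R w))"
  shows "((\<lambda>t. h (x + t *\<^sub>R w)) has_field_derivative (\<Sum>i\<in>UNIV. w $ i * pd i h (x + t *\<^sub>R w))) (at t)"
proof -
  have "((\<lambda>t. h (x + t *\<^sub>R w)) has_derivative
      (\<lambda>s. \<Sum>i\<in>UNIV. (s *\<^sub>R w) $ i * pd i h (x + t *\<^sub>R w))) (at t)"
    by (rule has_derivative_compose[of "\<lambda>t. x + t *\<^sub>R w" "\<lambda>s. s *\<^sub>R w" t UNIV h])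
       (use has_derivative_pd[OF assms] in \<open>auto intro!: derivative_eq_intros\<close>)
  moreover have "(\<lambda>s. \<Sum>i\<in>UNIV. (s *\<^sub>R w) $ i * pd i h (x + t *\<^sub>R w)) =
      (*) (\<Sum>i\<in>UNIV. w $ i * pd i h (x + t *\<^sub>R w))"
    by (auto simp: fun_eq_iff sum_distrib_left mult_ac)
  ultimately show ?thesis unfolding has_field_derivative_def by simp
qed

lemma second_derivative_max:
  assumes v: "smooth_open W v" and x: "x \<in> W" and max: "\<And>y. y \<in> W \<Longrightarrow> v y \<le> v x"
  shows "(\<Sum>k\<in>UNIV. \<Sum>l\<in>UNIV. w $ k * w $ l * pd k (pd l v) x) \<le> 0"
proof (rule ccontr)
  define s where "s = (\<Sum>k\<in>UNIV. \<Sum>l\<in>UNIV. w $ k * w $ l * pd k (pd l v) x)"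
  assume "\<not> ?thesis"
  then have s: "s > 0" by (simp add: s_def)
  have "open W" using v smooth_open_open by blast
  have "open ((\<lambda>t. x + t *\<^sub>R w) -` W)"
    by (rule open_vimage[OF \<open>open W\<close>]) (intro continuous_intros)
  then have "\<forall>\<^sub>F t in nhds (0::real). x + t *\<^sub>R w \<in> W"
    using x by (auto simp: eventually_nhds)
  then obtain d0 where d0: "d0 > 0" "\<And>t. \<bar>t\<bar> < d0 \<Longrightarrow> x + t *\<^sub>R w \<in> W"
    unfolding eventually_nhds_metric by (auto simp: dist_real_def)
  define \<phi> where "\<phi> t = v (x + t *\<^sub>R w)" for t
  define \<psi> where "\<psi> t = (\<Sum>l\<in>UNIV. w $ l * pd l v (x + t *\<^sub>R w))" for t
  have \<phi>: "(\<phi> has_field_derivative \<psi> t) (at t)" if "\<bar>t\<bar> < d0" for t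
    unfolding \<phi>_def \<psi>_def using d0(2)[OF that] v
    by (intro has_derivative_along smooth_open_differentiable) auto
  have "((\<lambda>t. \<Sum>l\<in>UNIV. w $ l * pd l v (x + t *\<^sub>R w)) has_field_derivative
      (\<Sum>l\<in>UNIV. w $ l * (\<Sum>k\<in>UNIV. w $ k * pd k (pd l v) (x + 0 *\<^sub>R w)))) (at 0)"
    using x v
    by (intro DERIV_sum DERIV_cmult has_derivative_along smooth_open_differentiable[of W]) (auto intro: smooth)
  moreover have "(\<Sum>l\<in>UNIV. w $ l * (\<Sum>k\<in>UNIV. w $ k * pd k (pd l v) (x + 0 *\<^sub>R w))) = s"
    unfolding s_def by (subst sum.swap) (simp add: sum_distrib_left mult_ac)
  ultimately have "(\<psi> has_field_derivative s) (at 0)" unfolding \<psi>_def by simp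
  then obtain d1 where d1: "d1 > 0" "\<And>h. 0 < h \<Longrightarrow> h < d1 \<Longrightarrow> \<psi> 0 < \<psi> h"
    using DERIV_pos_inc_right[of \<psi> s 0, OF _ s] by auto
  have "\<psi> 0 = 0"
    using pd_max_eq_0[OF v x max] by (simp add: \<psi>_def)
  define h where "h = min d0 d1 / 2"
  have h: "0 < h" "h < d0" "h < d1" using d0 d1 by (auto simp: h_def)
  obtain t where t: "0 < t" "t < h" "\<phi> h - \<phi> 0 = (h - 0) * \<psi> t"
    using MVT2[OF h(1), of \<phi> \<psi>] \<phi> h by auto
  have "\<psi> t > 0" using d1(2)[of t] t h \<open>\<psi> 0 = 0\<close> by simp
  then have "\<phi> h > \<phi> 0" using t h by (metis diff_gt_0_iff_gt diff_zero mult_pos_pos)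
  moreover have "\<phi> h \<le> \<phi> 0" using max[of "x + h *\<^sub>R w"] d0(2)[of h] h by (simp add: \<phi>_def)
  ultimately show False by simp
qed

text \<open>The operator \<open>\<Sum>\<^sub>k\<^sub>l a\<^sub>k\<^sub>l \<partial>\<^sub>k\<partial>\<^sub>l + \<Sum>\<^sub>k b\<^sub>k \<partial>\<^sub>k\<close>, in non-divergence form, and the bilinear form
  \<open>\<Sum>\<^sub>k\<^sub>l a\<^sub>k\<^sub>l \<partial>\<^sub>kf \<partial>\<^sub>lg\<close> that measures its failure to be a derivation (the carre du champ). When \<open>a\<close> is
  the inverse of a Riemannian metric, the value at \<open>(f, f)\<close> is the squared length of the gradient
  of \<open>f\<close>.\<close>

definition elliptic_op ::
    "('n::finite \<Rightarrow> 'n \<Rightarrow> real^'n \<Rightarrow> real) \<Rightarrow> ('n \<Rightarrow> real^'n \<Rightarrow> real) \<Rightarrow> (real^'n \<Rightarrow> real) \<Rightarrow> real^'n \<Rightarrow> real" where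
  "elliptic_op a b f x =
     (\<Sum>k\<in>UNIV. \<Sum>l\<in>UNIV. a k l x * pd k (pd l f) x) + (\<Sum>k\<in>UNIV. b k x * pd k f x)"

definition carre_du_champ ::
    "('n::finite \<Rightarrow> 'n \<Rightarrow> real^'n \<Rightarrow> real) \<Rightarrow> (real^'n \<Rightarrow> real) \<Rightarrow> (real^'n \<Rightarrow> real) \<Rightarrow> real^'n \<Rightarrow> real" where
  "carre_du_champ a f g x = (\<Sum>k\<in>UNIV. \<Sum>l\<in>UNIV. a k l x * (pd k f x * pd l g x))"

text \<open>The maximum principle. Writing \<open>a\<close> as a sum of squares turns the second order part into a sum
  of second derivatives along lines, each of which is nonpositive at a maximum.\<close>

lemma elliptic_op_max:
  fixes v :: "real^'n::finite \<Rightarrow> real"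
  assumes v: "smooth_open W v" "x \<in> W" "\<And>y. y \<in> W \<Longrightarrow> v y \<le> v x"
    and sym: "\<And>i j. a i j x = a j i x"
    and psd: "\<And>u. 0 \<le> (\<Sum>i\<in>UNIV. \<Sum>j\<in>UNIV. a i j x * u i * u j)"
  shows "elliptic_op a b v x \<le> 0"
proof -
  obtain w where w: "\<forall>i j. a i j x = (\<Sum>k\<in>(UNIV::'n set). w k i * w k j)"
    using psd_sum_of_squares[of "\<lambda>i j. a i j x", OF sym psd] by meson
  have "(\<Sum>k\<in>UNIV. \<Sum>l\<in>UNIV. a k l x * pd k (pd l v) x)
      = (\<Sum>k\<in>UNIV. \<Sum>l\<in>UNIV. \<Sum>m\<in>UNIV. w m k * w m l * pd k (pd l v) x)"
    by (simp add: w sum_distrib_right)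
  also have "\<dots> = (\<Sum>k\<in>UNIV. \<Sum>m\<in>UNIV. \<Sum>l\<in>UNIV. w m k * w m l * pd k (pd l v) x)"
    by (intro sum.cong refl sum.swap)
  also have "\<dots> = (\<Sum>m\<in>UNIV. \<Sum>k\<in>UNIV. \<Sum>l\<in>UNIV. w m k * w m l * pd k (pd l v) x)"
    by (rule sum.swap)
  also have "\<dots> \<le> 0"
  proof (rule sum_nonpos)
    fix m
    show "(\<Sum>k\<in>UNIV. \<Sum>l\<in>UNIV. w m k * w m l * pd k (pd l v) x) \<le> 0"
      using second_derivative_max[OF v, of "\<chi> i. w m i"] by simp
  qed
  finally have "(\<Sum>k\<in>UNIV. \<Sum>l\<in>UNIV. a k l x * pd k (pd l v) x) \<le> 0" .
  moreover have "pd k v x = 0" for k using pd_max_eq_0[OF v] by blast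
  ultimately show ?thesis by (simp add: elliptic_op_def)
qed

context
  fixes W :: "(real^'n::finite) set" and x :: "real^'n"
  assumes x: "x \<in> W"
begin

lemma pd_pd_add:
  assumes "smooth_open W f" "smooth_open W g"
  shows "pd k (pd l (\<lambda>y. f y + g y)) x = pd k (pd l f) x + pd k (pd l g) x"
proof -
  have "pd k (pd l (\<lambda>y. f y + g y)) x = pd k (\<lambda>y. pd l f y + pd l g y) x"
    using assms by (intro pd_cong[OF smooth_open_open[OF assms(1)] x] pd_add smooth_open_differentiable)
  also have "\<dots> = pd k (pd l f) x + pd k (pd l g) x"
    using assms x by (intro pd_add smooth_open_differentiable[of W] smooth)
  finally show ?thesis .
qed

lemma pd_pd_mult:
  assumes "smooth_open W f" "smooth_open W g"
  shows "pd k (pd l (\<lambda>y. f y * g y)) x = f x * pd k (pd l g) x + g x * pd k (pd l f) x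
           + pd k f x * pd l g x + pd l f x * pd k g x"
proof -
  have "pd k (pd l (\<lambda>y. f y * g y)) x = pd k (\<lambda>y. f y * pd l g y + pd l f y * g y) x"
    using assms by (intro pd_cong[OF smooth_open_open[OF assms(1)] x] pd_mult smooth_open_differentiable)
  also have "\<dots> = pd k (\<lambda>y. f y * pd l g y) x + pd k (\<lambda>y. pd l f y * g y) x"
    using assms x by (intro pd_add smooth_open_differentiable[of W] smooth)
  also have "\<dots> = (f x * pd k (pd l g) x + pd k f x * pd l g x)
      + (pd l f x * pd k g x + pd k (pd l f) x * g x)"
    using assms x by (intro arg_cong2[where f = "(+)"] pd_mult smooth_open_differentiable[of W] smooth)
  finally show ?thesis by (simp add: mult_ac)
qed

lemma elliptic_op_const: "open W \<Longrightarrow> elliptic_op a b (\<lambda>y. c) x = 0"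
proof -
  assume "open W"
  have "pd k (pd l (\<lambda>y. c)) x = 0" for k l
    using pd_cong[OF \<open>open W\<close> x, of "pd l (\<lambda>y. c)" "\<lambda>y. 0" k] by simp
  then show ?thesis by (simp add: elliptic_op_def)
qed

lemma elliptic_op_add:
  assumes "smooth_open W f" "smooth_open W g"
  shows "elliptic_op a b (\<lambda>y. f y + g y) x = elliptic_op a b f x + elliptic_op a b g x"
proof -
  have "pd k (\<lambda>y. f y + g y) x = pd k f x + pd k g x" for k
    using assms x by (intro pd_add smooth_open_differentiable)
  then show ?thesis using pd_pd_add[OF assms]
    by (simp add: elliptic_op_def sum.distrib distrib_left)
qed

lemma elliptic_op_mult:
  assumes "smooth_open W f" "smooth_open W g" and sym: "\<And>i j. a i j x = a j i x"
  shows "elliptic_op a b (\<lambda>y. f y * g y) x =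
    f x * elliptic_op a b g x + g x * elliptic_op a b f x + 2 * carre_du_champ a f g x"
proof -
  have 1: "pd k (\<lambda>y. f y * g y) x = f x * pd k g x + g x * pd k f x" for k
    using assms x by (subst pd_mult) (auto intro: smooth_open_differentiable)
  have "(\<Sum>k\<in>UNIV. \<Sum>l\<in>UNIV. a k l x * (pd l f x * pd k g x)) = (\<Sum>l\<in>UNIV. \<Sum>k\<in>UNIV. a k l x * (pd l f x * pd k g x))"
    by (rule sum.swap)
  also have "\<dots> = carre_du_champ a f g x" unfolding carre_du_champ_def using sym by simp
  finally have 2: "(\<Sum>k\<in>UNIV. \<Sum>l\<in>UNIV. a k l x * (pd l f x * pd k g x)) = carre_du_champ a f g x" .
  have "elliptic_op a b (\<lambda>y. f y * g y) x =
     (\<Sum>k\<in>UNIV. \<Sum>l\<in>UNIV. f x * (a k l x * pd k (pd l g) x) + g x * (a k l x * pd k (pd l f) x)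
           + a k l x * (pd k f x * pd l g x) + a k l x * (pd l f x * pd k g x))
     + (\<Sum>k\<in>UNIV. f x * (b k x * pd k g x) + g x * (b k x * pd k f x))"
    unfolding elliptic_op_def pd_pd_mult[OF assms(1,2)] 1
    by (intro arg_cong2[where f = "(+)"] sum.cong refl) (simp_all add: algebra_simps)
  also have "\<dots> = f x * elliptic_op a b g x + g x * elliptic_op a b f x + 2 * carre_du_champ a f g x"
    unfolding sum.distrib 2 by (simp add: elliptic_op_def carre_du_champ_def distrib_left sum_distrib_left)
  finally show ?thesis .
qed

lemma elliptic_op_cmult:
  assumes "smooth_open W f"
  shows "elliptic_op a b (\<lambda>y. c * f y) x = c * elliptic_op a b f x"
proof -
  have o: "open W" using assms smooth_open_open by blast
  have z: "pd k (pd l (\<lambda>y. c)) x = 0" for k l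
    using pd_cong[OF o x, of "pd l (\<lambda>y. c)" "\<lambda>y. 0" k] by simp
  have 1: "pd k (\<lambda>y. c * f y) x = c * pd k f x" for k
    using assms x by (intro pd_cmult smooth_open_differentiable)
  have 2: "pd k (pd l (\<lambda>y. c * f y)) x = c * pd k (pd l f) x" for k l
    using pd_pd_mult[OF smooth_open_const[OF o] assms] z by simp
  show ?thesis unfolding elliptic_op_def 1 2 by (simp add: sum_distrib_left distrib_left mult_ac)
qed

lemma elliptic_op_diff:
  assumes "smooth_open W f" "smooth_open W g"
  shows "elliptic_op a b (\<lambda>y. f y - g y) x = elliptic_op a b f x - elliptic_op a b g x"
  using elliptic_op_add[OF assms(1) smooth_open_mult[OF smooth_open_const[OF smooth_open_open[OF assms(1)], of "-1"] assms(2)], of a b]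
    elliptic_op_cmult[OF assms(2), of a b "-1"] by simp

lemma elliptic_op_sum:
  assumes "open W" "\<And>i. i \<in> I \<Longrightarrow> smooth_open W (f i)"
  shows "elliptic_op a b (\<lambda>y. \<Sum>i\<in>I. f i y) x = (\<Sum>i\<in>I. elliptic_op a b (f i) x)"
  using assms(2)
  by (induction I rule: infinite_finite_induct)
     (auto simp: elliptic_op_add elliptic_op_const assms(1) smooth)

text \<open>Differentiating the equation \<open>L f = c f\<close>. The third derivatives of \<open>f\<close> on the left are thereby
  traded for second and first derivatives.\<close>

lemma elliptic_op_pd:
  assumes a: "\<And>k l. smooth_open W (a k l)" and b: "\<And>k. smooth_open W (b k)" and f: "smooth_open W f"
    and eq: "\<And>y. y \<in> W \<Longrightarrow> elliptic_op a b f y = c * f y"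
  shows "elliptic_op a b (pd i f) x = c * pd i f x
    - (\<Sum>k\<in>UNIV. \<Sum>l\<in>UNIV. pd i (a k l) x * pd k (pd l f) x) - (\<Sum>k\<in>UNIV. pd i (b k) x * pd k f x)"
proof -
  have o: "open W" using f smooth_open_open by blast
  have d: "\<And>h. smooth_open W h \<Longrightarrow> h differentiable (at x)"
    using x smooth_open_differentiable by blast
  have comm: "pd i (pd k (pd l f)) x = pd k (pd l (pd i f)) x" for k l
  proof -
    have "pd i (pd k (pd l f)) x = pd k (pd i (pd l f)) x"
      by (rule pd_commute[OF smooth_open_pd[OF f] x])
    also have "\<dots> = pd k (pd l (pd i f)) x"
      by (rule pd_cong[OF o x]) (rule pd_commute[OF f])
    finally show ?thesis .
  qed
  have comm': "pd i (pd k f) x = pd k (pd i f) x" for k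
    by (rule pd_commute[OF f x])
  have "pd i (elliptic_op a b f) x = pd i (\<lambda>y. c * f y) x"
    by (rule pd_cong[OF o x]) (rule eq)
  also have "\<dots> = c * pd i f x" by (rule pd_cmult[OF d[OF f]])
  finally have 1: "pd i (elliptic_op a b f) x = c * pd i f x" .
  have "pd i (elliptic_op a b f) x =
      pd i (\<lambda>y. \<Sum>k\<in>UNIV. \<Sum>l\<in>UNIV. a k l y * pd k (pd l f) y) x + pd i (\<lambda>y. \<Sum>k\<in>UNIV. b k y * pd k f y) x"
    unfolding elliptic_op_def[abs_def] by (intro pd_add d smooth o a b f)
  also have "pd i (\<lambda>y. \<Sum>k\<in>UNIV. \<Sum>l\<in>UNIV. a k l y * pd k (pd l f) y) x =
      (\<Sum>k\<in>UNIV. pd i (\<lambda>y. \<Sum>l\<in>UNIV. a k l y * pd k (pd l f) y) x)"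
    by (intro pd_sum d smooth o a b f)
  also have "\<dots> = (\<Sum>k\<in>UNIV. \<Sum>l\<in>UNIV. pd i (\<lambda>y. a k l y * pd k (pd l f) y) x)"
    by (intro sum.cong refl pd_sum d smooth o a b f)
  also have "\<dots> = (\<Sum>k\<in>UNIV. \<Sum>l\<in>UNIV. a k l x * pd i (pd k (pd l f)) x + pd i (a k l) x * pd k (pd l f) x)"
    by (intro sum.cong refl pd_mult d smooth o a b f)
  also have "pd i (\<lambda>y. \<Sum>k\<in>UNIV. b k y * pd k f y) x = (\<Sum>k\<in>UNIV. pd i (\<lambda>y. b k y * pd k f y) x)"
    by (intro pd_sum d smooth o a b f)
  also have "\<dots> = (\<Sum>k\<in>UNIV. b k x * pd i (pd k f) x + pd i (b k) x * pd k f x)"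
    by (intro sum.cong refl pd_mult d smooth o a b f)
  finally show ?thesis
    unfolding 1 comm comm' sum.distrib by (simp add: elliptic_op_def[of a b "pd i f" x])
qed

end

section \<open>Bernstein's estimate at an interior point\<close>

text \<open>Pointwise bounds on the coefficients: symmetry, ellipticity with lower constant \<open>\<theta>\<close>, and
  the size bound \<open>\<Lambda>\<close> on the coefficients themselves and, in the second definition, on the first two
  derivatives of \<open>a\<close> and the first derivatives of \<open>b\<close>. All constants in the estimates below depend
  only on \<open>\<theta>\<close>, \<open>\<Lambda>\<close>, the dimension and, for the barriers, the radius of the half ball.\<close>

definition elliptic_at ::
    "real \<Rightarrow> real \<Rightarrow> ('n::finite \<Rightarrow> 'n \<Rightarrow> real^'n \<Rightarrow> real) \<Rightarrow> ('n \<Rightarrow> real^'n \<Rightarrow> real) \<Rightarrow> real^'n \<Rightarrow> bool" where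
  "elliptic_at \<theta> \<Lambda> a b x \<longleftrightarrow> (\<forall>i j. a i j x = a j i x) \<and>
     (\<forall>v. \<theta> * (\<Sum>i\<in>UNIV. (v i)\<^sup>2) \<le> (\<Sum>i\<in>UNIV. \<Sum>j\<in>UNIV. a i j x * v i * v j)) \<and>
     (\<forall>i j. \<bar>a i j x\<bar> \<le> \<Lambda>) \<and> (\<forall>i. \<bar>b i x\<bar> \<le> \<Lambda>)"

definition coeff_derivs_le ::
    "real \<Rightarrow> ('n::finite \<Rightarrow> 'n \<Rightarrow> real^'n \<Rightarrow> real) \<Rightarrow> ('n \<Rightarrow> real^'n \<Rightarrow> real) \<Rightarrow> real^'n \<Rightarrow> bool" where
  "coeff_derivs_le \<Lambda> a b x \<longleftrightarrow> (\<forall>i j k. \<bar>pd k (a i j) x\<bar> \<le> \<Lambda>) \<and>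
     (\<forall>i j k l. \<bar>pd k (pd l (a i j)) x\<bar> \<le> \<Lambda>) \<and> (\<forall>i k. \<bar>pd k (b i) x\<bar> \<le> \<Lambda>)"

lemma elliptic_atD:
  assumes "elliptic_at \<theta> \<Lambda> a b x"
  shows "a i j x = a j i x"
    and "\<theta> * (\<Sum>i\<in>UNIV. (v i)\<^sup>2) \<le> (\<Sum>i\<in>UNIV. \<Sum>j\<in>UNIV. a i j x * v i * v j)"
    and "\<bar>a i j x\<bar> \<le> \<Lambda>" and "\<bar>b i x\<bar> \<le> \<Lambda>"
  using assms unfolding elliptic_at_def by blast+

lemma elliptic_at_psd:
  assumes "elliptic_at \<theta> \<Lambda> a b x" "0 < \<theta>"
  shows "0 \<le> (\<Sum>i\<in>UNIV. \<Sum>j\<in>UNIV. a i j x * v i * v j)"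
  by (rule order_trans[OF _ elliptic_atD(2)[OF assms(1)]]) (use assms(2) in \<open>simp add: sum_nonneg\<close>)

text \<open>If \<open>a \<ge> \<theta>\<close> as quadratic forms, then \<open>tr (a h a h\<^sup>T) \<ge> \<theta>\<^sup>2 |h|\<^sup>2\<close>: split one factor \<open>a\<close> into
  squares and use the lower bound twice. This is the good term in Bernstein's argument.\<close>

lemma double_trace_ge:
  fixes a h :: "'n::finite \<Rightarrow> 'n \<Rightarrow> real"
  assumes sym: "\<And>i j. a i j = a j i" and \<theta>: "0 < \<theta>"
    and ell: "\<And>v. \<theta> * (\<Sum>i\<in>UNIV. (v i)\<^sup>2) \<le> (\<Sum>i\<in>UNIV. \<Sum>j\<in>UNIV. a i j * v i * v j)"
  shows "\<theta>\<^sup>2 * (\<Sum>i\<in>UNIV. \<Sum>k\<in>UNIV. (h i k)\<^sup>2)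
    \<le> (\<Sum>i\<in>UNIV. \<Sum>j\<in>UNIV. a i j * (\<Sum>k\<in>UNIV. \<Sum>l\<in>UNIV. a k l * (h i k * h j l)))"
proof -
  have psd: "0 \<le> (\<Sum>i\<in>UNIV. \<Sum>j\<in>UNIV. a i j * v i * v j)" for v
    by (rule order_trans[OF _ ell]) (use \<theta> in \<open>simp add: sum_nonneg\<close>)
  obtain w where w: "\<forall>i j. a i j = (\<Sum>k\<in>(UNIV::'n set). w k i * w k j)"
    using psd_sum_of_squares[OF sym psd] by blast
  define z where "z m i = (\<Sum>k\<in>UNIV. w m k * h i k)" for m i
  have expand: "(\<Sum>k\<in>UNIV. \<Sum>l\<in>UNIV. a k l * (h i k * h j l)) = (\<Sum>m\<in>UNIV. z m i * z m j)" for i j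
  proof -
    have "(\<Sum>k\<in>UNIV. \<Sum>l\<in>UNIV. a k l * (h i k * h j l))
        = (\<Sum>k\<in>UNIV. \<Sum>l\<in>UNIV. \<Sum>m\<in>UNIV. (w m k * h i k) * (w m l * h j l))"
      using w by (simp add: sum_distrib_left mult_ac)
    also have "\<dots> = (\<Sum>k\<in>UNIV. \<Sum>m\<in>UNIV. \<Sum>l\<in>UNIV. (w m k * h i k) * (w m l * h j l))"
      by (intro sum.cong refl sum.swap)
    also have "\<dots> = (\<Sum>m\<in>UNIV. \<Sum>k\<in>UNIV. \<Sum>l\<in>UNIV. (w m k * h i k) * (w m l * h j l))"
      by (rule sum.swap)
    finally show ?thesis by (simp add: z_def sum_product)
  qed
  have "\<theta>\<^sup>2 * (\<Sum>i\<in>UNIV. \<Sum>k\<in>UNIV. (h i k)\<^sup>2) = \<theta> * (\<Sum>i\<in>UNIV. \<theta> * (\<Sum>k\<in>UNIV. (h i k)\<^sup>2))"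
    by (simp add: power2_eq_square sum_distrib_left mult_ac)
  also have "\<dots> \<le> \<theta> * (\<Sum>i\<in>UNIV. \<Sum>k\<in>UNIV. \<Sum>l\<in>UNIV. a k l * h i k * h i l)"
    using \<theta> ell by (intro mult_left_mono sum_mono) auto
  also have "\<dots> = \<theta> * (\<Sum>i\<in>UNIV. \<Sum>m\<in>UNIV. z m i * z m i)"
    using expand by (simp add: mult.assoc)
  also have "\<dots> = (\<Sum>m\<in>UNIV. \<theta> * (\<Sum>i\<in>UNIV. (z m i)\<^sup>2))"
    by (subst sum.swap) (simp add: sum_distrib_left power2_eq_square)
  also have "\<dots> \<le> (\<Sum>m\<in>UNIV. \<Sum>i\<in>UNIV. \<Sum>j\<in>UNIV. a i j * z m i * z m j)"
    by (intro sum_mono ell)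
  also have "\<dots> = (\<Sum>i\<in>UNIV. \<Sum>m\<in>UNIV. \<Sum>j\<in>UNIV. a i j * z m i * z m j)"
    by (rule sum.swap)
  also have "\<dots> = (\<Sum>i\<in>UNIV. \<Sum>j\<in>UNIV. \<Sum>m\<in>UNIV. a i j * z m i * z m j)"
    by (intro sum.cong refl sum.swap)
  also have "\<dots> = (\<Sum>i\<in>UNIV. \<Sum>j\<in>UNIV. a i j * (\<Sum>k\<in>UNIV. \<Sum>l\<in>UNIV. a k l * (h i k * h j l)))"
    unfolding expand by (simp add: sum_distrib_left mult.assoc)
  finally show ?thesis .
qed

text \<open>A Bochner inequality in coordinates. With \<open>\<Gamma>(f) = \<Sum>\<^sub>i\<^sub>j a\<^sub>i\<^sub>j \<partial>\<^sub>if \<partial>\<^sub>jf\<close>, the product rule expands \<open>L \<Gamma>(f)\<close>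
  into a term controlling the full Hessian of \<open>f\<close> from below, the terms containing \<open>L \<partial>\<^sub>if\<close>, which the
  differentiated equation reduces to \<open>2 c \<Gamma>(f)\<close> plus lower order, and terms with derivatives of \<open>a\<close>. Every
  error is at most quadratic in (gradient, Hessian) with no pure Hessian square, so the Hessian term
  absorbs it up to a multiple of \<open>\<Gamma>(f)\<close>.\<close>

lemma bochner_inequality:
  fixes \<theta> \<Lambda> :: real and a :: "'n::finite \<Rightarrow> 'n \<Rightarrow> real^'n \<Rightarrow> real"
  defines "N \<equiv> real CARD('n)"
  defines "C \<equiv> ((6 * N * \<Lambda>\<^sup>2)\<^sup>2 / (4 * (2 * \<theta>\<^sup>2 / N\<^sup>2)) + (N\<^sup>2 + 3 * N) * \<Lambda>\<^sup>2) * (N / \<theta>)"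
  assumes \<theta>: "0 < \<theta>" and x: "x \<in> W"
    and a: "\<And>i j. smooth_open W (a i j)" and b: "\<And>i. smooth_open W (b i)" and f: "smooth_open W f"
    and ell: "elliptic_at \<theta> \<Lambda> a b x" and der: "coeff_derivs_le \<Lambda> a b x"
    and eq: "\<And>y. y \<in> W \<Longrightarrow> elliptic_op a b f y = c * f y"
  shows "elliptic_op a b (carre_du_champ a f f) x \<ge> (2 * c - C) * carre_du_champ a f f x"
proof -
  note sym = elliptic_atD(1)[OF ell]
  have N: "N > 0" by (simp add: N_def)
  have \<Lambda>: "\<Lambda> \<ge> 0" using elliptic_atD(4)[OF ell] abs_ge_zero order_trans by blast
  have o: "open W" using f smooth_open_open by blast
  let ?L = "elliptic_op a b" and ?G = "carre_du_champ a"
  \<comment> \<open>\<open>p\<close> and \<open>s\<close> are \<open>l\<^sup>1\<close> norms of gradient and Hessian, for which the sums of products factorize\<close>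
  define d where "d i = pd i f x" for i
  define h where "h i k = pd k (pd i f) x" for i k
  define p where "p = (\<Sum>i\<in>UNIV. \<bar>d i\<bar>)"
  define s where "s = (\<Sum>i\<in>UNIV. \<Sum>k\<in>UNIV. \<bar>h i k\<bar>)"
  have p0: "p \<ge> 0" and s0: "s \<ge> 0" by (simp_all add: p_def s_def sum_nonneg)
  have sf: "smooth_open W (pd i f)" for i using f by (rule smooth_open_pd)
  have s_swap: "(\<Sum>k\<in>UNIV. \<Sum>l\<in>UNIV. \<bar>h l k\<bar>) = s" unfolding s_def by (rule sum.swap)
  have absmult: "\<bar>u * v\<bar> \<le> U * \<bar>v\<bar>" if "\<bar>u\<bar> \<le> U" for u v U :: real
    using that by (simp add: abs_mult mult_right_mono)
  \<comment> \<open>the commutator of \<open>L\<close> with the partial derivatives\<close>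
  define e where "e j = ?L (pd j f) x - c * d j" for j
  have e_bound: "\<bar>e j\<bar> \<le> \<Lambda> * (s + p)" for j
  proof -
    have "e j = - ((\<Sum>k\<in>UNIV. \<Sum>l\<in>UNIV. pd j (a k l) x * h l k) + (\<Sum>k\<in>UNIV. pd j (b k) x * d k))"
      using elliptic_op_pd[OF x a b f eq, of j] by (simp add: e_def d_def h_def)
    then have "\<bar>e j\<bar> = \<bar>(\<Sum>k\<in>UNIV. \<Sum>l\<in>UNIV. pd j (a k l) x * h l k) + (\<Sum>k\<in>UNIV. pd j (b k) x * d k)\<bar>"
      by (simp only: abs_minus_cancel)
    also have "\<dots> \<le> (\<Sum>k\<in>UNIV. \<Sum>l\<in>UNIV. \<Lambda> * \<bar>h l k\<bar>) + (\<Sum>k\<in>UNIV. \<Lambda> * \<bar>d k\<bar>)"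
      using der unfolding coeff_derivs_le_def
      by (intro order_trans[OF abs_triangle_ineq] add_mono order_trans[OF sum_abs] sum_mono absmult) auto
    also have "\<dots> = \<Lambda> * (s + p)"
      by (simp add: distrib_left p_def flip: sum_distrib_left s_swap)
    finally show ?thesis .
  qed
  have La_bound: "\<bar>?L (a i j) x\<bar> \<le> (N\<^sup>2 + N) * \<Lambda>\<^sup>2" for i j
  proof -
    have "\<bar>?L (a i j) x\<bar> \<le> (\<Sum>k\<in>(UNIV::'n set). \<Sum>l\<in>(UNIV::'n set). \<Lambda> * \<Lambda>) + (\<Sum>k\<in>(UNIV::'n set). \<Lambda> * \<Lambda>)"
      unfolding elliptic_op_def
      using der elliptic_atD(3,4)[OF ell] \<Lambda> unfolding coeff_derivs_le_def
      by (intro order_trans[OF abs_triangle_ineq] add_mono order_trans[OF sum_abs] sum_mono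
           order_trans[OF absmult mult_left_mono]) auto
    also have "\<dots> = (N\<^sup>2 + N) * \<Lambda>\<^sup>2" by (simp add: N_def power2_eq_square algebra_simps)
    finally show ?thesis .
  qed
  have prod_pd: "pd l (\<lambda>y. pd i f y * pd j f y) x = d i * h j l + h i l * d j" for i j l
    unfolding d_def h_def using sf x by (intro pd_mult smooth_open_differentiable)
  have Ga_bound: "\<bar>?G (a i j) (\<lambda>y. pd i f y * pd j f y) x\<bar>
      \<le> N * \<Lambda>\<^sup>2 * (\<bar>d i\<bar> * (\<Sum>l\<in>UNIV. \<bar>h j l\<bar>) + \<bar>d j\<bar> * (\<Sum>l\<in>UNIV. \<bar>h i l\<bar>))" for i j
  proof -
    have "\<bar>?G (a i j) (\<lambda>y. pd i f y * pd j f y) x\<bar>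
        \<le> (\<Sum>k\<in>(UNIV::'n set). \<Sum>l\<in>UNIV. \<Lambda> * (\<Lambda> * (\<bar>d i\<bar> * \<bar>h j l\<bar> + \<bar>d j\<bar> * \<bar>h i l\<bar>)))"
      unfolding carre_du_champ_def
    proof (intro order_trans[OF sum_abs] sum_mono)
      fix k l
      have "\<bar>d i * h j l + h i l * d j\<bar> \<le> \<bar>d i\<bar> * \<bar>h j l\<bar> + \<bar>d j\<bar> * \<bar>h i l\<bar>"
        by (rule order_trans[OF abs_triangle_ineq]) (simp add: abs_mult mult.commute)
      then have "\<bar>pd k (a i j) x\<bar> * \<bar>d i * h j l + h i l * d j\<bar> \<le> \<Lambda> * (\<bar>d i\<bar> * \<bar>h j l\<bar> + \<bar>d j\<bar> * \<bar>h i l\<bar>)"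
        using der \<Lambda> unfolding coeff_derivs_le_def by (intro mult_mono) auto
      then show "\<bar>a k l x * (pd k (a i j) x * pd l (\<lambda>y. pd i f y * pd j f y) x)\<bar>
          \<le> \<Lambda> * (\<Lambda> * (\<bar>d i\<bar> * \<bar>h j l\<bar> + \<bar>d j\<bar> * \<bar>h i l\<bar>))"
        unfolding prod_pd abs_mult using mult_mono[OF elliptic_atD(3)[OF ell, of k l] _ \<Lambda>]
        by fastforce
    qed
    also have "\<dots> = N * \<Lambda>\<^sup>2 * (\<bar>d i\<bar> * (\<Sum>l\<in>UNIV. \<bar>h j l\<bar>) + \<bar>d j\<bar> * (\<Sum>l\<in>UNIV. \<bar>h i l\<bar>))"
      by (simp add: N_def power2_eq_square sum.distrib distrib_left sum_distrib_left mult_ac)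
    finally show ?thesis .
  qed
  have "?L (?G f f) x = (\<Sum>i\<in>UNIV. \<Sum>j\<in>UNIV. ?L (\<lambda>y. a i j y * (pd i f y * pd j f y)) x)"
    unfolding carre_du_champ_def[abs_def]
    by (subst elliptic_op_sum[OF x o] | intro sum.cong refl smooth o a sf)+
  also have "\<dots> = (\<Sum>i\<in>UNIV. \<Sum>j\<in>UNIV. a i j x * (d i * ?L (pd j f) x + d j * ?L (pd i f) x)
      + 2 * (a i j x * ?G (pd i f) (pd j f) x) + d i * d j * ?L (a i j) x
      + 2 * ?G (a i j) (\<lambda>y. pd i f y * pd j f y) x)"
  proof (intro sum.cong refl)
    fix i j
    show "?L (\<lambda>y. a i j y * (pd i f y * pd j f y)) x = a i j x * (d i * ?L (pd j f) x + d j * ?L (pd i f) x)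
      + 2 * (a i j x * ?G (pd i f) (pd j f) x) + d i * d j * ?L (a i j) x
      + 2 * ?G (a i j) (\<lambda>y. pd i f y * pd j f y) x"
      unfolding elliptic_op_mult[where a = a, OF x a smooth_open_mult[OF sf sf] sym]
        elliptic_op_mult[where a = a, OF x sf sf sym] d_def by (simp add: algebra_simps)
  qed
  also have "\<dots> = (\<Sum>i\<in>UNIV. \<Sum>j\<in>UNIV. a i j x * (d i * ?L (pd j f) x + d j * ?L (pd i f) x))
      + 2 * (\<Sum>i\<in>UNIV. \<Sum>j\<in>UNIV. a i j x * ?G (pd i f) (pd j f) x)
      + (\<Sum>i\<in>UNIV. \<Sum>j\<in>UNIV. d i * d j * ?L (a i j) x)
      + 2 * (\<Sum>i\<in>UNIV. \<Sum>j\<in>UNIV. ?G (a i j) (\<lambda>y. pd i f y * pd j f y) x)"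
    by (simp add: sum.distrib sum_distrib_left)
  finally have split: "?L (?G f f) x = (\<Sum>i\<in>UNIV. \<Sum>j\<in>UNIV. a i j x * (d i * ?L (pd j f) x + d j * ?L (pd i f) x))
      + 2 * (\<Sum>i\<in>UNIV. \<Sum>j\<in>UNIV. a i j x * ?G (pd i f) (pd j f) x)
      + (\<Sum>i\<in>UNIV. \<Sum>j\<in>UNIV. d i * d j * ?L (a i j) x)
      + 2 * (\<Sum>i\<in>UNIV. \<Sum>j\<in>UNIV. ?G (a i j) (\<lambda>y. pd i f y * pd j f y) x)" .
  have T1: "(\<Sum>i\<in>UNIV. \<Sum>j\<in>UNIV. a i j x * (d i * ?L (pd j f) x + d j * ?L (pd i f) x))
      \<ge> 2 * c * ?G f f x - 2 * N * \<Lambda>\<^sup>2 * (p * (s + p))"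
  proof -
    have "(\<Sum>i\<in>UNIV. \<Sum>j\<in>UNIV. a i j x * (d i * ?L (pd j f) x + d j * ?L (pd i f) x))
      = (\<Sum>i\<in>UNIV. \<Sum>j\<in>UNIV. 2 * c * (a i j x * (d i * d j)) + a i j x * (d i * e j + d j * e i))"
      unfolding e_def by (intro sum.cong refl) (simp add: algebra_simps)
    also have "\<dots> = 2 * c * ?G f f x + (\<Sum>i\<in>UNIV. \<Sum>j\<in>UNIV. a i j x * (d i * e j + d j * e i))"
      unfolding carre_du_champ_def by (simp add: sum.distrib sum_distrib_left d_def)
    finally have 1: "(\<Sum>i\<in>UNIV. \<Sum>j\<in>UNIV. a i j x * (d i * ?L (pd j f) x + d j * ?L (pd i f) x)) = \<dots>" .
    have "\<bar>\<Sum>i\<in>UNIV. \<Sum>j\<in>UNIV. a i j x * (d i * e j + d j * e i)\<bar>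
        \<le> (\<Sum>i\<in>UNIV. \<Sum>j\<in>UNIV. \<Lambda> * (\<bar>d i\<bar> * (\<Lambda> * (s + p)) + \<bar>d j\<bar> * (\<Lambda> * (s + p))))"
    proof (intro order_trans[OF sum_abs] sum_mono)
      fix i j
      have "\<bar>d i * e j + d j * e i\<bar> \<le> \<bar>d i\<bar> * (\<Lambda> * (s + p)) + \<bar>d j\<bar> * (\<Lambda> * (s + p))"
        by (rule order_trans[OF abs_triangle_ineq], unfold abs_mult)
           (intro add_mono mult_left_mono e_bound abs_ge_zero)
      then show "\<bar>a i j x * (d i * e j + d j * e i)\<bar> \<le> \<Lambda> * (\<bar>d i\<bar> * (\<Lambda> * (s + p)) + \<bar>d j\<bar> * (\<Lambda> * (s + p)))"
        unfolding abs_mult using elliptic_atD(3)[OF ell] \<Lambda> by (intro mult_mono) auto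
    qed
    also have "\<dots> = 2 * N * \<Lambda>\<^sup>2 * (p * (s + p))"
    proof -
      have "(\<Sum>i\<in>UNIV. \<Sum>j\<in>UNIV. \<Lambda> * (\<bar>d i\<bar> * (\<Lambda> * (s + p)) + \<bar>d j\<bar> * (\<Lambda> * (s + p))))
         = (\<Sum>i\<in>UNIV. \<Sum>j\<in>(UNIV::'n set). \<bar>d i\<bar> * (\<Lambda>\<^sup>2 * (s + p))) + (\<Sum>i\<in>(UNIV::'n set). \<Sum>j\<in>UNIV. \<bar>d j\<bar> * (\<Lambda>\<^sup>2 * (s + p)))"
        by (simp add: sum.distrib distrib_left sum_distrib_left power2_eq_square mult_ac)
      also have "\<dots> = N * (p * (\<Lambda>\<^sup>2 * (s + p))) + N * (p * (\<Lambda>\<^sup>2 * (s + p)))"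
      proof -
        have "(\<Sum>i\<in>UNIV. \<Sum>j\<in>(UNIV::'n set). \<bar>d i\<bar> * t) = N * (p * t)"
          "(\<Sum>i\<in>(UNIV::'n set). \<Sum>j\<in>UNIV. \<bar>d j\<bar> * t) = N * (p * t)" for t
          unfolding p_def by (simp_all add: N_def sum_distrib_left sum_distrib_right mult_ac)
        then show ?thesis by simp
      qed
      finally show ?thesis by (simp add: algebra_simps)
    qed
    finally show ?thesis unfolding 1 by linarith
  qed
  have T2: "(\<Sum>i\<in>UNIV. \<Sum>j\<in>UNIV. a i j x * ?G (pd i f) (pd j f) x) \<ge> \<theta>\<^sup>2 * (s\<^sup>2 / N\<^sup>2)"
  proof -
    have "(\<Sum>i\<in>UNIV. \<Sum>k\<in>UNIV. \<bar>h i k\<bar>)\<^sup>2 \<le> (\<Sum>i\<in>UNIV. (\<Sum>k\<in>UNIV. \<bar>h i k\<bar>)\<^sup>2) * N"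
      unfolding N_def by (rule sum_squared_le_sum_of_squares)
    also have "\<dots> \<le> (\<Sum>i\<in>UNIV. (\<Sum>k\<in>UNIV. \<bar>h i k\<bar>\<^sup>2) * N) * N"
      unfolding N_def by (intro mult_right_mono sum_mono sum_squared_le_sum_of_squares) auto
    also have "\<dots> = (\<Sum>i\<in>UNIV. \<Sum>k\<in>UNIV. (h i k)\<^sup>2) * N\<^sup>2"
      by (simp add: power2_eq_square mult_ac flip: sum_distrib_left)
    finally have "s\<^sup>2 / N\<^sup>2 \<le> (\<Sum>i\<in>UNIV. \<Sum>k\<in>UNIV. (h i k)\<^sup>2)"
      using N by (simp add: s_def field_simps)
    then have "\<theta>\<^sup>2 * (s\<^sup>2 / N\<^sup>2) \<le> \<theta>\<^sup>2 * (\<Sum>i\<in>UNIV. \<Sum>k\<in>UNIV. (h i k)\<^sup>2)"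
      by (intro mult_left_mono) auto
    also have "\<dots> \<le> (\<Sum>i\<in>UNIV. \<Sum>j\<in>UNIV. a i j x * (\<Sum>k\<in>UNIV. \<Sum>l\<in>UNIV. a k l x * (h i k * h j l)))"
      by (rule double_trace_ge[OF sym \<theta> elliptic_atD(2)[OF ell]])
    finally show ?thesis by (simp add: carre_du_champ_def h_def)
  qed
  have T3: "(\<Sum>i\<in>UNIV. \<Sum>j\<in>UNIV. d i * d j * ?L (a i j) x) \<ge> - ((N\<^sup>2 + N) * \<Lambda>\<^sup>2 * p\<^sup>2)"
  proof -
    have "\<bar>\<Sum>i\<in>UNIV. \<Sum>j\<in>UNIV. d i * d j * ?L (a i j) x\<bar> \<le> (\<Sum>i\<in>UNIV. \<Sum>j\<in>UNIV. \<bar>d i\<bar> * \<bar>d j\<bar> * ((N\<^sup>2 + N) * \<Lambda>\<^sup>2))"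
      by (intro order_trans[OF sum_abs] sum_mono, unfold abs_mult) (intro mult_left_mono La_bound, simp)
    also have "\<dots> = (N\<^sup>2 + N) * \<Lambda>\<^sup>2 * p\<^sup>2"
      unfolding p_def power2_eq_square[of "sum _ _"] sum_product by (simp add: sum_distrib_left sum_distrib_right mult_ac)
    finally show ?thesis by linarith
  qed
  have T4: "(\<Sum>i\<in>UNIV. \<Sum>j\<in>UNIV. ?G (a i j) (\<lambda>y. pd i f y * pd j f y) x) \<ge> - (2 * N * \<Lambda>\<^sup>2 * (p * s))"
  proof -
    have "\<bar>\<Sum>i\<in>UNIV. \<Sum>j\<in>UNIV. ?G (a i j) (\<lambda>y. pd i f y * pd j f y) x\<bar> \<le>
        (\<Sum>i\<in>UNIV. \<Sum>j\<in>UNIV. N * \<Lambda>\<^sup>2 * (\<bar>d i\<bar> * (\<Sum>l\<in>UNIV. \<bar>h j l\<bar>) + \<bar>d j\<bar> * (\<Sum>l\<in>UNIV. \<bar>h i l\<bar>)))"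
      by (intro order_trans[OF sum_abs] sum_mono Ga_bound)
    also have "\<dots> = N * \<Lambda>\<^sup>2 * ((\<Sum>i\<in>UNIV. \<Sum>j\<in>UNIV. \<bar>d i\<bar> * (\<Sum>l\<in>UNIV. \<bar>h j l\<bar>)) + (\<Sum>i\<in>UNIV. \<Sum>j\<in>UNIV. \<bar>d j\<bar> * (\<Sum>l\<in>UNIV. \<bar>h i l\<bar>)))"
      by (simp add: sum.distrib flip: sum_distrib_left)
    also have "(\<Sum>i\<in>UNIV. \<Sum>j\<in>UNIV. \<bar>d i\<bar> * (\<Sum>l\<in>UNIV. \<bar>h j l\<bar>)) = p * s"
      unfolding p_def s_def by (rule sum_product[symmetric])
    also have "(\<Sum>i\<in>UNIV. \<Sum>j\<in>UNIV. \<bar>d j\<bar> * (\<Sum>l\<in>UNIV. \<bar>h i l\<bar>)) = p * s"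
      unfolding p_def s_def by (subst sum.swap) (rule sum_product[symmetric])
    also have "N * \<Lambda>\<^sup>2 * (p * s + p * s) = 2 * N * \<Lambda>\<^sup>2 * (p * s)" by simp
    finally show ?thesis by (simp add: abs_le_iff)
  qed
  define \<alpha> where "\<alpha> = 2 * \<theta>\<^sup>2 / N\<^sup>2"
  define \<beta> where "\<beta> = 6 * N * \<Lambda>\<^sup>2"
  have \<alpha>: "\<alpha> > 0" using \<theta> N by (simp add: \<alpha>_def)
  \<comment> \<open>absorb the mixed term \<open>p s\<close> into the Hessian term\<close>
  have "0 \<le> (2 * \<alpha> * s - \<beta> * p)\<^sup>2 / (4 * \<alpha>)" using \<alpha> by simp
  also have "\<dots> = \<alpha> * s\<^sup>2 - \<beta> * (p * s) + \<beta>\<^sup>2 / (4 * \<alpha>) * p\<^sup>2"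
    using \<alpha> by (simp add: power2_eq_square field_simps)
  finally have AG: "\<alpha> * s\<^sup>2 - \<beta> * (p * s) \<ge> - (\<beta>\<^sup>2 / (4 * \<alpha>) * p\<^sup>2)" by linarith
  have "?L (?G f f) x \<ge> 2 * c * ?G f f x - 2 * N * \<Lambda>\<^sup>2 * (p * (s + p)) + 2 * (\<theta>\<^sup>2 * (s\<^sup>2 / N\<^sup>2))
      - (N\<^sup>2 + N) * \<Lambda>\<^sup>2 * p\<^sup>2 - 2 * (2 * N * \<Lambda>\<^sup>2 * (p * s))"
    unfolding split using T1 T2 T3 T4 by linarith
  also have "2 * c * ?G f f x - 2 * N * \<Lambda>\<^sup>2 * (p * (s + p)) + 2 * (\<theta>\<^sup>2 * (s\<^sup>2 / N\<^sup>2))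
      - (N\<^sup>2 + N) * \<Lambda>\<^sup>2 * p\<^sup>2 - 2 * (2 * N * \<Lambda>\<^sup>2 * (p * s))
      = 2 * c * ?G f f x + (\<alpha> * s\<^sup>2 - \<beta> * (p * s)) - (N\<^sup>2 + 3 * N) * \<Lambda>\<^sup>2 * p\<^sup>2"
    by (simp add: \<alpha>_def \<beta>_def power2_eq_square algebra_simps)
  finally have L1: "?L (?G f f) x \<ge> 2 * c * ?G f f x - (\<beta>\<^sup>2 / (4 * \<alpha>) + (N\<^sup>2 + 3 * N) * \<Lambda>\<^sup>2) * p\<^sup>2"
    using AG by (simp add: distrib_right)
  have "p\<^sup>2 \<le> (\<Sum>i\<in>UNIV. \<bar>d i\<bar>\<^sup>2) * N"
    unfolding p_def N_def by (rule sum_squared_le_sum_of_squares)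
  also have "\<dots> \<le> (?G f f x / \<theta>) * N"
  proof (intro mult_right_mono)
    have "\<theta> * (\<Sum>i\<in>UNIV. (d i)\<^sup>2) \<le> ?G f f x"
      using elliptic_atD(2)[OF ell, of d] by (simp add: carre_du_champ_def d_def mult.assoc)
    then show "(\<Sum>i\<in>UNIV. \<bar>d i\<bar>\<^sup>2) \<le> ?G f f x / \<theta>" using \<theta> by (simp add: field_simps)
  qed (use N in simp)
  finally have "(\<beta>\<^sup>2 / (4 * \<alpha>) + (N\<^sup>2 + 3 * N) * \<Lambda>\<^sup>2) * p\<^sup>2 \<le>
      (\<beta>\<^sup>2 / (4 * \<alpha>) + (N\<^sup>2 + 3 * N) * \<Lambda>\<^sup>2) * (?G f f x / \<theta> * N)"
    using \<alpha> N by (intro mult_left_mono) (auto intro!: add_nonneg_nonneg)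
  also have "\<dots> = C * ?G f f x" unfolding C_def \<alpha>_def \<beta>_def by (simp add: mult_ac)
  finally show ?thesis using L1 by (simp add: left_diff_distrib)
qed

text \<open>Bernstein's estimate. At an interior maximum of \<open>\<Gamma>(f) + K \<lambda>\<^sup>2 f\<^sup>2\<close> the operator applied to this
  function is nonpositive, while \<open>L (f\<^sup>2) = 2 \<Gamma>(f) - 2 \<lambda>\<^sup>2 f\<^sup>2\<close>. For \<open>K\<close> large the contribution
  \<open>2 K \<lambda>\<^sup>2 \<Gamma>(f)\<close> beats the loss in the Bochner inequality; here \<open>\<lambda> \<ge> 1\<close> is used to bound the curvature-type
  constant by a multiple of \<open>\<lambda>\<^sup>2\<close>.\<close>

lemma bernstein_interior:
  fixes \<theta> \<Lambda> :: real
  assumes \<theta>: "0 < \<theta>"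
  shows "\<exists>K0\<ge>0. \<forall>W (a :: 'n::finite \<Rightarrow> 'n \<Rightarrow> real^'n \<Rightarrow> real) b f x lam K.
    x \<in> W \<longrightarrow> (\<forall>i j. smooth_open W (a i j)) \<longrightarrow> (\<forall>i. smooth_open W (b i)) \<longrightarrow> smooth_open W f \<longrightarrow>
    elliptic_at \<theta> \<Lambda> a b x \<longrightarrow> coeff_derivs_le \<Lambda> a b x \<longrightarrow> 1 \<le> lam \<longrightarrow> K0 \<le> K \<longrightarrow>
    (\<forall>y\<in>W. elliptic_op a b f y = - lam\<^sup>2 * f y) \<longrightarrow>
    (\<forall>y\<in>W. carre_du_champ a f f y + K * lam\<^sup>2 * (f y)\<^sup>2 \<le> carre_du_champ a f f x + K * lam\<^sup>2 * (f x)\<^sup>2) \<longrightarrow>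
    carre_du_champ a f f x \<le> K * lam\<^sup>2 * (f x)\<^sup>2"
proof -
  define N where "N = real CARD('n)"
  define C where "C = ((6 * N * \<Lambda>\<^sup>2)\<^sup>2 / (4 * (2 * \<theta>\<^sup>2 / N\<^sup>2)) + (N\<^sup>2 + 3 * N) * \<Lambda>\<^sup>2) * (N / \<theta>)"
  have C: "C \<ge> 0" using \<theta> by (auto simp: C_def N_def intro!: mult_nonneg_nonneg add_nonneg_nonneg)
  show ?thesis
  proof (intro exI[of _ "2 + C / 2"] conjI allI impI)
    show "0 \<le> 2 + C / 2" using C by simp
  next
    fix W and a :: "'n \<Rightarrow> 'n \<Rightarrow> real^'n \<Rightarrow> real" and b f x and lam K :: real
    assume x: "x \<in> W" and a: "\<forall>i j. smooth_open W (a i j)" and b: "\<forall>i. smooth_open W (b i)"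
      and f: "smooth_open W f" and ell: "elliptic_at \<theta> \<Lambda> a b x" and der: "coeff_derivs_le \<Lambda> a b x"
      and lam: "1 \<le> lam" and K: "2 + C / 2 \<le> K"
      and eq: "\<forall>y\<in>W. elliptic_op a b f y = - lam\<^sup>2 * f y"
      and max: "\<forall>y\<in>W. carre_du_champ a f f y + K * lam\<^sup>2 * (f y)\<^sup>2 \<le> carre_du_champ a f f x + K * lam\<^sup>2 * (f x)\<^sup>2"
    let ?G = "carre_du_champ a f f" and ?L = "elliptic_op a b"
    note sym = elliptic_atD(1)[OF ell]
    have o: "open W" using f smooth_open_open by blast
    have sG: "smooth_open W ?G"
      unfolding carre_du_champ_def[abs_def] using a f o by (intro smooth) auto
    have sq: "smooth_open W (\<lambda>y. K * lam\<^sup>2 * (f y * f y))"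
      using f o by (intro smooth) auto
    have P: "smooth_open W (\<lambda>y. ?G y + K * lam\<^sup>2 * (f y * f y))" by (intro smooth sG sq)
    have m1: "?L (\<lambda>y. ?G y + K * lam\<^sup>2 * (f y * f y)) x \<le> 0"
      by (rule elliptic_op_max[where a = a, OF P x])
         (use max sym elliptic_at_psd[OF ell \<theta>] in \<open>simp_all add: power2_eq_square\<close>)
    have m2: "?L (\<lambda>y. ?G y + K * lam\<^sup>2 * (f y * f y)) x = ?L ?G x + K * lam\<^sup>2 * ?L (\<lambda>y. f y * f y) x"
      using elliptic_op_add[OF x sG sq] elliptic_op_cmult[OF x smooth_open_mult[OF f f]] by simp
    have m3: "?L (\<lambda>y. f y * f y) x = - 2 * lam\<^sup>2 * (f x)\<^sup>2 + 2 * ?G x"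
      using elliptic_op_mult[OF x f f, of a b] sym eq x by (simp add: power2_eq_square)
    have "?L ?G x \<ge> (2 * (- lam\<^sup>2) - C) * ?G x"
      unfolding C_def N_def using a b eq by (intro bochner_inequality[OF \<theta> x _ _ f ell der]) auto
    then have "(2 * (- lam\<^sup>2) - C) * ?G x + K * lam\<^sup>2 * (- 2 * lam\<^sup>2 * (f x)\<^sup>2 + 2 * ?G x) \<le> 0"
      using m1 unfolding m2 m3 by linarith
    then have 1: "(2 * K * lam\<^sup>2 - 2 * lam\<^sup>2 - C) * ?G x \<le> 2 * lam\<^sup>2 * (K * lam\<^sup>2 * (f x)\<^sup>2)"
      by (simp add: algebra_simps)
    have G0: "?G x \<ge> 0"
      using elliptic_at_psd[OF ell \<theta>, of "\<lambda>i. pd i f x"] by (simp add: carre_du_champ_def mult.assoc)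
    have l1: "1 \<le> lam\<^sup>2" using lam by simp
    have "C \<le> C * lam\<^sup>2" using mult_left_mono[OF l1 C] by simp
    moreover have "(2 + C / 2) * lam\<^sup>2 \<le> K * lam\<^sup>2" using K by (intro mult_right_mono) auto
    ultimately have "2 * lam\<^sup>2 \<le> 2 * K * lam\<^sup>2 - 2 * lam\<^sup>2 - C" by (simp add: distrib_right)
    then have "2 * lam\<^sup>2 * ?G x \<le> 2 * lam\<^sup>2 * (K * lam\<^sup>2 * (f x)\<^sup>2)"
      using 1 mult_right_mono[OF _ G0] order_trans by blast
    then show "?G x \<le> K * lam\<^sup>2 * (f x)\<^sup>2" using lam by simp
  qed
qed

section \<open>Barriers in a half ball\<close>

text \<open>A solution \<open>f\<close> of \<open>L f = -\<lambda>\<^sup>2 f\<close> in the part of the ball \<open>ball q R\<close> lying in the open half-space, continuous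
  up to the flat part of the boundary and zero there. The centre \<open>q\<close> may be at any distance from the
  hyperplane, so that full balls and half balls are covered alike.\<close>

definition dirichlet_half_ball ::
    "real \<Rightarrow> real \<Rightarrow> ('n::finite \<Rightarrow> 'n \<Rightarrow> real^'n \<Rightarrow> real) \<Rightarrow> ('n \<Rightarrow> real^'n \<Rightarrow> real) \<Rightarrow>
      real \<Rightarrow> real^'n \<Rightarrow> real \<Rightarrow> (real^'n \<Rightarrow> real) \<Rightarrow> bool" where
  "dirichlet_half_ball \<theta> \<Lambda> a b R q lam f \<longleftrightarrow>
     q \<in> half_space \<and> continuous_on (ball q R \<inter> half_space) f \<and>
     smooth_open (ball q R \<inter> {x. 0 < x $ bdry_coord}) f \<and>
     (\<forall>x\<in>ball q R \<inter> {x. 0 < x $ bdry_coord}.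
        elliptic_at \<theta> \<Lambda> a b x \<and> elliptic_op a b f x = - lam\<^sup>2 * f x) \<and>
     (\<forall>x\<in>ball q R. x $ bdry_coord = 0 \<longrightarrow> f x = 0)"

lemma open_half: "open {x::real^'n::finite. 0 < x $ i}"
  by (intro open_Collect_less continuous_intros)

lemma dirichlet_half_ball_minus:
  assumes "dirichlet_half_ball \<theta> \<Lambda> a b R q lam f"
  shows "dirichlet_half_ball \<theta> \<Lambda> a b R q lam (\<lambda>x. - f x)"
proof -
  let ?W = "ball q R \<inter> {x. 0 < x $ bdry_coord}"
  have s: "smooth_open ?W f" using assms by (simp add: dirichlet_half_ball_def)
  have "elliptic_op a b (\<lambda>x. - f x) x = - elliptic_op a b f x" if "x \<in> ?W" for x
    using elliptic_op_cmult[OF that s, of a b "-1"] by simp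
  then show ?thesis using assms s smooth_open_minus
    by (auto simp: dirichlet_half_ball_def intro!: continuous_on_minus)
qed

lemma pd_affine: "pd l (\<lambda>y. y $ i - c) y = (if l = i then 1 else 0)"
  using pd_diff[of "\<lambda>y. y $ i" y "\<lambda>y. c" l] smooth_open_component[of UNIV i]
  by (simp add: smooth_open_differentiable pd_component)

lemma elliptic_op_affine:
  assumes "x \<in> W" "open W"
  shows "elliptic_op a b (\<lambda>y. y $ i - c) x = b i x"
proof -
  have "pd k (pd l (\<lambda>y. y $ i - c)) x = 0" for k l
  proof -
    have "pd l (\<lambda>y. y $ i - c) = (\<lambda>y. if l = i then 1 else 0)" by (rule ext) (rule pd_affine)
    then show ?thesis by simp
  qed
  then show ?thesis by (simp add: elliptic_op_def pd_affine if_distrib cong: if_cong)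
qed

lemma elliptic_op_square:
  assumes "x \<in> W" "open W" and sym: "\<And>i j. a i j x = a j i x"
  shows "elliptic_op a b (\<lambda>y. (y $ i - c) * (y $ i - c)) x = 2 * (x $ i - c) * b i x + 2 * a i i x"
proof -
  have s: "smooth_open W (\<lambda>y. y $ i - c)" using assms by (intro smooth)
  have "carre_du_champ a (\<lambda>y. y $ i - c) (\<lambda>y. y $ i - c) x = a i i x"
  proof -
    have "a k l x * (pd k (\<lambda>y. y $ i - c) x * pd l (\<lambda>y. y $ i - c) x)
        = (if l = i then if k = i then a i i x else 0 else 0)" for k l
      by (simp add: pd_affine)
    then show ?thesis by (simp add: carre_du_champ_def)
  qed
  then show ?thesis
    using elliptic_op_mult[OF assms(1) s s, of a b] elliptic_op_affine[OF assms(1,2), of a b] sym by simp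
qed

text \<open>The squared distance to \<open>q\<close>, written as a polynomial in the coordinates.\<close>

definition dist_sq :: "real^'n::finite \<Rightarrow> real^'n \<Rightarrow> real" where
  "dist_sq q x = (\<Sum>i\<in>UNIV. (x $ i - q $ i) * (x $ i - q $ i))"

lemma dist_sq_eq: "dist_sq q x = (dist x q)\<^sup>2"
  by (simp add: dist_sq_def dist_norm power2_norm_eq_inner inner_vec_def)

lemma smooth_open_dist_sq [smooth]: "open W \<Longrightarrow> smooth_open W (dist_sq q)"
  unfolding dist_sq_def[abs_def] by (intro smooth)

lemma elliptic_op_dist_sq:
  fixes q :: "real^'n::finite"
  assumes x: "x \<in> W" and o: "open W" and ell: "elliptic_at \<theta> \<Lambda> a b x" and d: "dist x q \<le> 1"
  shows "elliptic_op a b (dist_sq q) x \<le> 4 * real CARD('n) * \<Lambda>"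
proof -
  have \<Lambda>: "\<Lambda> \<ge> 0" using elliptic_atD(4)[OF ell] abs_ge_zero order_trans by blast
  have "elliptic_op a b (dist_sq q) x
      = (\<Sum>i\<in>UNIV. elliptic_op a b (\<lambda>y. (y $ i - q $ i) * (y $ i - q $ i)) x)"
    unfolding dist_sq_def[abs_def] by (rule elliptic_op_sum[OF x o]) (intro smooth o)
  also have "\<dots> = (\<Sum>i\<in>UNIV. 2 * (x $ i - q $ i) * b i x + 2 * a i i x)"
    by (intro sum.cong refl elliptic_op_square[OF x o] elliptic_atD(1)[OF ell])
  also have "\<dots> \<le> (\<Sum>i\<in>(UNIV::'n set). 4 * \<Lambda>)"
  proof (rule sum_mono)
    fix i
    have "\<bar>x $ i - q $ i\<bar> \<le> 1"
      using component_le_norm_cart[of "x - q" i] d by (simp add: dist_norm)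
    then have "\<bar>x $ i - q $ i\<bar> * \<bar>b i x\<bar> \<le> 1 * \<Lambda>"
      using elliptic_atD(4)[OF ell] by (intro mult_mono) auto
    then have "(x $ i - q $ i) * b i x \<le> \<Lambda>"
      by (metis abs_ge_self abs_mult mult_1 order_trans)
    moreover have "a i i x \<le> \<Lambda>" using elliptic_atD(3)[OF ell, of i i] by simp
    ultimately show "2 * (x $ i - q $ i) * b i x + 2 * a i i x \<le> 4 * \<Lambda>"
      unfolding mult.assoc by linarith
  qed
  also have "\<dots> = 4 * real CARD('n) * \<Lambda>" by simp
  finally show ?thesis .
qed

lemma closed_half_space: "closed (half_space :: (real^'n::finite) set)"
  unfolding half_space_def by (intro closed_Collect_le continuous_intros)

lemma convex_half_space: "convex (half_space :: (real^'n::finite) set)"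
  unfolding half_space_def by (auto simp: convex_def)

text \<open>Near a boundary point \<open>q\<close>, with \<open>h\<close> the height above the hyperplane, the comparison function is
  \<open>w = M (A \<lambda> h - B \<lambda>\<^sup>2 h\<^sup>2 + D \<lambda>\<^sup>2 |x - q|\<^sup>2)\<close> on the half ball of radius \<open>\<rho>/\<lambda>\<close>. The last term makes \<open>w \<ge> M\<close> on
  the spherical part, the concave term \<open>-B \<lambda>\<^sup>2 h\<^sup>2\<close> makes \<open>L w < -\<lambda>\<^sup>2 M\<close>, and the linear term keeps
  \<open>w\<close> nonnegative. Since \<open>L f = -\<lambda>\<^sup>2 f \<ge> -\<lambda>\<^sup>2 M\<close>, the maximum principle gives \<open>f \<le> w\<close>.\<close>

lemma boundary_barrier:
  fixes \<theta> \<Lambda> R :: real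
  assumes \<theta>: "0 < \<theta>" and \<Lambda>: "1 \<le> \<Lambda>" and R: "0 < R"
  shows "\<exists>A>0. \<exists>D>0. \<exists>\<rho>>0. \<forall>(a :: 'n::finite \<Rightarrow> 'n \<Rightarrow> real^'n \<Rightarrow> real) b q lam f M.
    dirichlet_half_ball \<theta> \<Lambda> a b R q lam f \<longrightarrow> q $ bdry_coord = 0 \<longrightarrow> 1 \<le> lam \<longrightarrow> 0 < M \<longrightarrow>
    (\<forall>x\<in>ball q R \<inter> half_space. f x \<le> M) \<longrightarrow>
    (\<forall>x\<in>cball q (\<rho> / lam) \<inter> half_space. f x \<le> M * (A * lam * x $ bdry_coord + D * lam\<^sup>2 * (dist x q)\<^sup>2))"
proof -
  define N where "N = real CARD('n)"
  define \<rho> where "\<rho> = min (R / 2) (min 1 (\<theta> / (3 * \<Lambda>)))"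
  define D where "D = 1 / \<rho>\<^sup>2"
  define B where "B = (4 * N * \<Lambda> * D + 2) / \<theta>"
  \<comment> \<open>with this \<open>A\<close>, \<open>A \<lambda> h \<ge> B \<lambda>\<^sup>2 h\<^sup>2\<close> as long as \<open>\<lambda> h \<le> \<rho>\<close>\<close>
  define A where "A = B * \<rho>"
  have N: "N > 0" by (simp add: N_def)
  have \<rho>: "0 < \<rho>" "\<rho> < R" "\<rho> \<le> 1" "3 * \<Lambda> * \<rho> \<le> \<theta>"
  proof -
    have "\<rho> \<le> \<theta> / (3 * \<Lambda>)" by (simp add: \<rho>_def)
    then show "3 * \<Lambda> * \<rho> \<le> \<theta>" using \<Lambda> by (simp add: field_simps)
  qed (use \<theta> \<Lambda> R in \<open>auto simp: \<rho>_def\<close>)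
  have D: "D > 0" using \<rho> by (simp add: D_def)
  have B: "B > 0" using N D \<theta> \<Lambda> by (simp add: B_def add_pos_pos)
  have A: "A > 0" using B \<rho> by (simp add: A_def)
  have B\<theta>: "B * \<theta> = 4 * N * \<Lambda> * D + 2" using \<theta> by (simp add: B_def)
  show ?thesis
  proof (rule exI[of _ A], intro conjI A, rule exI[of _ D], intro conjI D, rule exI[of _ \<rho>],
      intro conjI \<rho>(1) allI impI)
    fix a :: "'n \<Rightarrow> 'n \<Rightarrow> real^'n \<Rightarrow> real" and b q f and lam M :: real
    assume dir: "dirichlet_half_ball \<theta> \<Lambda> a b R q lam f" and q: "q $ bdry_coord = 0"
      and lam: "1 \<le> lam" and M: "0 < M" and le: "\<forall>x\<in>ball q R \<inter> half_space. f x \<le> M"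
    let ?\<beta> = "bdry_coord :: 'n"
    let ?L = "elliptic_op a b"
    define K where "K = cball q (\<rho> / lam) \<inter> half_space"
    have r: "0 < \<rho> / lam" "\<rho> / lam \<le> \<rho>"
      using \<rho> lam by (auto simp: divide_le_eq mult_le_cancel_left1)
    have KR: "K \<subseteq> ball q R \<inter> half_space" using r \<rho> by (auto simp: K_def)
    have qK: "q \<in> K" using q r by (simp add: K_def half_space_def)
    have "compact K" unfolding K_def by (intro compact_Int_closed closed_half_space) auto
    define w where "w x = M * (A * lam) * (x $ ?\<beta> - 0) - M * B * lam\<^sup>2 * ((x $ ?\<beta> - 0) * (x $ ?\<beta> - 0))
        + M * D * lam\<^sup>2 * dist_sq q x" for x
    have w_eq: "w x = M * (A * lam * x $ ?\<beta> - B * lam\<^sup>2 * (x $ ?\<beta>)\<^sup>2 + D * lam\<^sup>2 * (dist x q)\<^sup>2)" for x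
      by (simp add: w_def dist_sq_eq power2_eq_square algebra_simps)
    have w_le: "w x \<le> M * (A * lam * x $ ?\<beta> + D * lam\<^sup>2 * (dist x q)\<^sup>2)" for x
      unfolding w_eq using M B by (intro mult_left_mono) auto
    have sw: "smooth_open W w" if "open W" for W
      unfolding w_def[abs_def] using that by (intro smooth)
    have cw: "continuous_on K w" using smooth_open_continuous[OF sw[OF open_UNIV]] continuous_on_subset by blast
    have "continuous_on K (\<lambda>x. f x - w x)"
      using dir KR unfolding dirichlet_half_ball_def by (intro continuous_on_diff cw) (blast intro: continuous_on_subset)
    then obtain z where z: "z \<in> K" "\<And>x. x \<in> K \<Longrightarrow> f x - w x \<le> f z - w z"
      using continuous_attains_sup[OF \<open>compact K\<close>] qK by blast
    have zh: "0 \<le> z $ ?\<beta>" "dist z q \<le> \<rho> / lam" "z \<in> ball q R"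
      using z(1) KR by (auto simp: K_def half_space_def dist_commute)
    have fM: "f z \<le> M" using le z(1) KR by blast
    have "f z - w z \<le> 0"
    proof (rule ccontr)
      assume neg: "\<not> f z - w z \<le> 0"
      have hz: "lam * z $ ?\<beta> \<le> \<rho>"
      proof -
        have "\<bar>(z - q) $ ?\<beta>\<bar> \<le> norm (z - q)" by (rule component_le_norm_cart)
        then have "z $ ?\<beta> \<le> \<rho> / lam" using zh q by (simp add: dist_norm)
        then show ?thesis using lam by (simp add: field_simps)
      qed
      have AB: "A * lam * z $ ?\<beta> - B * lam\<^sup>2 * (z $ ?\<beta>)\<^sup>2 \<ge> 0"
      proof -
        have "B * (lam * z $ ?\<beta>) * (lam * z $ ?\<beta>) \<le> B * (lam * z $ ?\<beta>) * \<rho>"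
          using hz B lam zh by (intro mult_left_mono) auto
        then show ?thesis by (simp add: A_def power2_eq_square mult_ac)
      qed
      have "z $ ?\<beta> \<noteq> 0"
      proof
        assume "z $ ?\<beta> = 0"
        then have "f z = 0" using dir zh by (auto simp: dirichlet_half_ball_def)
        moreover have "w z \<ge> 0" unfolding w_eq using AB D M by (intro mult_nonneg_nonneg add_nonneg_nonneg) auto
        ultimately show False using neg by simp
      qed
      then have zpos: "0 < z $ ?\<beta>" using zh by simp
      have "dist z q \<noteq> \<rho> / lam"
      proof
        assume "dist z q = \<rho> / lam"
        then have "D * lam\<^sup>2 * (dist z q)\<^sup>2 = 1" using \<rho> lam by (simp add: D_def power_divide)
        then have "M * 1 \<le> w z" unfolding w_eq using AB M by (intro mult_left_mono) auto
        then show False using neg fM by simp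
      qed
      then have zin: "dist z q < \<rho> / lam" using zh by simp
      define W where "W = ball q (\<rho> / lam) \<inter> {x. 0 < x $ ?\<beta>}"
      have W: "open W" "z \<in> W" "W \<subseteq> K" "W \<subseteq> ball q R \<inter> {x. 0 < x $ ?\<beta>}"
        using zin zpos r \<rho> by (auto simp: W_def K_def half_space_def dist_commute open_half)
      have sf: "smooth_open W f"
        using dir W smooth_open_subset unfolding dirichlet_half_ball_def by blast
      have ell: "elliptic_at \<theta> \<Lambda> a b z" and eq: "?L f z = - lam\<^sup>2 * f z"
        using dir W unfolding dirichlet_half_ball_def by blast+
      have "?L (\<lambda>x. f x - w x) z \<le> 0"
        by (rule elliptic_op_max[where a = a, OF smooth_open_diff[OF sf sw[OF W(1)]] W(2)])
           (use z(2) W(3) elliptic_atD(1)[OF ell] elliptic_at_psd[OF ell \<theta>] in auto)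
      then have "?L f z - ?L w z \<le> 0"
        using elliptic_op_diff[OF W(2) sf sw[OF W(1)], of a b] by simp
      then have "- lam\<^sup>2 * M \<le> ?L w z"
        using eq mult_left_mono[OF fM, of "lam\<^sup>2"] by simp
      moreover have "?L w z < - lam\<^sup>2 * M"
      proof -
        have s1: "smooth_open W (\<lambda>x. x $ ?\<beta> - 0)" using W(1) by (intro smooth)
        note s2 = smooth_open_mult[OF s1 s1]
        note s3 = smooth_open_dist_sq[OF W(1), of q]
        note sc = smooth_open_mult[OF smooth_open_const[OF W(1)]]
        have Lw: "?L w z = M * (A * lam) * b ?\<beta> z - M * B * lam\<^sup>2 * (2 * (z $ ?\<beta> - 0) * b ?\<beta> z + 2 * a ?\<beta> ?\<beta> z)
            + M * D * lam\<^sup>2 * ?L (dist_sq q) z"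
          unfolding w_def[abs_def]
            elliptic_op_add[OF W(2) smooth_open_diff[OF sc[OF s1] sc[OF s2]] sc[OF s3]]
            elliptic_op_diff[OF W(2) sc[OF s1] sc[OF s2]]
            elliptic_op_cmult[OF W(2) s1] elliptic_op_cmult[OF W(2) s2] elliptic_op_cmult[OF W(2) s3]
            elliptic_op_affine[OF W(2,1)]
            elliptic_op_square[where a = a and b = b, OF W(2,1) elliptic_atD(1)[OF ell]] by (rule refl)
        have "?L w z = M * (A * lam * b ?\<beta> z - B * lam\<^sup>2 * (2 * z $ ?\<beta> * b ?\<beta> z) - B * lam\<^sup>2 * (2 * a ?\<beta> ?\<beta> z)
            + D * lam\<^sup>2 * ?L (dist_sq q) z)"
          unfolding Lw by (simp add: algebra_simps)
        also have "\<dots> \<le> M * (lam\<^sup>2 * (B * \<rho> * \<Lambda>) + lam\<^sup>2 * (2 * B * \<rho> * \<Lambda>) - lam\<^sup>2 * (2 * B * \<theta>) + lam\<^sup>2 * (D * (4 * N * \<Lambda>)))"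
        proof (intro mult_left_mono add_mono diff_mono)
          have b: "b ?\<beta> z \<le> \<Lambda>" "- b ?\<beta> z \<le> \<Lambda>" using elliptic_atD(4)[OF ell, of ?\<beta>] by auto
          have l: "lam \<le> lam\<^sup>2" using lam by (simp add: power2_eq_square)
          have "A * lam * b ?\<beta> z \<le> A * lam * \<Lambda>" using b A lam by (intro mult_left_mono) auto
          also have "\<dots> \<le> A * lam\<^sup>2 * \<Lambda>" using A l \<Lambda> by (intro mult_left_mono mult_right_mono) auto
          finally have Ab: "A * lam * b ?\<beta> z \<le> lam\<^sup>2 * (B * \<rho> * \<Lambda>)" by (simp add: A_def mult_ac)
          have "z $ ?\<beta> \<le> lam * z $ ?\<beta>" using lam zh by (simp add: mult_le_cancel_right1)
          then have "z $ ?\<beta> \<le> \<rho>" using hz by linarith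
          then have "z $ ?\<beta> * (- b ?\<beta> z) \<le> \<rho> * \<Lambda>"
            using b zh \<rho> \<Lambda> by (smt (verit) mult_mono mult_nonneg_nonpos mult_nonneg_nonneg)
          then have "(2 * B * lam\<^sup>2) * (z $ ?\<beta> * (- b ?\<beta> z)) \<le> (2 * B * lam\<^sup>2) * (\<rho> * \<Lambda>)"
            using B by (intro mult_left_mono) auto
          then show "A * lam * b ?\<beta> z - B * lam\<^sup>2 * (2 * z $ ?\<beta> * b ?\<beta> z) \<le> lam\<^sup>2 * (B * \<rho> * \<Lambda>) + lam\<^sup>2 * (2 * B * \<rho> * \<Lambda>)"
            using Ab by (simp add: mult_ac)
          have "\<theta> \<le> a ?\<beta> ?\<beta> z"
          proof -
            have "(\<Sum>i\<in>UNIV. \<Sum>j\<in>UNIV. a i j z * of_bool (i = ?\<beta>) * of_bool (j = ?\<beta>))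
               = (\<Sum>i\<in>UNIV. \<Sum>j\<in>UNIV. if j = ?\<beta> then if i = ?\<beta> then a i j z else 0 else 0)"
              by (intro sum.cong refl) auto
            moreover have "(\<Sum>i\<in>UNIV. (of_bool (i = ?\<beta>))\<^sup>2 :: real) = (\<Sum>i\<in>UNIV. if i = ?\<beta> then 1 else 0)"
              by (intro sum.cong refl) auto
            ultimately show ?thesis using elliptic_atD(2)[OF ell, of "\<lambda>i. of_bool (i = ?\<beta>)"] by simp
          qed
          then show "lam\<^sup>2 * (2 * B * \<theta>) \<le> B * lam\<^sup>2 * (2 * a ?\<beta> ?\<beta> z)"
            using B by (simp add: mult_ac mult_right_mono)
          have "?L (dist_sq q) z \<le> 4 * N * \<Lambda>"
            unfolding N_def using zin r \<rho> by (intro elliptic_op_dist_sq[OF W(2,1) ell]) auto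
          then have "(D * lam\<^sup>2) * ?L (dist_sq q) z \<le> (D * lam\<^sup>2) * (4 * N * \<Lambda>)"
            using D by (intro mult_left_mono) auto
          then show "D * lam\<^sup>2 * ?L (dist_sq q) z \<le> lam\<^sup>2 * (D * (4 * N * \<Lambda>))" by (simp add: mult_ac)
        qed (use M in simp)
        also have "\<dots> = M * (lam\<^sup>2 * (B * (3 * \<Lambda> * \<rho>) - 2 * (B * \<theta>) + 4 * N * \<Lambda> * D))"
          by (simp add: algebra_simps)
        also have "\<dots> \<le> M * (lam\<^sup>2 * (- 2))"
        proof (intro mult_left_mono)
          have "B * (3 * \<Lambda> * \<rho>) \<le> B * \<theta>" using B \<rho> by (intro mult_left_mono) auto
          then show "B * (3 * \<Lambda> * \<rho>) - 2 * (B * \<theta>) + 4 * N * \<Lambda> * D \<le> - 2" using B\<theta> by linarith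
        qed (use M in auto)
        also have "\<dots> < - lam\<^sup>2 * M" using M lam by simp
        finally show ?thesis .
      qed
      ultimately show False by simp
    qed
    show "\<forall>x\<in>cball q (\<rho> / lam) \<inter> half_space. f x \<le> M * (A * lam * x $ ?\<beta> + D * lam\<^sup>2 * (dist x q)\<^sup>2)"
    proof
      fix x assume "x \<in> cball q (\<rho> / lam) \<inter> half_space"
      then have "f x - w x \<le> 0" using z(2)[of x] \<open>f z - w z \<le> 0\<close> by (simp add: K_def)
      then show "f x \<le> M * (A * lam * x $ ?\<beta> + D * lam\<^sup>2 * (dist x q)\<^sup>2)" using w_le[of x] by linarith
    qed
  qed
qed

text \<open>Dividing the barrier bound for \<open>f\<close> and \<open>-f\<close> by the height and letting it tend to zero bounds
  the normal derivative; the tangential derivatives vanish with \<open>f\<close> along the hyperplane. The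
  derivative is one-sided, taken within a set \<open>S\<close> containing the half ball.\<close>

lemma boundary_normal_derivative:
  fixes \<theta> \<Lambda> R :: real
  assumes \<theta>: "0 < \<theta>" and \<Lambda>: "1 \<le> \<Lambda>" and R: "0 < R"
  shows "\<exists>C>0. \<forall>(a :: 'n::finite \<Rightarrow> 'n \<Rightarrow> real^'n \<Rightarrow> real) b q lam f M S f'.
    dirichlet_half_ball \<theta> \<Lambda> a b R q lam f \<longrightarrow> q $ bdry_coord = 0 \<longrightarrow> 1 \<le> lam \<longrightarrow> 0 < M \<longrightarrow>
    (\<forall>x\<in>ball q R \<inter> half_space. \<bar>f x\<bar> \<le> M) \<longrightarrow> ball q R \<inter> half_space \<subseteq> S \<longrightarrow>
    (f has_derivative f') (at q within S) \<longrightarrow>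
    \<bar>f' (axis bdry_coord 1)\<bar> \<le> C * lam * M \<and> (\<forall>i. i \<noteq> bdry_coord \<longrightarrow> f' (axis i 1) = 0)"
proof -
  obtain A D \<rho> where ADr: "A > 0" "D > 0" "\<rho> > 0" and barrier:
   "\<And>(a :: 'n::finite \<Rightarrow> 'n \<Rightarrow> real^'n \<Rightarrow> real) b q lam f M x.
    dirichlet_half_ball \<theta> \<Lambda> a b R q lam f \<Longrightarrow> q $ bdry_coord = 0 \<Longrightarrow> 1 \<le> lam \<Longrightarrow> 0 < M \<Longrightarrow>
    (\<forall>x\<in>ball q R \<inter> half_space. f x \<le> M) \<Longrightarrow> x\<in>cball q (\<rho> / lam) \<inter> half_space \<Longrightarrow>
    f x \<le> M * (A * lam * x $ bdry_coord + D * lam\<^sup>2 * (dist x q)\<^sup>2)"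
    using boundary_barrier[OF assms, where 'n = 'n] by metis
  show ?thesis
  proof (intro exI[of _ A] conjI ADr(1) allI impI)
    fix a :: "'n \<Rightarrow> 'n \<Rightarrow> real^'n \<Rightarrow> real" and b q f S f' and lam M :: real
    assume dir: "dirichlet_half_ball \<theta> \<Lambda> a b R q lam f" and q: "q $ bdry_coord = 0"
      and lam: "1 \<le> lam" and M: "0 < M" and le: "\<forall>x\<in>ball q R \<inter> half_space. \<bar>f x\<bar> \<le> M"
      and S: "ball q R \<inter> half_space \<subseteq> S" and f': "(f has_derivative f') (at q within S)"
    let ?\<beta> = "bdry_coord :: 'n"
    define r where "r = min R (\<rho> / lam)"
    have r: "0 < r" "r \<le> R" "r \<le> \<rho> / lam" using R ADr lam by (auto simp: r_def)
    have lin: "linear f'" using f' has_derivative_linear by blast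
    have fq: "f q = 0" using dir q R by (auto simp: dirichlet_half_ball_def)
    have bound: "\<bar>f x\<bar> \<le> M * (A * lam * x $ ?\<beta> + D * lam\<^sup>2 * (dist x q)\<^sup>2)"
      if "x \<in> cball q (\<rho> / lam) \<inter> half_space" for x
      using barrier[OF dir q lam M _ that] barrier[OF dirichlet_half_ball_minus[OF dir] q lam M _ that] le
      by (force simp: abs_le_iff)
    have lim: "((\<lambda>t. f (q + t *\<^sub>R axis i 1) / t) \<longlongrightarrow> f' (axis i 1)) (at_right 0)" for i
    proof -
      have sub: "(\<lambda>t. q + t *\<^sub>R axis i 1) ` {0..r / 2} \<subseteq> S"
      proof safe
        fix t assume t: "t \<in> {0..r / 2}"
        have "q + t *\<^sub>R axis i 1 \<in> ball q R \<inter> half_space"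
          using t r q by (simp add: half_space_def dist_norm) (simp add: axis_def)
        then show "q + t *\<^sub>R axis i 1 \<in> S" using S by blast
      qed
      have "((\<lambda>t. f (q + t *\<^sub>R axis i 1)) has_derivative (\<lambda>s. f' (s *\<^sub>R axis i 1))) (at 0 within {0..r / 2})"
        by (rule has_derivative_in_compose[of "\<lambda>t. q + t *\<^sub>R axis i 1" "\<lambda>s. s *\<^sub>R axis i 1" 0 "{0..r / 2}" f f'])
           (use has_derivative_subset[OF f' sub] in \<open>auto intro!: derivative_eq_intros\<close>)
      then have "((\<lambda>t. f (q + t *\<^sub>R axis i 1)) has_real_derivative f' (axis i 1)) (at 0 within {0..r / 2})"
        unfolding has_field_derivative_def using lin by (simp add: linear_cmul mult.commute[of _ "f' _"])
      then have "((\<lambda>t. f (q + t *\<^sub>R axis i 1) / t) \<longlongrightarrow> f' (axis i 1)) (at 0 within {0..r / 2})"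
        unfolding has_field_derivative_iff using fq by simp
      moreover have "at 0 within {0..r / 2} = at_right 0"
        using r by (intro at_within_Icc_at_right) simp
      ultimately show ?thesis by simp
    qed
    have small: "\<forall>\<^sub>F t in at_right (0::real). t \<in> {0<..<r}"
      using r by (intro eventually_at_right_real)
    show "f' (axis i 1) = 0" if "i \<noteq> ?\<beta>" for i
    proof -
      have "\<forall>\<^sub>F t in at_right 0. f (q + t *\<^sub>R axis i 1) / t = 0"
        using small
      proof eventually_elim
        case (elim t)
        then have "q + t *\<^sub>R axis i 1 \<in> ball q R" "(q + t *\<^sub>R axis i 1) $ ?\<beta> = 0"
          using r q that by (simp_all add: dist_norm) (simp add: axis_def)
        then show ?case using dir by (auto simp: dirichlet_half_ball_def)
      qed
      then have "((\<lambda>t. f (q + t *\<^sub>R axis i 1) / t) \<longlongrightarrow> 0) (at_right 0)"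
        by (rule tendsto_eventually)
      from tendsto_unique[OF trivial_limit_at_right_real lim this] show ?thesis .
    qed
    show "\<bar>f' (axis ?\<beta> 1)\<bar> \<le> A * lam * M"
    proof (rule tendsto_le[OF trivial_limit_at_right_real])
      show "((\<lambda>t. \<bar>f (q + t *\<^sub>R axis ?\<beta> 1) / t\<bar>) \<longlongrightarrow> \<bar>f' (axis ?\<beta> 1)\<bar>) (at_right 0)"
        by (intro tendsto_rabs lim)
      have "((\<lambda>t. M * (A * lam + D * lam\<^sup>2 * t)) \<longlongrightarrow> M * (A * lam + D * lam\<^sup>2 * 0)) (at_right 0)"
        by (intro tendsto_intros)
      then show "((\<lambda>t. M * (A * lam + D * lam\<^sup>2 * t)) \<longlongrightarrow> A * lam * M) (at_right 0)"
        by (simp add: mult_ac)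
      show "\<forall>\<^sub>F t in at_right 0. \<bar>f (q + t *\<^sub>R axis ?\<beta> 1) / t\<bar> \<le> M * (A * lam + D * lam\<^sup>2 * t)"
        using small
      proof eventually_elim
        case (elim t)
        let ?x = "q + t *\<^sub>R axis ?\<beta> 1"
        have x: "?x \<in> cball q (\<rho> / lam) \<inter> half_space" "?x $ ?\<beta> = t" "dist ?x q = t"
          using elim r q by (simp_all add: half_space_def dist_norm)
        have "\<bar>f ?x\<bar> \<le> M * (A * lam + D * lam\<^sup>2 * t) * t"
          using bound[OF x(1)] unfolding x(2,3) by (simp add: power2_eq_square algebra_simps)
        then show ?case using elim by (simp add: abs_divide divide_le_eq)
      qed
    qed
  qed
qed

text \<open>A positive value of \<open>f\<close> at \<open>q\<close> forces a gradient of size at least \<open>\<lambda> f(q)\<close> up to a constant. Where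
  \<open>f\<close> is still large, \<open>L (f + \<alpha> \<lambda>\<^sup>2 f(q) |x - q|\<^sup>2)\<close> is negative, so that sum has no interior minimum on
  the half ball of radius \<open>\<rho>/\<lambda>\<close> except where \<open>f\<close> has already dropped. In each case \<open>f\<close> decreases by a fixed
  fraction \<open>\<delta>\<close> of \<open>f(q)\<close> within distance \<open>\<rho>/\<lambda>\<close>, and the mean value inequality applies.\<close>

lemma value_le_gradient_bound:
  fixes \<theta> \<Lambda> R :: real
  assumes \<theta>: "0 < \<theta>" and \<Lambda>: "1 \<le> \<Lambda>" and R: "0 < R"
  shows "\<exists>C>0. \<forall>(a :: 'n::finite \<Rightarrow> 'n \<Rightarrow> real^'n \<Rightarrow> real) b q lam f f' Q.
    dirichlet_half_ball \<theta> \<Lambda> a b R q lam f \<longrightarrow> 1 \<le> lam \<longrightarrow> 0 < f q \<longrightarrow> 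
    (\<forall>x\<in>ball q R \<inter> half_space. (f has_derivative f' x) (at x within ball q R \<inter> half_space) \<and> onorm (f' x) \<le> Q) \<longrightarrow>
    lam * f q \<le> C * Q"
proof -
  define N where "N = real CARD('n)"
  define \<rho> where "\<rho> = min (R / 2) 1"
  \<comment> \<open>since \<open>L (|x - q|\<^sup>2) \<le> 4 N \<Lambda>\<close>, an interior minimum is only possible where \<open>f \<le> f(q)/4\<close>\<close>
  define \<alpha> where "\<alpha> = 1 / (16 * N * \<Lambda>)"
  define \<delta> where "\<delta> = min (1 / 2) (\<alpha> * \<rho>\<^sup>2)"
  have N: "N > 0" by (simp add: N_def)
  have \<rho>: "0 < \<rho>" "\<rho> < R" "\<rho> \<le> 1" using R by (auto simp: \<rho>_def)
  have \<alpha>: "\<alpha> > 0" using N \<Lambda> by (simp add: \<alpha>_def)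
  have \<delta>: "0 < \<delta>" "\<delta> \<le> 1 / 2" "\<delta> \<le> \<alpha> * \<rho>\<^sup>2" using \<alpha> \<rho> by (auto simp: \<delta>_def)
  show ?thesis
  proof (intro exI[of _ "\<rho> / \<delta>"] conjI allI impI)
    show "0 < \<rho> / \<delta>" using \<rho> \<delta> by simp
  next
    fix a :: "'n \<Rightarrow> 'n \<Rightarrow> real^'n \<Rightarrow> real" and b q f f' and lam Q :: real
    assume dir: "dirichlet_half_ball \<theta> \<Lambda> a b R q lam f"
      and lam: "1 \<le> lam" and M0: "0 < f q"
      and der: "\<forall>x\<in>ball q R \<inter> half_space. (f has_derivative f' x) (at x within ball q R \<inter> half_space) \<and> onorm (f' x) \<le> Q"
    let ?\<beta> = "bdry_coord :: 'n"
    let ?L = "elliptic_op a b"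
    define M where "M = f q"
    have M: "M > 0" using M0 by (simp add: M_def)
    define K where "K = cball q (\<rho> / lam) \<inter> half_space"
    have r: "0 < \<rho> / lam" "\<rho> / lam \<le> \<rho>"
      using \<rho> lam by (auto simp: divide_le_eq mult_le_cancel_left1)
    have KR: "K \<subseteq> ball q R \<inter> half_space" using r \<rho> by (auto simp: K_def)
    have qK: "q \<in> K" using dir r by (simp add: K_def dirichlet_half_ball_def)
    have "compact K" unfolding K_def by (intro compact_Int_closed closed_half_space) auto
    define w where "w x = (- (\<alpha> * lam\<^sup>2 * M)) * dist_sq q x" for x
    have sw: "smooth_open W w" if "open W" for W
      unfolding w_def[abs_def] using that by (intro smooth)
    have cw: "continuous_on K w" using smooth_open_continuous[OF sw[OF open_UNIV]] continuous_on_subset by blast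
    have "continuous_on K (\<lambda>x. w x - f x)"
      using dir KR unfolding dirichlet_half_ball_def by (intro continuous_on_diff cw) (blast intro: continuous_on_subset)
    then obtain z where z: "z \<in> K" "\<And>x. x \<in> K \<Longrightarrow> w x - f x \<le> w z - f z"
      using continuous_attains_sup[OF \<open>compact K\<close>] qK by blast
    have zh: "0 \<le> z $ ?\<beta>" "dist z q \<le> \<rho> / lam" "z \<in> ball q R"
      using z(1) KR by (auto simp: K_def half_space_def dist_commute)
    have zq: "f z \<le> M - \<alpha> * lam\<^sup>2 * M * (dist z q)\<^sup>2"
      using z(2)[OF qK] by (simp add: w_def dist_sq_eq M_def)
    have fz: "f z \<le> M - \<delta> * M"
    proof -
      \<comment> \<open>the minimizer \<open>z\<close> lies on the flat part, on the spherical part, or inside\<close>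
      consider "z $ ?\<beta> = 0" | "dist z q = \<rho> / lam" | "0 < z $ ?\<beta>" "dist z q < \<rho> / lam"
        using zh by linarith
      then show ?thesis
      proof cases
        case 1
        then have "f z = 0" using dir zh by (auto simp: dirichlet_half_ball_def)
        moreover have "\<delta> * M \<le> 1 / 2 * M" using \<delta> M by (intro mult_right_mono) auto
        ultimately show ?thesis using M by simp
      next
        case 2
        then have "\<alpha> * lam\<^sup>2 * M * (dist z q)\<^sup>2 = \<alpha> * \<rho>\<^sup>2 * M" using lam by (simp add: power_divide)
        moreover have "\<delta> * M \<le> \<alpha> * \<rho>\<^sup>2 * M" using \<delta> M by (intro mult_right_mono) auto
        ultimately show ?thesis using zq by linarith
      next
        case 3
        define W where "W = ball q (\<rho> / lam) \<inter> {x. 0 < x $ ?\<beta>}"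
        have W: "open W" "z \<in> W" "W \<subseteq> K" "W \<subseteq> ball q R \<inter> {x. 0 < x $ ?\<beta>}"
          using 3 r \<rho> by (auto simp: W_def K_def half_space_def dist_commute open_half)
        have sf: "smooth_open W f"
          using dir W smooth_open_subset unfolding dirichlet_half_ball_def by blast
        have ell: "elliptic_at \<theta> \<Lambda> a b z" and eq: "?L f z = - lam\<^sup>2 * f z"
          using dir W unfolding dirichlet_half_ball_def by blast+
        have "?L (\<lambda>x. w x - f x) z \<le> 0"
          by (rule elliptic_op_max[where a = a, OF smooth_open_diff[OF sw[OF W(1)] sf] W(2)])
             (use z(2) W(3) elliptic_atD(1)[OF ell] elliptic_at_psd[OF ell \<theta>] in auto)
        moreover have "?L w z = (- (\<alpha> * lam\<^sup>2 * M)) * ?L (dist_sq q) z"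
          unfolding w_def[abs_def] by (rule elliptic_op_cmult[OF W(2) smooth_open_dist_sq[OF W(1)]])
        ultimately have "lam\<^sup>2 * f z \<le> (\<alpha> * lam\<^sup>2 * M) * ?L (dist_sq q) z"
          using elliptic_op_diff[OF W(2) sw[OF W(1)] sf, of a b] eq by simp
        also have "\<dots> \<le> (\<alpha> * lam\<^sup>2 * M) * (4 * N * \<Lambda>)"
          unfolding N_def using 3 r \<rho> \<alpha> M
          by (intro mult_left_mono elliptic_op_dist_sq[OF W(2,1) ell]) auto
        also have "\<dots> = lam\<^sup>2 * (M / 4)" using N \<Lambda> by (simp add: \<alpha>_def field_simps)
        finally have "f z \<le> M / 4" using lam by simp
        moreover have "\<delta> * M \<le> 1 / 2 * M" using \<delta> M by (intro mult_right_mono) auto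
        ultimately show ?thesis using M by linarith
      qed
    qed
    have Q: "0 \<le> Q"
    proof -
      have "q \<in> ball q R \<inter> half_space" using qK KR by blast
      then have "(f has_derivative f' q) (at q within ball q R \<inter> half_space)" "onorm (f' q) \<le> Q" using der by blast+
      then show ?thesis using onorm_pos_le[OF has_derivative_bounded_linear] by fastforce
    qed
    have "norm (f q - f z) \<le> Q * norm (q - z)"
      by (rule differentiable_bound[where S = "ball q R \<inter> half_space" and f' = f'])
         (use der qK z(1) KR in \<open>auto intro!: convex_Int convex_half_space\<close>)
    also have "\<dots> \<le> Q * (\<rho> / lam)"
      using zh Q by (intro mult_left_mono) (auto simp: dist_norm norm_minus_commute)
    finally have "\<delta> * M \<le> Q * (\<rho> / lam)" using fz by (simp add: M_def abs_le_iff)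
    then show "lam * f q \<le> \<rho> / \<delta> * Q"
      using lam \<delta> by (simp add: M_def field_simps)
  qed
qed

section \<open>Smooth functions on relatively open subsets of the half-space\<close>

lemma open_half_space_part:
  assumes "openin (top_of_set half_space) S"
  shows "open (S \<inter> {x::real^'n::finite. 0 < x $ bdry_coord})"
proof -
  obtain T where "open T" "S = half_space \<inter> T" using assms by (auto simp: openin_open)
  then have "S \<inter> {x. 0 < x $ bdry_coord} = T \<inter> {x. 0 < x $ bdry_coord}"
    by (auto simp: half_space_def)
  then show ?thesis using \<open>open T\<close> open_half by (metis open_Int)
qed

lemma smooth_on_extension:
  fixes f :: "real^'n::finite \<Rightarrow> real"
  assumes "smooth_on S f" "x \<in> S"
  obtains r F where "r > 0" "smooth_open (ball x r) F" "\<And>y. y \<in> S \<inter> ball x r \<Longrightarrow> F y = f y"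
proof -
  obtain W F where W: "open W" "x \<in> W" "\<forall>k. Ck_on k W F" "\<forall>y\<in>S \<inter> W. F y = f y"
    using assms unfolding smooth_on_def by blast
  obtain r where r: "r > 0" "ball x r \<subseteq> W" using W openE by blast
  have "smooth_open (ball x r) F"
    using W r smooth_open_subset[of W F "ball x r"] by (simp add: smooth_open_def)
  then show thesis using that[of r F] r W by blast
qed

lemma smooth_on_interior:
  fixes f :: "real^'n::finite \<Rightarrow> real"
  assumes "openin (top_of_set half_space) S" "smooth_on S f"
  shows "smooth_open (S \<inter> {x. 0 < x $ bdry_coord}) f"
proof (rule smooth_open_local)
  let ?W = "S \<inter> {x. 0 < x $ bdry_coord}"
  show o: "open ?W" by (rule open_half_space_part[OF assms(1)])
  fix x assume x: "x \<in> ?W"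
  then obtain r F where r: "r > 0" "smooth_open (ball x r) F" "\<And>y. y \<in> S \<inter> ball x r \<Longrightarrow> F y = f y"
    using smooth_on_extension[OF assms(2)] by blast
  have "smooth_open (ball x r \<inter> ?W) F" using r(2) o smooth_open_subset by blast
  then have "smooth_open (ball x r \<inter> ?W) f" by (rule smooth_open_cong) (use r(3) in auto)
  then show "\<exists>V. x \<in> V \<and> smooth_open V f" using x r(1) by (intro exI[of _ "ball x r \<inter> ?W"]) auto
qed

text \<open>Derivatives within \<open>S\<close>, also at points of the hyperplane, are those of any smooth extension.\<close>

lemma pderiv_on_eq_pd:
  fixes f :: "real^'n::finite \<Rightarrow> real"
  assumes S: "openin (top_of_set half_space) S" and F: "smooth_open W F" and y: "y \<in> S \<inter> W"
    and eq: "\<And>z. z \<in> S \<inter> W \<Longrightarrow> F z = f z"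
  shows "pderiv_on S i f y = pd i F y"
    and "(f has_derivative (\<lambda>v. \<Sum>i\<in>UNIV. v $ i * pderiv_on S i f y)) (at y within S)"
proof -
  let ?D = "\<lambda>v. \<Sum>i\<in>UNIV. v $ i * pd i F y"
  have "(F has_derivative ?D) (at y)"
    using has_derivative_pd smooth_open_differentiable[OF F] y by blast
  then have FD: "(F has_derivative ?D) (at y within S)" by (rule has_derivative_at_withinI)
  obtain r where r: "r > 0" "ball y r \<subseteq> W" using smooth_open_open[OF F] y openE by blast
  have fD: "(f has_derivative ?D) (at y within S)"
    by (rule has_derivative_transform_within[OF FD r(1)]) (use y eq r in \<open>auto simp: subset_eq dist_commute\<close>)
  then have "f differentiable (at y within S)" unfolding differentiable_def by blast
  then have "(f has_derivative frechet_derivative f (at y within S)) (at y within S)"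
    by (simp only: frechet_derivative_works)
  from half_space_derivative_unique[OF S _ this fD] y
  have fr: "frechet_derivative f (at y within S) = ?D" by blast
  have pe: "pderiv_on S i f y = pd i F y" for i
  proof -
    have "axis i 1 $ j * pd j F y = (if j = i then pd j F y else 0)" for j by (simp add: axis_def)
    then show ?thesis by (simp add: pderiv_on_def fr)
  qed
  show "pderiv_on S i f y = pd i F y" by (rule pe)
  show "(f has_derivative (\<lambda>v. \<Sum>i\<in>UNIV. v $ i * pderiv_on S i f y)) (at y within S)"
    using fD by (simp add: pe)
qed

lemma pderiv_on_interior:
  fixes f :: "real^'n::finite \<Rightarrow> real"
  assumes "openin (top_of_set half_space) S" "smooth_on S f" "y \<in> S" "0 < y $ bdry_coord"
  shows "pderiv_on S i f y = pd i f y"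
  by (rule pderiv_on_eq_pd[OF assms(1) smooth_on_interior[OF assms(1,2)]]) (use assms in auto)

lemma has_derivative_pderiv_on:
  fixes f :: "real^'n::finite \<Rightarrow> real"
  assumes "openin (top_of_set half_space) S" "smooth_on S f" "y \<in> S"
  shows "(f has_derivative (\<lambda>v. \<Sum>i\<in>UNIV. v $ i * pderiv_on S i f y)) (at y within S)"
proof -
  obtain r F where r: "r > 0" "smooth_open (ball y r) F" "\<And>z. z \<in> S \<inter> ball y r \<Longrightarrow> F z = f z"
    using smooth_on_extension[OF assms(2,3)] by blast
  show ?thesis by (rule pderiv_on_eq_pd(2)[OF assms(1) r(2) _ r(3)]) (use assms r in auto)
qed

lemma continuous_on_pderiv_on:
  fixes f :: "real^'n::finite \<Rightarrow> real"
  assumes "openin (top_of_set half_space) S" "smooth_on S f"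
  shows "continuous_on S (pderiv_on S i f)"
proof (rule continuous_on_eq_continuous_within[THEN iffD2], rule ballI)
  fix y assume y: "y \<in> S"
  obtain r F where r: "r > 0" "smooth_open (ball y r) F" "\<And>z. z \<in> S \<inter> ball y r \<Longrightarrow> F z = f z"
    using smooth_on_extension[OF assms(2) y] by blast
  have "continuous (at y within S) (pd i F)"
    using smooth_open_continuous[OF smooth_open_pd[OF r(2)]] r(1)
    by (simp add: continuous_on_eq_continuous_at continuous_at_imp_continuous_at_within)
  then show "continuous (at y within S) (pderiv_on S i f)"
    by (rule continuous_transform_within[OF _ r(1) y])
       (rule pderiv_on_eq_pd(1)[OF assms(1) r(2) _ r(3), symmetric], auto simp: dist_commute)
qed

lemma smooth_on_continuous:
  fixes f :: "real^'n::finite \<Rightarrow> real"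
  assumes "smooth_on S f"
  shows "continuous_on S f"
  using smooth_on_imp_differentiable[OF assms] differentiable_imp_continuous_within
  by (auto simp: continuous_on_eq_continuous_within)

section \<open>Positive definite matrices\<close>

lemma matrix_inv_mult:
  fixes G :: "real^'n::finite^'n"
  assumes "invertible G"
  shows "G ** matrix_inv G = mat 1" "matrix_inv G ** G = mat 1"
proof -
  have "\<exists>B. G ** B = mat 1 \<and> B ** G = mat 1" using assms by (simp add: invertible_def)
  then have "G ** matrix_inv G = mat 1 \<and> matrix_inv G ** G = mat 1"
    unfolding matrix_inv_def by (rule someI_ex)
  then show "G ** matrix_inv G = mat 1" "matrix_inv G ** G = mat 1" by blast+
qed

lemma inner_matrix_vector_sum:
  "v \<bullet> (G *v w) = (\<Sum>i\<in>UNIV. \<Sum>j\<in>UNIV. G $ i $ j * v $ i * w $ j)"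
  for G :: "real^'n::finite^'n"
  by (simp add: inner_vec_def matrix_vector_mult_def sum_distrib_left mult_ac)

context
  fixes G :: "real^'n::finite^'n"
  assumes sym: "transpose G = G" and pos: "\<And>v. v \<noteq> 0 \<Longrightarrow> 0 < v \<bullet> (G *v v)"
begin

lemma pos_def_invertible: "invertible G"
  unfolding invertible_left_inverse matrix_left_invertible_ker using pos by force

lemma pos_def_det: "0 < det G"
proof -
  have psd: "0 \<le> (\<Sum>i\<in>UNIV. \<Sum>j\<in>UNIV. G $ i $ j * v i * v j)" for v
  proof -
    have "0 \<le> (\<chi> i. v i) \<bullet> (G *v (\<chi> i. v i))"
      using pos[of "\<chi> i. v i"] by (cases "(\<chi> i. v i) = 0") auto
    then show ?thesis unfolding inner_matrix_vector_sum by simp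
  qed
  have "G $ i $ j = G $ j $ i" for i j
    using arg_cong[OF sym, of "\<lambda>M. M $ j $ i"] by (simp add: transpose_def)
  then obtain w where w: "\<forall>i j. G $ i $ j = (\<Sum>k\<in>(UNIV::'n set). w k i * w k j)"
    using psd_sum_of_squares[of "\<lambda>i j. G $ i $ j", OF _ psd] by blast
  define B where "B = (\<chi> k i. w k i)"
  have "G = transpose B ** B"
    using w by (simp add: vec_eq_iff matrix_matrix_mult_def transpose_def B_def)
  then have "det G = det B * det B" by (simp add: det_mul)
  moreover have "det G \<noteq> 0" using pos_def_invertible by (simp add: invertible_det_nz)
  ultimately show ?thesis by (auto simp: zero_less_mult_iff linorder_neq_iff)
qed

lemma pos_def_inv_sym: "transpose (matrix_inv G) = matrix_inv G"
proof -
  note i = matrix_inv_mult[OF pos_def_invertible]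
  have "transpose (matrix_inv G) ** G = mat 1"
    using arg_cong[OF i(1), of transpose] sym by (simp add: matrix_transpose_mul)
  then have "transpose (matrix_inv G) ** (G ** matrix_inv G) = matrix_inv G"
    by (simp add: matrix_mul_assoc)
  then show ?thesis by (simp add: i)
qed

lemma pos_def_inv_pos:
  assumes "v \<noteq> 0"
  shows "0 < v \<bullet> (matrix_inv G *v v)"
proof -
  note i = matrix_inv_mult[OF pos_def_invertible]
  have v: "G *v (matrix_inv G *v v) = v" by (simp add: matrix_vector_mul_assoc i)
  then have "matrix_inv G *v v \<noteq> 0" using assms by auto
  from pos[OF this] show ?thesis using v by (simp add: inner_commute)
qed

end

lemma smooth_open_det [smooth]:
  fixes G :: "real^'n::finite \<Rightarrow> real^'m::finite^'m"
  assumes "open W" "\<And>i j. smooth_open W (\<lambda>x. G x $ i $ j)"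
  shows "smooth_open W (\<lambda>x. det (G x))"
  unfolding det_def using assms by (intro smooth)

text \<open>By Cramer's rule.\<close>

lemma smooth_open_matrix_inv:
  fixes G :: "real^'n::finite \<Rightarrow> real^'m::finite^'m"
  assumes o: "open W" and G: "\<And>i j. smooth_open W (\<lambda>x. G x $ i $ j)" and nz: "\<And>x. x \<in> W \<Longrightarrow> det (G x) \<noteq> 0"
  shows "smooth_open W (\<lambda>x. matrix_inv (G x) $ i $ j)"
proof -
  define E where "E x = (\<chi> k l. if l = i then axis j 1 $ k else G x $ k $ l)" for x
  have "smooth_open W (\<lambda>x. E x $ k $ l)" for k l
    using G o by (cases "l = i") (auto simp: E_def intro: smooth)
  then have "smooth_open W (\<lambda>x. det (E x) / det (G x))"
    using G nz o by (intro smooth)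
  moreover have "det (E x) / det (G x) = matrix_inv (G x) $ i $ j" if "x \<in> W" for x
  proof -
    have inv: "invertible (G x)" using nz[OF that] by (simp add: invertible_det_nz)
    have "G x *v (matrix_inv (G x) *v axis j 1) = axis j 1"
      by (simp add: matrix_vector_mul_assoc matrix_inv_mult[OF inv])
    then have "matrix_inv (G x) *v axis j 1
        = (\<chi> m. det (\<chi> k l. if l = m then axis j 1 $ k else G x $ k $ l) / det (G x))"
      using cramer[OF nz[OF that]] by blast
    then have "(matrix_inv (G x) *v axis j 1) $ i = det (E x) / det (G x)" by (simp add: E_def)
    moreover have "(matrix_inv (G x) *v axis j 1) $ i = matrix_inv (G x) $ i $ j"
      by (simp add: matrix_vector_mul_component column_def matrix_vector_mult_basis)
    ultimately show ?thesis by simp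
  qed
  ultimately show ?thesis by (rule smooth_open_cong)
qed

lemma uniform_bound:
  fixes f :: "'i::finite \<Rightarrow> 'b::topological_space \<Rightarrow> real"
  assumes "compact K" "\<And>i. continuous_on K (f i)"
  shows "\<exists>B\<ge>0. \<forall>i. \<forall>x\<in>K. \<bar>f i x\<bar> \<le> B"
proof -
  have "\<exists>b. \<forall>x\<in>K. \<bar>f i x\<bar> \<le> b" for i
    using compact_imp_bounded[OF compact_continuous_image[OF assms(2,1)], of i]
    by (auto simp: bounded_iff)
  then obtain b where b: "\<And>i x. x \<in> K \<Longrightarrow> \<bar>f i x\<bar> \<le> b i" by metis
  have "\<bar>f i x\<bar> \<le> (\<Sum>j\<in>UNIV. \<bar>b j\<bar>)" if "x \<in> K" for i x
  proof -
    have "\<bar>f i x\<bar> \<le> \<bar>b i\<bar>" using b[OF that, of i] by linarith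
    also have "\<dots> \<le> (\<Sum>j\<in>UNIV. \<bar>b j\<bar>)" by (rule member_le_sum) auto
    finally show ?thesis .
  qed
  then show ?thesis by (intro exI[of _ "\<Sum>j\<in>UNIV. \<bar>b j\<bar>"]) (auto intro: sum_nonneg)
qed

section \<open>Coordinate expressions on the manifold\<close>

text \<open>A smooth manifold with boundary and a Riemannian metric on it; compactness is added where it
  is needed.\<close>

locale riemannian_manifold =
  fixes N :: "'a topology" and A :: "('a, 'n::finite) chart set" and g :: "('a, 'n) metric"
  assumes manifold: "smooth_manifold_with_boundary N A"
    and metric: "riemannian_metric A g"
begin

context
  fixes U :: "'a set" and \<phi> :: "'a \<Rightarrow> real^'n"
  assumes chart: "(U, \<phi>) \<in> A"
begin

lemma chart_is_chart: "is_chart N (U, \<phi>)"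
proof -
  have "\<forall>c\<in>A. is_chart N c"
    using manifold unfolding smooth_manifold_with_boundary_def by (elim conjE)
  then show ?thesis using chart by blast
qed

lemma chart_open: "openin N U"
  using chart_is_chart by (simp add: is_chart_def)

lemma chart_image_open: "openin (top_of_set half_space) (\<phi> ` U)"
  using chart_is_chart by (simp add: is_chart_def)

lemma chart_image_half_space: "\<phi> ` U \<subseteq> half_space"
  using chart_image_open openin_imp_subset by blast

lemma chart_homeo: "homeomorphic_map (subtopology N U) (top_of_set (\<phi> ` U)) \<phi>"
  using chart_is_chart by (simp add: is_chart_def)

lemma chart_topspace: "topspace (subtopology N U) = U"
  using chart_open by (auto simp: topspace_subtopology dest: openin_subset)

lemma chart_inj: "inj_on \<phi> U"
  using homeomorphic_imp_injective_map[OF chart_homeo] by (simp only: chart_topspace)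

lemma chart_subset: "U \<subseteq> topspace N"
  using chart_open openin_subset by blast

lemma chart_inv: "p \<in> U \<Longrightarrow> inv_into U \<phi> (\<phi> p) = p"
  using chart_inj by simp

lemma chart_preimage_open:
  assumes "open T"
  shows "openin N {p \<in> U. \<phi> p \<in> T}"
proof -
  have "continuous_map (subtopology N U) (top_of_set (\<phi> ` U)) \<phi>"
    using chart_homeo homeomorphic_imp_continuous_map by blast
  then have "continuous_map (subtopology N U) euclidean \<phi>"
    by (simp add: continuous_map_in_subtopology)
  then have "openin (subtopology N U) {p \<in> topspace (subtopology N U). \<phi> p \<in> T}"
    using assms openin_continuous_map_preimage by fastforce
  then show ?thesis using chart_open openin_trans_full unfolding chart_topspace by blast
qed

lemma chart_metric:
  "smooth_on (\<phi> ` U) (\<lambda>x. g (U, \<phi>) (inv_into U \<phi> x) $ i $ j)"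
  "p \<in> U \<Longrightarrow> transpose (g (U, \<phi>) p) = g (U, \<phi>) p"
  "p \<in> U \<Longrightarrow> v \<noteq> 0 \<Longrightarrow> 0 < v \<bullet> (g (U, \<phi>) p *v v)"
  using bspec[OF conjunct1[OF metric[unfolded riemannian_metric_def]] chart] by auto

lemma chart_smooth_function:
  "smooth_function A u \<Longrightarrow> smooth_on (\<phi> ` U) (u \<circ> inv_into U \<phi>)"
  using chart by (auto simp: smooth_function_def)

lemma boundary_if: "p \<in> U \<Longrightarrow> \<phi> p $ bdry_coord = 0 \<Longrightarrow> p \<in> mfd_boundary A"
  using chart by (auto simp: mfd_boundary_def)

end

text \<open>A boundary point in one chart is a boundary point in every other: otherwise the boundary
  coordinate of the transition map would have an interior minimum, making the Jacobian, and with it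
  the metric, singular.\<close>

lemma boundary_chart_independent:
  assumes c: "(U, \<phi>) \<in> A" "p \<in> U" and d: "(V, \<psi>) \<in> A" "p \<in> V" and zero: "\<psi> p $ bdry_coord = 0"
  shows "\<phi> p $ bdry_coord = 0"
proof (rule ccontr)
  let ?\<beta> = "bdry_coord :: 'n"
  assume ne: "\<phi> p $ ?\<beta> \<noteq> 0"
  let ?R = "\<phi> ` (U \<inter> V)" and ?t = "transition (U, \<phi>) (V, \<psi>)"
  have "\<phi> p \<in> half_space" using chart_image_half_space[OF c(1)] c(2) by blast
  then have pos: "0 < \<phi> p $ ?\<beta>" using ne by (simp add: half_space_def)
  have pR: "\<phi> p \<in> ?R" using c(2) d(2) by blast
  have "openin (subtopology N U) (U \<inter> V)"
    using chart_open[OF d(1)] by (rule openin_subtopology_Int2)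
  then have "openin (top_of_set (\<phi> ` U)) ?R"
    using homeomorphic_map_openness_eq[OF chart_homeo[OF c(1)]] by simp
  then have oR: "openin (top_of_set half_space) ?R"
    using chart_image_open[OF c(1)] by (rule openin_trans)
  define W where "W = ?R \<inter> {x. 0 < x $ ?\<beta>}"
  have W: "open W" "\<phi> p \<in> W" using open_half_space_part[OF oR] pos pR by (auto simp: W_def)
  define D where "D = frechet_derivative ?t (at (\<phi> p) within ?R)"
  have "\<forall>(U, \<phi>)\<in>A. \<forall>(V, \<psi>)\<in>A. smooth_on (\<phi> ` (U \<inter> V)) (transition (U, \<phi>) (V, \<psi>))"
    using manifold unfolding smooth_manifold_with_boundary_def by (elim conjE)
  then have "smooth_on ?R ?t" using c(1) d(1) by blast
  then have "(?t has_derivative D) (at (\<phi> p) within ?R)"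
    unfolding D_def using smooth_on_imp_differentiable[OF _ pR] frechet_derivative_works by blast
  then have "(?t has_derivative D) (at (\<phi> p) within W)"
    by (rule has_derivative_subset) (simp add: W_def)
  then have tD: "(?t has_derivative D) (at (\<phi> p))" using at_within_open[OF W(2,1)] by simp
  have "((\<lambda>x. ?t x $ ?\<beta>) has_derivative (\<lambda>v. D v $ ?\<beta>)) (at (\<phi> p))"
    using tD by (rule bounded_linear.has_derivative[OF bounded_linear_vec_nth])
  moreover have "?t (\<phi> p) $ ?\<beta> \<le> ?t x $ ?\<beta>" if x: "x \<in> W" for x
  proof -
    obtain q where q: "q \<in> U" "q \<in> V" "x = \<phi> q" using x unfolding W_def by blast
    have "\<psi> q \<in> half_space" using chart_image_half_space[OF d(1)] q by blast
    then show ?thesis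
      using q c(2) chart_inv[OF c(1)] zero by (simp add: transition_def half_space_def)
  qed
  ultimately have D0: "(\<lambda>v. D v $ ?\<beta>) = (\<lambda>v. 0)"
    by (intro differential_zero_maxmin[OF W(2,1)]) auto
  define J where "J = jacobian (U, \<phi>) (V, \<psi>) p"
  have "linear D" using tD has_derivative_linear by blast
  then have DJ: "D x = J *v x" for x
    unfolding J_def jacobian_def by (simp add: D_def matrix_works)
  have gJ: "g (U, \<phi>) p = transpose J ** g (V, \<psi>) p ** J"
    unfolding J_def
    using conjunct2[OF metric[unfolded riemannian_metric_def]] c d by fastforce
  \<comment> \<open>the range of the Jacobian lies in the hyperplane, so the Jacobian is not onto\<close>
  have "J *v x \<noteq> axis ?\<beta> 1" for x
    using D0 DJ[of x] by (metis axis_nth zero_neq_one)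
  then have "\<not> invertible J"
    unfolding invertible_right_inverse matrix_right_invertible_surjective surj_def by metis
  moreover have "invertible J"
  proof -
    have "x = 0" if "J *v x = 0" for x
    proof (rule ccontr)
      assume "x \<noteq> 0"
      then have "0 < x \<bullet> (g (U, \<phi>) p *v x)" using chart_metric(3)[OF c] by blast
      moreover have "g (U, \<phi>) p *v x = 0"
        using that by (simp add: gJ flip: matrix_vector_mul_assoc)
      ultimately show False by simp
    qed
    then show ?thesis unfolding invertible_left_inverse matrix_left_invertible_ker by blast
  qed
  ultimately show False by simp
qed

lemma interior_iff:
  assumes "(U, \<phi>) \<in> A" "p \<in> U"
  shows "p \<in> mfd_interior N A \<longleftrightarrow> 0 < \<phi> p $ bdry_coord"
proof -
  have p: "p \<in> topspace N" using chart_subset[OF assms(1)] assms(2) by blast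
  have "\<phi> p \<in> half_space" using chart_image_half_space[OF assms(1)] assms(2) by blast
  then have "0 < \<phi> p $ bdry_coord \<longleftrightarrow> \<phi> p $ bdry_coord \<noteq> 0" by (auto simp: half_space_def)
  also have "\<dots> \<longleftrightarrow> p \<notin> mfd_boundary A"
    using boundary_chart_independent[OF assms] boundary_if[OF assms]
    by (auto simp: mfd_boundary_def)
  finally show ?thesis using p by (simp add: mfd_interior_def)
qed

text \<open>Coefficients \<open>a\<close>, \<open>b\<close> of minus the positive Laplacian in a chart around the point with coordinates
  \<open>x0\<close>. They are smooth on a full ball, also across the hyperplane, which gives bounds on their
  derivatives up to the boundary; the relation to the metric is only required inside the
  half-space.\<close>

definition local_coefficients ::
    "'a set \<Rightarrow> ('a \<Rightarrow> real^'n) \<Rightarrow> real^'n \<Rightarrow> real \<Rightarrow> ('n \<Rightarrow> 'n \<Rightarrow> real^'n \<Rightarrow> real) \<Rightarrow> ('n \<Rightarrow> real^'n \<Rightarrow> real) \<Rightarrow> bool" where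
  "local_coefficients U \<phi> x0 r a b \<longleftrightarrow>
     ball x0 r \<inter> half_space \<subseteq> \<phi> ` U \<and>
     (\<forall>i j. smooth_open (ball x0 r) (a i j)) \<and> (\<forall>i. smooth_open (ball x0 r) (b i)) \<and>
     (\<forall>x\<in>ball x0 r \<inter> half_space. \<forall>i j. a i j x = matrix_inv (g (U, \<phi>) (inv_into U \<phi> x)) $ i $ j) \<and>
     (\<forall>u. smooth_function A u \<longrightarrow> (\<forall>x\<in>ball x0 r. 0 < x $ bdry_coord \<longrightarrow>
        laplacian g (U, \<phi>) u (inv_into U \<phi> x) = - elliptic_op a b (u \<circ> inv_into U \<phi>) x))"

text \<open>The components of the metric have smooth extensions to a full ball, on a smaller one of which the
  determinant stays positive. There \<open>a\<close> is the inverse matrix, and expanding the divergence gives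
  \<open>b\<^sub>j = s\<^sup>-\<^sup>1 \<Sum>\<^sub>i \<partial>\<^sub>i(a\<^sub>i\<^sub>j s)\<close> with \<open>s\<close> the square root of the determinant.\<close>

lemma local_coefficients_exist:
  assumes c: "(U, \<phi>) \<in> A" "p \<in> U"
  shows "\<exists>r>0. \<exists>a b. local_coefficients U \<phi> (\<phi> p) r a b"
proof -
  let ?S = "\<phi> ` U" and ?G = "\<lambda>x. g (U, \<phi>) (inv_into U \<phi> x)"
  have pS: "\<phi> p \<in> ?S" using c(2) by blast
  note oS = chart_image_open[OF c(1)]
  obtain r0 where r0: "r0 > 0" "ball (\<phi> p) r0 \<inter> half_space \<subseteq> ?S"
    using oS pS unfolding openin_contains_ball by blast
  have "\<exists>r F. r > 0 \<and> smooth_open (ball (\<phi> p) r) F \<and> (\<forall>y\<in>?S \<inter> ball (\<phi> p) r. F y = ?G y $ i $ j)" for i j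
    by (rule smooth_on_extension[OF chart_metric(1)[OF c(1), of i j] pS]) blast
  then obtain \<rho> E where E: "\<And>i j. \<rho> i j > 0" "\<And>i j. smooth_open (ball (\<phi> p) (\<rho> i j)) (E i j)"
    "\<And>i j y. y \<in> ?S \<inter> ball (\<phi> p) (\<rho> i j) \<Longrightarrow> E i j y = ?G y $ i $ j"
    by metis
  define r1 where "r1 = Min (insert r0 (range (\<lambda>(i, j). \<rho> i j)))"
  have r1: "r1 > 0" "r1 \<le> r0" "\<And>i j. r1 \<le> \<rho> i j"
  proof -
    show "r1 > 0" using r0 E(1) by (auto simp: r1_def)
    show "r1 \<le> r0" unfolding r1_def by (intro Min_le) auto
    show "r1 \<le> \<rho> i j" for i j
      unfolding r1_def by (intro Min_le) (auto intro: image_eqI[of _ _ "(i, j)"])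
  qed
  define H where "H x = (\<chi> i j. E i j x)" for x
  have sH1: "smooth_open (ball (\<phi> p) r1) (\<lambda>x. H x $ i $ j)" for i j
    unfolding H_def using smooth_open_subset[OF E(2)[of i j], of "ball (\<phi> p) r1"] r1(3)[of i j]
    by (simp add: subset_ball)
  have HG: "H x = ?G x" if "x \<in> ball (\<phi> p) r1 \<inter> half_space" for x
  proof -
    have "x \<in> ?S" using that r0 r1 by auto
    moreover have "x \<in> ball (\<phi> p) (\<rho> i j)" for i j using that r1(3)[of i j] by auto
    ultimately show ?thesis by (simp add: vec_eq_iff H_def E(3))
  qed
  have inv_U: "inv_into U \<phi> x \<in> U" if "x \<in> ball (\<phi> p) r1 \<inter> half_space" for x
    using that r0 r1 by (intro inv_into_into) auto
  have pb: "\<phi> p \<in> ball (\<phi> p) r1 \<inter> half_space"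
    using r1 pS chart_image_half_space[OF c(1)] by auto
  have sdet1: "smooth_open (ball (\<phi> p) r1) (\<lambda>x. det (H x))"
    by (rule smooth_open_det[OF open_ball sH1])
  have "det (H (\<phi> p)) > 0"
    unfolding HG[OF pb] using chart_metric(2,3)[OF c(1) inv_U[OF pb]] by (intro pos_def_det) auto
  moreover have "isCont (\<lambda>x. det (H x)) (\<phi> p)"
    using smooth_open_continuous[OF sdet1] r1(1) by (simp add: continuous_on_eq_continuous_at)
  ultimately have "\<forall>\<^sub>F x in at (\<phi> p). 0 < det (H x)"
    by (intro order_tendstoD(1)[of _ "det (H (\<phi> p))"]) (auto simp: isCont_def)
  then obtain r2 where r2: "r2 > 0" "\<And>x. x \<noteq> \<phi> p \<Longrightarrow> dist x (\<phi> p) < r2 \<Longrightarrow> 0 < det (H x)"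
    unfolding eventually_at by blast
  define r where "r = min r1 r2"
  have r: "r > 0" "r \<le> r1" "r \<le> r2" using r1 r2 by (auto simp: r_def)
  have detH: "0 < det (H x)" if "x \<in> ball (\<phi> p) r" for x
    using that r2(2)[of x] \<open>det (H (\<phi> p)) > 0\<close> r by (cases "x = \<phi> p") (auto simp: dist_commute)
  have sub: "ball (\<phi> p) r \<subseteq> ball (\<phi> p) r1" using r by auto
  have sH: "smooth_open (ball (\<phi> p) r) (\<lambda>x. H x $ i $ j)" for i j
    by (rule smooth_open_subset[OF sH1 sub]) simp
  define a where "a i j x = matrix_inv (H x) $ i $ j" for i j x
  define s where "s x = sqrt (det (H x))" for x
  define b where "b j x = (\<Sum>i\<in>UNIV. pd i (\<lambda>y. a i j y * s y) x) / s x" for j x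
  have sa: "smooth_open (ball (\<phi> p) r) (a i j)" for i j
    unfolding a_def[abs_def] using detH by (intro smooth_open_matrix_inv sH) (auto simp: order_less_imp_not_eq2)
  have ss: "smooth_open (ball (\<phi> p) r) s"
    unfolding s_def[abs_def] using detH by (intro smooth sH open_ball)
  have s0: "s x > 0" if "x \<in> ball (\<phi> p) r" for x using detH[OF that] by (simp add: s_def)
  have sb: "smooth_open (ball (\<phi> p) r) (b j)" for j
    unfolding b_def[abs_def] using s0 by (intro smooth sa ss open_ball) (auto simp: order_less_imp_not_eq2)
  have lap: "laplacian g (U, \<phi>) u (inv_into U \<phi> x) = - elliptic_op a b (u \<circ> inv_into U \<phi>) x"
    if u: "smooth_function A u" and x: "x \<in> ball (\<phi> p) r" "0 < x $ bdry_coord" for u x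
  proof -
    let ?f = "u \<circ> inv_into U \<phi>"
    define V where "V = ball (\<phi> p) r \<inter> {x. 0 < x $ bdry_coord}"
    have V: "open V" "x \<in> V" using x open_half by (auto simp: V_def)
    have VH: "V \<subseteq> ball (\<phi> p) r1 \<inter> half_space" using sub by (auto simp: V_def half_space_def)
    then have VS: "V \<subseteq> ?S" using r0 r1 by force
    have xS: "x \<in> ?S" using V VS by blast
    then have \<phi>x: "\<phi> (inv_into U \<phi> x) = x" by (rule f_inv_into_f)
    have sf: "smooth_open V ?f"
      by (rule smooth_open_subset[OF smooth_on_interior[OF oS chart_smooth_function[OF c(1) u]] _ V(1)])
         (use VS in \<open>auto simp: V_def\<close>)
    have Vb: "V \<subseteq> ball (\<phi> p) r" by (simp add: V_def)
    note saV = smooth_open_subset[OF sa Vb V(1)] and ssV = smooth_open_subset[OF ss Vb V(1)]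
    have term_eq: "pderiv_on ?S i (\<lambda>x. matrix_inv (?G x) $ i $ j * sqrt (det (?G x)) * pderiv_on ?S j ?f x) x
        = a i j x * s x * pd i (pd j ?f) x + pd i (\<lambda>y. a i j y * s y) x * pd j ?f x" for i j
    proof -
      have "x \<in> interior ?S" using V VS interiorI by blast
      then have "at x within ?S = at x" by (rule at_within_interior)
      then have "pderiv_on ?S i (\<lambda>x. matrix_inv (?G x) $ i $ j * sqrt (det (?G x)) * pderiv_on ?S j ?f x) x
          = pd i (\<lambda>x. matrix_inv (?G x) $ i $ j * sqrt (det (?G x)) * pderiv_on ?S j ?f x) x"
        by (simp add: pderiv_on_def pd_def)
      also have "\<dots> = pd i (\<lambda>x. (a i j x * s x) * pd j ?f x) x"
      proof (rule pd_cong[OF V])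
        fix y assume y: "y \<in> V"
        then have "y \<in> ?S" "0 < y $ bdry_coord" using VS by (auto simp: V_def)
        then have "pderiv_on ?S j ?f y = pd j ?f y"
          by (rule pderiv_on_interior[OF oS chart_smooth_function[OF c(1) u]])
        moreover have "H y = ?G y" using y VH by (intro HG) blast
        ultimately show "matrix_inv (?G y) $ i $ j * sqrt (det (?G y)) * pderiv_on ?S j ?f y = (a i j y * s y) * pd j ?f y"
          by (simp add: a_def s_def)
      qed
      also have "\<dots> = a i j x * s x * pd i (pd j ?f) x + pd i (\<lambda>y. a i j y * s y) x * pd j ?f x"
        by (intro pd_mult smooth_open_differentiable[OF _ V(2)] smooth saV ssV sf)
      finally show ?thesis .
    qed
    have Gx: "?G x = H x" using HG VH V(2) by (metis subsetD)
    have sx: "s x > 0" using s0 x by simp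
    have "laplacian g (U, \<phi>) u (inv_into U \<phi> x) =
      - (1 / s x) * (\<Sum>i\<in>UNIV. \<Sum>j\<in>UNIV. a i j x * s x * pd i (pd j ?f) x + pd i (\<lambda>y. a i j y * s y) x * pd j ?f x)"
      unfolding laplacian_def by (simp add: \<phi>x term_eq Gx s_def)
    also have "\<dots> = - (1 / s x) * (\<Sum>i\<in>UNIV. \<Sum>j\<in>UNIV. s x * (a i j x * pd i (pd j ?f) x))
        - (1 / s x) * (\<Sum>i\<in>UNIV. \<Sum>j\<in>UNIV. pd i (\<lambda>y. a i j y * s y) x * pd j ?f x)"
      by (simp add: sum.distrib algebra_simps)
    also have "\<dots> = - (\<Sum>i\<in>UNIV. \<Sum>j\<in>UNIV. a i j x * pd i (pd j ?f) x)
        - (\<Sum>j\<in>UNIV. b j x * pd j ?f x)"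
    proof -
      have "(\<Sum>i\<in>UNIV. \<Sum>j\<in>UNIV. pd i (\<lambda>y. a i j y * s y) x * pd j ?f x)
          = (\<Sum>j\<in>UNIV. \<Sum>i\<in>UNIV. pd i (\<lambda>y. a i j y * s y) x * pd j ?f x)" by (rule sum.swap)
      also have "\<dots> = s x * (\<Sum>j\<in>UNIV. b j x * pd j ?f x)"
      proof -
        have "(\<Sum>i\<in>UNIV. pd i (\<lambda>y. a i j y * s y) x * pd j ?f x) = s x * (b j x * pd j ?f x)" for j
          using sx by (simp add: b_def flip: sum_distrib_right)
        then show ?thesis by (simp add: sum_distrib_left)
      qed
      finally show ?thesis using sx by (simp flip: sum_distrib_left)
    qed
    finally show ?thesis by (simp add: elliptic_op_def)
  qed
  have "local_coefficients U \<phi> (\<phi> p) r a b"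
    unfolding local_coefficients_def
  proof (intro conjI allI ballI impI sa sb lap)
    show "ball (\<phi> p) r \<inter> half_space \<subseteq> ?S" using r0 r1 r by force
  next
    fix x i j assume "x \<in> ball (\<phi> p) r \<inter> half_space"
    then show "a i j x = matrix_inv (?G x) $ i $ j" using HG sub by (auto simp: a_def)
  qed
  then show ?thesis using r(1) by blast
qed

lemma local_coefficients_bounds:
  assumes c: "(U, \<phi>) \<in> A" and x0: "x0 \<in> half_space" and r: "0 < r" and loc: "local_coefficients U \<phi> x0 r a b"
  shows "\<exists>\<theta>>0. \<exists>\<Lambda>\<ge>1. \<forall>x\<in>cball x0 (r / 2) \<inter> half_space. elliptic_at \<theta> \<Lambda> a b x \<and> coeff_derivs_le \<Lambda> a b x"
proof -
  define K where "K = cball x0 (r / 2) \<inter> half_space"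
  have "compact K" unfolding K_def by (intro compact_Int_closed closed_half_space) auto
  have K: "K \<subseteq> ball x0 r" "x0 \<in> K" using r x0 by (auto simp: K_def)
  have sa: "smooth_open (ball x0 r) (a i j)" and sb: "smooth_open (ball x0 r) (b i)" for i j
    using loc by (auto simp: local_coefficients_def)
  have cont: "continuous_on K f" if "smooth_open (ball x0 r) f" for f
    using smooth_open_continuous[OF that] K continuous_on_subset by blast
  have pos_def: "transpose (g (U, \<phi>) (inv_into U \<phi> x)) = g (U, \<phi>) (inv_into U \<phi> x)"
      "v \<noteq> 0 \<Longrightarrow> 0 < v \<bullet> (g (U, \<phi>) (inv_into U \<phi> x) *v v)" if "x \<in> K" for x v
  proof -
    have "x \<in> \<phi> ` U" using loc that K by (auto simp: local_coefficients_def K_def)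
    then have "inv_into U \<phi> x \<in> U" by (rule inv_into_into)
    then show "transpose (g (U, \<phi>) (inv_into U \<phi> x)) = g (U, \<phi>) (inv_into U \<phi> x)"
      "v \<noteq> 0 \<Longrightarrow> 0 < v \<bullet> (g (U, \<phi>) (inv_into U \<phi> x) *v v)"
      using chart_metric[OF c] by blast+
  qed
  have aK: "a i j x = matrix_inv (g (U, \<phi>) (inv_into U \<phi> x)) $ i $ j" if "x \<in> K" for x i j
    using loc that K by (auto simp: local_coefficients_def K_def)
  have sym: "a i j x = a j i x" if "x \<in> K" for x i j
  proof -
    let ?M = "matrix_inv (g (U, \<phi>) (inv_into U \<phi> x))"
    have "transpose ?M $ i $ j = ?M $ i $ j" using pos_def_inv_sym[OF pos_def[OF that]] by simp
    then show ?thesis by (simp add: aK[OF that] transpose_def)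
  qed
  \<comment> \<open>the lower ellipticity constant is the minimum of the quadratic form over unit vectors\<close>
  define Q where "Q = (\<lambda>(x, v). \<Sum>i\<in>UNIV. \<Sum>j\<in>UNIV. a i j x * v $ i * v $ j)"
  have Qpos: "Q (x, v) > 0" if "x \<in> K" "v \<noteq> 0" for x v
  proof -
    have "Q (x, v) = v \<bullet> (matrix_inv (g (U, \<phi>) (inv_into U \<phi> x)) *v v)"
      unfolding inner_matrix_vector_sum Q_def using aK[OF that(1)] by simp
    then show ?thesis using pos_def_inv_pos[OF pos_def[OF that(1)] that(2)] by simp
  qed
  have "continuous_on (K \<times> sphere 0 1) Q"
    unfolding Q_def case_prod_unfold
    by (intro continuous_intros continuous_on_compose2[OF cont[OF sa]]) auto
  moreover have "compact (K \<times> sphere (0::real^'n) 1)"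
    using \<open>compact K\<close> compact_Times compact_sphere by blast
  moreover have "K \<times> sphere (0::real^'n) 1 \<noteq> {}"
    using K(2) norm_axis_1[of "bdry_coord :: 'n"] by (auto simp del: norm_axis_1)
  ultimately obtain z where z: "z \<in> K \<times> sphere 0 1" "\<And>y. y \<in> K \<times> sphere 0 1 \<Longrightarrow> Q z \<le> Q y"
    using continuous_attains_inf by metis
  define \<theta> where "\<theta> = Q z"
  have \<theta>: "\<theta> > 0"
  proof -
    have "fst z \<in> K" "snd z \<noteq> 0" using z(1) by force+
    then show ?thesis using Qpos[of "fst z" "snd z"] by (simp add: \<theta>_def)
  qed
  have ell: "\<theta> * (\<Sum>i\<in>UNIV. (v i)\<^sup>2) \<le> (\<Sum>i\<in>UNIV. \<Sum>j\<in>UNIV. a i j x * v i * v j)" if "x \<in> K" for x v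
  proof -
    define w where "w = (\<chi> i. v i)"
    have "\<theta> * (norm w)\<^sup>2 \<le> Q (x, w)"
    proof (cases "w = 0")
      case True
      then show ?thesis by (simp add: Q_def)
    next
      case False
      have "Q (x, w) = (norm w)\<^sup>2 * Q (x, w /\<^sub>R norm w)"
        using False by (simp add: Q_def sum_distrib_left field_simps power2_eq_square)
      moreover have "\<theta> \<le> Q (x, w /\<^sub>R norm w)"
        unfolding \<theta>_def using that False by (intro z(2)) auto
      then have "(norm w)\<^sup>2 * \<theta> \<le> (norm w)\<^sup>2 * Q (x, w /\<^sub>R norm w)"
        by (intro mult_left_mono) auto
      ultimately show ?thesis by (simp add: mult.commute)
    qed
    moreover have "(norm w)\<^sup>2 = (\<Sum>i\<in>UNIV. (v i)\<^sup>2)"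
      unfolding power2_norm_eq_inner inner_vec_def by (simp add: w_def power2_eq_square)
    ultimately show ?thesis by (simp add: Q_def w_def)
  qed
  note bound = uniform_bound[OF \<open>compact K\<close>]
  obtain B1 where B1: "B1 \<ge> 0" "\<forall>i. \<forall>x\<in>K. \<bar>a (fst i) (snd i) x\<bar> \<le> B1"
    using bound[where f = "\<lambda>i. a (fst i) (snd i)", OF cont[OF sa]] by blast
  obtain B2 where B2: "B2 \<ge> 0" "\<forall>i. \<forall>x\<in>K. \<bar>b i x\<bar> \<le> B2"
    using bound[where f = b, OF cont[OF sb]] by blast
  obtain B3 where B3: "B3 \<ge> 0" "\<forall>i. \<forall>x\<in>K. \<bar>pd (fst i) (a (fst (snd i)) (snd (snd i))) x\<bar> \<le> B3"
    using bound[where f = "\<lambda>i. pd (fst i) (a (fst (snd i)) (snd (snd i)))", OF cont[OF smooth_open_pd[OF sa]]]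
    by blast
  obtain B4 where B4: "B4 \<ge> 0" "\<forall>i. \<forall>x\<in>K. \<bar>pd (fst (fst i)) (pd (snd (fst i)) (a (fst (snd i)) (snd (snd i)))) x\<bar> \<le> B4"
    using bound[where f = "\<lambda>i. pd (fst (fst i)) (pd (snd (fst i)) (a (fst (snd i)) (snd (snd i))))",
        OF cont[OF smooth_open_pd[OF smooth_open_pd[OF sa]]]]
    by blast
  obtain B5 where B5: "B5 \<ge> 0" "\<forall>i. \<forall>x\<in>K. \<bar>pd (fst i) (b (snd i)) x\<bar> \<le> B5"
    using bound[where f = "\<lambda>i. pd (fst i) (b (snd i))", OF cont[OF smooth_open_pd[OF sb]]] by blast
  define \<Lambda> where "\<Lambda> = 1 + B1 + B2 + B3 + B4 + B5"
  have \<Lambda>: "\<Lambda> \<ge> 1" "B1 \<le> \<Lambda>" "B2 \<le> \<Lambda>" "B3 \<le> \<Lambda>" "B4 \<le> \<Lambda>" "B5 \<le> \<Lambda>"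
    using B1(1) B2(1) B3(1) B4(1) B5(1) by (auto simp: \<Lambda>_def)
  have "elliptic_at \<theta> \<Lambda> a b x" if x: "x \<in> K" for x
  proof -
    have "\<bar>a i j x\<bar> \<le> \<Lambda>" "\<bar>b i x\<bar> \<le> \<Lambda>" for i j
      using B1(2)[rule_format, OF x, of "(i, j)"] B2(2)[rule_format, OF x, of i] \<Lambda> by simp_all
    then show ?thesis using sym[OF x] ell[OF x] by (simp add: elliptic_at_def)
  qed
  moreover have "coeff_derivs_le \<Lambda> a b x" if x: "x \<in> K" for x
  proof -
    have "\<bar>pd k (a i j) x\<bar> \<le> \<Lambda>" "\<bar>pd k (pd l (a i j)) x\<bar> \<le> \<Lambda>" "\<bar>pd k (b i) x\<bar> \<le> \<Lambda>" for i j k l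
      using B3(2)[rule_format, OF x, of "(k, i, j)"] B4(2)[rule_format, OF x, of "((k, l), (i, j))"]
        B5(2)[rule_format, OF x, of "(k, i)"] \<Lambda> by simp_all
    then show ?thesis by (simp add: coeff_derivs_le_def)
  qed
  ultimately show ?thesis using \<theta> \<Lambda>(1) unfolding K_def by blast
qed

end

section \<open>Continuous functions on the manifold and their supremum norm\<close>

lemma open_not_negligible:
  fixes W :: "'b::euclidean_space set"
  assumes "open W" "x \<in> W"
  shows "\<not> negligible W"
proof
  assume neg: "negligible W"
  obtain e where e: "e > 0" "ball x e \<subseteq> W" using assms openE by blast
  obtain c d where cd: "x \<in> box c d" "box c d \<subseteq> ball x e" using rational_boxes[OF e(1)] by metis
  then have "negligible (box c d)" using negligible_subset[OF neg] e(2) by blast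
  then show False using cd(1) by (simp add: negligible_interval)
qed

context riemannian_manifold
begin

lemma chart_exists:
  assumes "p \<in> topspace N"
  obtains U \<phi> where "(U, \<phi>) \<in> A" "p \<in> U"
proof -
  have "(\<Union>c\<in>A. fst c) = topspace N"
    using manifold unfolding smooth_manifold_with_boundary_def by (elim conjE)
  then show thesis using assms that by fastforce
qed

text \<open>A real function is continuous if around every point it is, in some chart, a continuous
  function of the coordinates.\<close>

lemma continuous_map_locally:
  fixes f :: "'a \<Rightarrow> real"
  assumes "\<And>p. p \<in> topspace N \<Longrightarrow> \<exists>U \<phi> V h. (U, \<phi>) \<in> A \<and> p \<in> U \<and> open V \<and> \<phi> p \<in> V \<and>
      continuous_on (\<phi> ` U \<inter> V) h \<and> (\<forall>q\<in>U. \<phi> q \<in> V \<longrightarrow> f q = h (\<phi> q))"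
  shows "continuous_map N euclideanreal f"
  unfolding continuous_map
proof (intro conjI allI impI)
  fix T :: "real set" assume "openin euclideanreal T"
  then have T: "open T" by simp
  show "openin N {p \<in> topspace N. f p \<in> T}"
  proof (subst openin_subopen, safe)
    fix p assume p: "p \<in> topspace N" "f p \<in> T"
    obtain U \<phi> V h where c: "(U, \<phi>) \<in> A" "p \<in> U" and V: "open V" "\<phi> p \<in> V"
      and h: "continuous_on (\<phi> ` U \<inter> V) h" "\<forall>q\<in>U. \<phi> q \<in> V \<longrightarrow> f q = h (\<phi> q)"
      using assms[OF p(1)] by blast
    obtain X where X: "open X" "X \<inter> (\<phi> ` U \<inter> V) = h -` T \<inter> (\<phi> ` U \<inter> V)"
      using continuous_on_open_invariant[THEN iffD1, OF h(1)] T by blast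
    let ?Y = "{q \<in> U. \<phi> q \<in> V \<inter> X}"
    have "openin N ?Y" using V X by (intro chart_preimage_open[OF c(1)]) auto
    moreover have "p \<in> ?Y" using X(2) V(2) c(2) h(2) p(2) by auto
    moreover have "?Y \<subseteq> {p \<in> topspace N. f p \<in> T}"
      using X(2) h(2) chart_subset[OF c(1)] by auto
    ultimately show "\<exists>Y. openin N Y \<and> p \<in> Y \<and> Y \<subseteq> {p \<in> topspace N. f p \<in> T}" by blast
  qed
qed simp

lemma continuous_smooth_function:
  assumes u: "smooth_function A u"
  shows "continuous_map N euclideanreal u"
proof (rule continuous_map_locally)
  fix p assume "p \<in> topspace N"
  then obtain U \<phi> where c: "(U, \<phi>) \<in> A" "p \<in> U" by (rule chart_exists)
  have "continuous_on (\<phi> ` U \<inter> UNIV) (u \<circ> inv_into U \<phi>)"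
    using smooth_on_continuous[OF chart_smooth_function[OF c(1) u]] by simp
  moreover have "\<forall>q\<in>U. u q = (u \<circ> inv_into U \<phi>) (\<phi> q)" using chart_inv[OF c(1)] by simp
  ultimately show "\<exists>U \<phi> V h. (U, \<phi>) \<in> A \<and> p \<in> U \<and> open V \<and> \<phi> p \<in> V \<and>
      continuous_on (\<phi> ` U \<inter> V) h \<and> (\<forall>q\<in>U. \<phi> q \<in> V \<longrightarrow> u q = h (\<phi> q))"
    using c by (intro exI[of _ U] exI[of _ \<phi>] exI[of _ UNIV] exI[of _ "u \<circ> inv_into U \<phi>"]) auto
qed

text \<open>In a chart, \<open>|\<nabla>u|\<^sup>2 = \<Sum>\<^sub>i\<^sub>j g\<^sup>i\<^sup>j \<partial>\<^sub>iu \<partial>\<^sub>ju\<close>.\<close>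

lemma gradient_length_chart_eq:
  assumes u: "smooth_function A u" and c: "(U, \<phi>) \<in> A" "p \<in> U"
  defines "D \<equiv> \<lambda>i. pderiv_on (\<phi> ` U) i (u \<circ> inv_into U \<phi>) (\<phi> p)"
  shows "gradient_length A g u p
      = sqrt (\<Sum>i\<in>UNIV. \<Sum>j\<in>UNIV. matrix_inv (g (U, \<phi>) p) $ i $ j * (D i * D j))"
    and "0 \<le> (\<Sum>i\<in>UNIV. \<Sum>j\<in>UNIV. matrix_inv (g (U, \<phi>) p) $ i $ j * (D i * D j))"
proof -
  let ?G = "g (U, \<phi>) p"
  define d where "d = partials (U, \<phi>) u p"
  have d: "d $ i = D i" for i by (simp add: d_def partials_def D_def)
  note G = chart_metric(2,3)[OF c]
  have "?G *v (matrix_inv ?G *v d) = d"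
    using matrix_inv_mult[OF pos_def_invertible[OF G]] by (simp add: matrix_vector_mul_assoc)
  then have "(matrix_inv ?G *v d) \<bullet> (?G *v (matrix_inv ?G *v d)) = d \<bullet> (matrix_inv ?G *v d)"
    by (simp add: inner_commute)
  also have "\<dots> = (\<Sum>i\<in>UNIV. \<Sum>j\<in>UNIV. matrix_inv ?G $ i $ j * (D i * D j))"
    unfolding inner_matrix_vector_sum by (simp add: d mult.assoc)
  finally have eq: "(matrix_inv ?G *v d) \<bullet> (?G *v (matrix_inv ?G *v d)) = \<dots>" .
  show "gradient_length A g u p
      = sqrt (\<Sum>i\<in>UNIV. \<Sum>j\<in>UNIV. matrix_inv (g (U, \<phi>) p) $ i $ j * (D i * D j))"
    using gradient_length_chart[OF manifold metric u c(1)] c(2) eq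
    by (simp add: tangent_length_def gradient_def d_def)
  have "0 \<le> v \<bullet> (?G *v v)" for v using G(2)[of v] by (cases "v = 0") auto
  then show "0 \<le> (\<Sum>i\<in>UNIV. \<Sum>j\<in>UNIV. matrix_inv (g (U, \<phi>) p) $ i $ j * (D i * D j))"
    unfolding eq[symmetric] .
qed

lemma gradient_length_nonneg:
  assumes "smooth_function A u" "p \<in> topspace N"
  shows "0 \<le> gradient_length A g u p"
  by (rule chart_exists[OF assms(2)]) (simp add: gradient_length_chart_eq[OF assms(1)])

lemma gradient_length_local:
  assumes u: "smooth_function A u" and c: "(U, \<phi>) \<in> A" and loc: "local_coefficients U \<phi> x0 r a b"
    and p: "p \<in> U" "\<phi> p \<in> ball x0 r"
  defines "D \<equiv> \<lambda>i. pderiv_on (\<phi> ` U) i (u \<circ> inv_into U \<phi>) (\<phi> p)"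
  shows "(gradient_length A g u p)\<^sup>2 = (\<Sum>i\<in>UNIV. \<Sum>j\<in>UNIV. a i j (\<phi> p) * (D i * D j))"
proof -
  have "\<phi> p \<in> ball x0 r \<inter> half_space" using p chart_image_half_space[OF c] by blast
  then have "a i j (\<phi> p) = matrix_inv (g (U, \<phi>) p) $ i $ j" for i j
    using loc chart_inv[OF c p(1)] unfolding local_coefficients_def by metis
  then show ?thesis
    using gradient_length_chart_eq[OF u c p(1)] by (simp add: D_def)
qed

lemma continuous_gradient_length:
  assumes u: "smooth_function A u"
  shows "continuous_map N euclideanreal (gradient_length A g u)"
proof (rule continuous_map_locally)
  fix p assume pN: "p \<in> topspace N"
  then obtain U \<phi> where c: "(U, \<phi>) \<in> A" "p \<in> U" by (rule chart_exists)
  obtain r a b where r: "r > 0" and loc: "local_coefficients U \<phi> (\<phi> p) r a b"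
    using local_coefficients_exist[OF c] by blast
  let ?D = "\<lambda>i. pderiv_on (\<phi> ` U) i (u \<circ> inv_into U \<phi>)"
  define h where "h x = sqrt (\<Sum>i\<in>UNIV. \<Sum>j\<in>UNIV. a i j x * (?D i x * ?D j x))" for x
  have "continuous_on (ball (\<phi> p) r) (a i j)" for i j
    using loc unfolding local_coefficients_def by (blast intro: smooth_open_continuous)
  then have "continuous_on (\<phi> ` U \<inter> ball (\<phi> p) r) (a i j)" for i j
    using continuous_on_subset by blast
  moreover have "continuous_on (\<phi> ` U \<inter> ball (\<phi> p) r) (?D i)" for i
    using continuous_on_pderiv_on[OF chart_image_open[OF c(1)] chart_smooth_function[OF c(1) u]]
      continuous_on_subset by blast
  ultimately have "continuous_on (\<phi> ` U \<inter> ball (\<phi> p) r) h"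
    unfolding h_def by (intro continuous_intros)
  moreover have "gradient_length A g u q = h (\<phi> q)" if "q \<in> U" "\<phi> q \<in> ball (\<phi> p) r" for q
    using gradient_length_local[OF u c(1) loc that] gradient_length_nonneg[OF u, of q] chart_subset[OF c(1)] that
    unfolding h_def by (metis real_sqrt_abs abs_of_nonneg subsetD)
  ultimately show "\<exists>U \<phi> V h. (U, \<phi>) \<in> A \<and> p \<in> U \<and> open V \<and> \<phi> p \<in> V \<and>
      continuous_on (\<phi> ` U \<inter> V) h \<and> (\<forall>q\<in>U. \<phi> q \<in> V \<longrightarrow> gradient_length A g u q = h (\<phi> q))"
    using c r by (intro exI[of _ U] exI[of _ \<phi>] exI[of _ "ball (\<phi> p) r"] exI[of _ h]) auto
qed

text \<open>Nonempty open sets are not null, hence for continuous bounded functions the essential supremum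
  is the supremum.\<close>

lemma open_not_null:
  assumes Y: "openin N Y" "p \<in> Y"
  shows "\<not> null_set A Y"
proof
  assume null: "null_set A Y"
  obtain U \<phi> where c: "(U, \<phi>) \<in> A" "p \<in> U"
    using chart_exists openin_subset[OF Y(1)] Y(2) by blast
  let ?R = "\<phi> ` (Y \<inter> U)"
  have "openin (subtopology N U) (U \<inter> Y)" using Y(1) by (rule openin_subtopology_Int2)
  then have "openin (top_of_set (\<phi> ` U)) (\<phi> ` (U \<inter> Y))"
    using homeomorphic_map_openness_eq[OF chart_homeo[OF c(1)]] by simp
  then have "openin (top_of_set half_space) (\<phi> ` (U \<inter> Y))"
    using chart_image_open[OF c(1)] by (rule openin_trans)
  then have oR: "openin (top_of_set half_space) ?R" by (simp add: Int_commute)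
  have pR: "\<phi> p \<in> ?R" using c(2) Y(2) by blast
  obtain r where r: "r > 0" "ball (\<phi> p) r \<inter> half_space \<subseteq> ?R"
    using oR pR unfolding openin_contains_ball by blast
  define W where "W = ?R \<inter> {x. 0 < x $ bdry_coord}"
  have "open W" unfolding W_def by (rule open_half_space_part[OF oR])
  moreover have "\<phi> p + (r / 2) *\<^sub>R axis bdry_coord 1 \<in> W"
  proof -
    have "0 \<le> \<phi> p $ bdry_coord" using chart_image_half_space[OF c(1)] c(2) by (auto simp: half_space_def)
    moreover have "dist (\<phi> p) (\<phi> p + (r / 2) *\<^sub>R axis bdry_coord 1) < r"
      using r(1) by (simp add: dist_norm)
    ultimately show ?thesis using r by (auto simp: W_def half_space_def axis_def subset_eq)
  qed
  moreover have "negligible W"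
    using null c(1) negligible_subset[of ?R W] by (auto simp: null_set_def W_def)
  ultimately show False using open_not_negligible by blast
qed

lemma Linf_norm_ge:
  assumes f: "continuous_map N euclideanreal f" and p: "p \<in> topspace N"
    and bound: "\<And>q. q \<in> topspace N \<Longrightarrow> \<bar>f q\<bar> \<le> B"
  shows "\<bar>f p\<bar> \<le> Linf_norm N A f"
  unfolding Linf_norm_def
proof (rule cInf_greatest)
  have "{q \<in> topspace N. \<bar>B\<bar> < \<bar>f q\<bar>} = {}" using bound by force
  then have "null_set A {q \<in> topspace N. \<bar>B\<bar> < \<bar>f q\<bar>}" by (simp only:) (simp add: null_set_def)
  then have "\<bar>B\<bar> \<in> {C. 0 \<le> C \<and> null_set A {q \<in> topspace N. C < \<bar>f q\<bar>}}" by simp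
  then show "{C. 0 \<le> C \<and> null_set A {q \<in> topspace N. C < \<bar>f q\<bar>}} \<noteq> {}" by blast
  fix C assume C: "C \<in> {C. 0 \<le> C \<and> null_set A {q \<in> topspace N. C < \<bar>f q\<bar>}}"
  show "\<bar>f p\<bar> \<le> C"
  proof (rule ccontr)
    assume "\<not> \<bar>f p\<bar> \<le> C"
    then have "p \<in> {q \<in> topspace N. C < \<bar>f q\<bar>}" using p by simp
    moreover have "openin N {q \<in> topspace N. f q \<in> {x. C < \<bar>x\<bar>}}"
      using f by (rule openin_continuous_map_preimage) (auto intro!: open_Collect_less continuous_intros)
    ultimately show False using open_not_null C by auto
  qed
qed

lemma Linf_norm_le:
  assumes "\<And>q. q \<in> topspace N \<Longrightarrow> \<bar>f q\<bar> \<le> B" "0 \<le> B"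
  shows "Linf_norm N A f \<le> B"
  unfolding Linf_norm_def
proof (rule cInf_lower)
  have "{q \<in> topspace N. B < \<bar>f q\<bar>} = {}" using assms(1) by force
  then have "null_set A {q \<in> topspace N. B < \<bar>f q\<bar>}" by (simp only:) (simp add: null_set_def)
  then show "B \<in> {C. 0 \<le> C \<and> null_set A {q \<in> topspace N. C < \<bar>f q\<bar>}}" using assms(2) by simp
qed (auto intro: bdd_belowI[of _ 0])

lemma attains_max:
  assumes "compact_space N" "continuous_map N euclideanreal f" "topspace N \<noteq> {}"
  obtains p where "p \<in> topspace N" "\<And>q. q \<in> topspace N \<Longrightarrow> f q \<le> f p"
proof -
  have "compact (f ` topspace N)"
    using image_compactin[OF assms(1)[unfolded compact_space_def] assms(2)] by simp
  then obtain m where "m \<in> f ` topspace N" "\<forall>y\<in>f ` topspace N. y \<le> m"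
    using compact_attains_sup[of "f ` topspace N"] assms(3) by auto
  then show thesis using that by auto
qed

section \<open>The gradient estimate\<close>

text \<open>The three local estimates at a point \<open>q\<close>, with a common constant \<open>C\<close> valid for all eigenfunctions with
  \<open>\<lambda> \<ge> 1\<close>: Bernstein's estimate if \<open>q\<close> is an interior point where \<open>|\<nabla>e|\<^sup>2 + K \<lambda>\<^sup>2 e\<^sup>2\<close> is maximal, the boundary
  gradient estimate, and the bound of \<open>\<lambda> |e(q)|\<close> by the gradient. Stated pointwise and monotone in
  \<open>C\<close>, they pass from a neighbourhood of each point to the whole compact manifold.\<close>

definition eigenfunction_bounds :: "'a \<Rightarrow> real \<Rightarrow> bool" where
  "eigenfunction_bounds q C \<longleftrightarrow> 0 < C \<and>
     (\<forall>lam\<ge>1. \<forall>e. dirichlet_eigenfunction N A g (lam\<^sup>2) e \<longrightarrow>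
        (\<forall>K\<ge>C. q \<in> mfd_interior N A \<longrightarrow>
           (\<forall>p\<in>topspace N. (gradient_length A g e p)\<^sup>2 + K * lam\<^sup>2 * (e p)\<^sup>2
              \<le> (gradient_length A g e q)\<^sup>2 + K * lam\<^sup>2 * (e q)\<^sup>2) \<longrightarrow>
           (gradient_length A g e q)\<^sup>2 \<le> K * lam\<^sup>2 * (e q)\<^sup>2) \<and>
        (\<forall>M>0. q \<in> mfd_boundary A \<longrightarrow> (\<forall>p\<in>topspace N. \<bar>e p\<bar> \<le> M) \<longrightarrow>
           gradient_length A g e q \<le> C * lam * M) \<and>
        (\<forall>Q. (\<forall>p\<in>topspace N. gradient_length A g e p \<le> Q) \<longrightarrow> lam * \<bar>e q\<bar> \<le> C * Q))"

lemma eigenfunction_bounds_mono: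
  assumes "eigenfunction_bounds q C" "C \<le> C'" and q: "q \<in> topspace N"
  shows "eigenfunction_bounds q C'"
proof -
  have "C * lam * M \<le> C' * lam * M" if "1 \<le> lam" "0 < M" for lam M :: real
    using assms(2) that by (intro mult_right_mono) auto
  moreover have "C * Q \<le> C' * Q"
    if "dirichlet_eigenfunction N A g (lam\<^sup>2) e" "\<forall>p\<in>topspace N. gradient_length A g e p \<le> Q" for lam e Q
  proof (intro mult_right_mono assms(2))
    have "smooth_function A e" using that(1) by (simp add: dirichlet_eigenfunction_def)
    then show "0 \<le> Q" using gradient_length_nonneg[OF _ q] that(2) q by force
  qed
  ultimately show ?thesis
    using assms(1,2) unfolding eigenfunction_bounds_def by (smt (verit))
qed

lemma eigenfunction_half_ball:
  assumes c: "(U, \<phi>) \<in> A" and loc: "local_coefficients U \<phi> x0 r a b"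
    and ell: "\<forall>x\<in>cball x0 (r / 2) \<inter> half_space. elliptic_at \<theta> \<Lambda> a b x"
    and e: "dirichlet_eigenfunction N A g (lam\<^sup>2) e"
    and q: "q \<in> ball x0 (r / 4) \<inter> half_space"
  shows "dirichlet_half_ball \<theta> \<Lambda> a b (r / 4) q lam (e \<circ> inv_into U \<phi>)"
proof -
  let ?f = "e \<circ> inv_into U \<phi>" and ?S = "\<phi> ` U"
  have sub: "ball q (r / 4) \<subseteq> ball x0 (r / 2)"
  proof
    fix x assume "x \<in> ball q (r / 4)"
    then show "x \<in> ball x0 (r / 2)" using q dist_triangle[of x0 x q] by auto
  qed
  have "dist x0 q < r / 4" using q by simp
  then have r: "r > 0" using zero_le_dist[of x0 q] by linarith
  have subr: "ball x0 (r / 2) \<subseteq> ball x0 r" using r by auto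
  have S: "ball q (r / 4) \<inter> half_space \<subseteq> ?S"
    using loc sub subr unfolding local_coefficients_def by blast
  have es: "smooth_function A e" using e by (simp add: dirichlet_eigenfunction_def)
  note fs = chart_smooth_function[OF c es]
  have pos_half: "{x::real^'n. 0 < x $ bdry_coord} \<subseteq> half_space" by (auto simp: half_space_def)
  show ?thesis unfolding dirichlet_half_ball_def
  proof (intro conjI ballI impI)
    show "q \<in> half_space" using q by blast
    show "continuous_on (ball q (r / 4) \<inter> half_space) ?f"
      using smooth_on_continuous[OF fs] S continuous_on_subset by blast
    show "smooth_open (ball q (r / 4) \<inter> {x. 0 < x $ bdry_coord}) ?f"
      by (rule smooth_open_subset[OF smooth_on_interior[OF chart_image_open[OF c] fs]])
         (use S pos_half open_half in auto)
  next
    fix x assume x: "x \<in> ball q (r / 4) \<inter> {x. 0 < x $ bdry_coord}"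
    have xH: "x \<in> half_space" using x pos_half by blast
    have xb: "x \<in> ball x0 (r / 2)" using x sub by blast
    show "elliptic_at \<theta> \<Lambda> a b x" using ell xb xH by auto
    have xS: "x \<in> ?S" using x S pos_half by blast
    then have px: "inv_into U \<phi> x \<in> U" "\<phi> (inv_into U \<phi> x) = x"
      by (auto intro: inv_into_into f_inv_into_f)
    have "inv_into U \<phi> x \<in> mfd_interior N A" using interior_iff[OF c px(1)] px(2) x by simp
    then have "laplacian g (U, \<phi>) e (inv_into U \<phi> x) = lam\<^sup>2 * e (inv_into U \<phi> x)"
      using e c px(1) unfolding dirichlet_eigenfunction_def by fastforce
    moreover have "laplacian g (U, \<phi>) e (inv_into U \<phi> x) = - elliptic_op a b ?f x"
      using loc es xb subr x unfolding local_coefficients_def by blast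
    ultimately show "elliptic_op a b ?f x = - lam\<^sup>2 * ?f x" by simp
  next
    fix x assume x: "x \<in> ball q (r / 4)" "x $ bdry_coord = 0"
    then have "x \<in> ?S" using S by (auto simp: half_space_def)
    then have px: "inv_into U \<phi> x \<in> U" "\<phi> (inv_into U \<phi> x) = x"
      by (auto intro: inv_into_into f_inv_into_f)
    then have "inv_into U \<phi> x \<in> mfd_boundary A" using boundary_if[OF c px(1)] x by simp
    then show "?f x = 0" using e by (simp add: dirichlet_eigenfunction_def)
  qed
qed

text \<open>The estimates in half balls, read in a chart. For \<open>q\<close> within \<open>r/4\<close> of the centre, the ball of radius
  \<open>r/4\<close> about \<open>q\<close> stays where the coefficient bounds hold, so the constants are independent of \<open>q\<close>.\<close>

lemma eigenfunction_bounds_local: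
  assumes p: "p \<in> topspace N"
  shows "\<exists>Y C. openin N Y \<and> p \<in> Y \<and> (\<forall>q\<in>Y. eigenfunction_bounds q C)"
proof -
  obtain U \<phi> where c: "(U, \<phi>) \<in> A" "p \<in> U" using p by (rule chart_exists)
  let ?S = "\<phi> ` U"
  obtain r a b where r: "r > 0" and loc: "local_coefficients U \<phi> (\<phi> p) r a b"
    using local_coefficients_exist[OF c] by blast
  have x0: "\<phi> p \<in> half_space" using chart_image_half_space[OF c(1)] c(2) by blast
  obtain \<theta> \<Lambda> where \<theta>: "\<theta> > 0" and \<Lambda>: "\<Lambda> \<ge> 1"
    and co: "\<forall>x\<in>cball (\<phi> p) (r / 2) \<inter> half_space. elliptic_at \<theta> \<Lambda> a b x \<and> coeff_derivs_le \<Lambda> a b x"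
    using local_coefficients_bounds[OF c(1) x0 r loc] by blast
  define R where "R = r / 4"
  have R: "R > 0" using r by (simp add: R_def)
  obtain K0 where K0: "K0 \<ge> 0" and bernstein: "\<forall>W (a :: 'n \<Rightarrow> 'n \<Rightarrow> real^'n \<Rightarrow> real) b f x lam K.
    x \<in> W \<longrightarrow> (\<forall>i j. smooth_open W (a i j)) \<longrightarrow> (\<forall>i. smooth_open W (b i)) \<longrightarrow> smooth_open W f \<longrightarrow>
    elliptic_at \<theta> \<Lambda> a b x \<longrightarrow> coeff_derivs_le \<Lambda> a b x \<longrightarrow> 1 \<le> lam \<longrightarrow> K0 \<le> K \<longrightarrow>
    (\<forall>y\<in>W. elliptic_op a b f y = - lam\<^sup>2 * f y) \<longrightarrow>
    (\<forall>y\<in>W. carre_du_champ a f f y + K * lam\<^sup>2 * (f y)\<^sup>2 \<le> carre_du_champ a f f x + K * lam\<^sup>2 * (f x)\<^sup>2) \<longrightarrow>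
    carre_du_champ a f f x \<le> K * lam\<^sup>2 * (f x)\<^sup>2"
    using bernstein_interior[OF \<theta>, where 'n = 'n] by blast
  obtain C1 where C1: "C1 > 0" and boundary: "\<forall>(a :: 'n \<Rightarrow> 'n \<Rightarrow> real^'n \<Rightarrow> real) b q lam f M S f'.
    dirichlet_half_ball \<theta> \<Lambda> a b R q lam f \<longrightarrow> q $ bdry_coord = 0 \<longrightarrow> 1 \<le> lam \<longrightarrow> 0 < M \<longrightarrow>
    (\<forall>x\<in>ball q R \<inter> half_space. \<bar>f x\<bar> \<le> M) \<longrightarrow> ball q R \<inter> half_space \<subseteq> S \<longrightarrow>
    (f has_derivative f') (at q within S) \<longrightarrow>
    \<bar>f' (axis bdry_coord 1)\<bar> \<le> C1 * lam * M \<and> (\<forall>i. i \<noteq> bdry_coord \<longrightarrow> f' (axis i 1) = 0)"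
    using boundary_normal_derivative[OF \<theta> \<Lambda> R, where 'n = 'n] by blast
  obtain C2 where C2: "C2 > 0" and lower: "\<forall>(a :: 'n \<Rightarrow> 'n \<Rightarrow> real^'n \<Rightarrow> real) b q lam f f' Q.
    dirichlet_half_ball \<theta> \<Lambda> a b R q lam f \<longrightarrow> 1 \<le> lam \<longrightarrow> 0 < f q \<longrightarrow> 
    (\<forall>x\<in>ball q R \<inter> half_space. (f has_derivative f' x) (at x within ball q R \<inter> half_space) \<and> onorm (f' x) \<le> Q) \<longrightarrow>
    lam * f q \<le> C2 * Q"
    using value_le_gradient_bound[OF \<theta> \<Lambda> R, where 'n = 'n] by blast
  define C where "C = max (max K0 1) (max (\<Lambda> * C1) (C2 / sqrt \<theta>))"
  have C: "0 < C" "K0 \<le> C" "\<Lambda> * C1 \<le> C" "C2 / sqrt \<theta> \<le> C" by (auto simp: C_def)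
  define Y where "Y = {q \<in> U. \<phi> q \<in> ball (\<phi> p) R}"
  have "openin N Y" unfolding Y_def by (intro chart_preimage_open[OF c(1)]) simp
  moreover have "p \<in> Y" using c R by (simp add: Y_def)
  moreover have "eigenfunction_bounds q C" if q: "q \<in> Y" for q
    unfolding eigenfunction_bounds_def
  proof (intro conjI allI impI C(1))
    fix lam :: real and e assume lam: "1 \<le> lam" and e: "dirichlet_eigenfunction N A g (lam\<^sup>2) e"
    define f where "f = e \<circ> inv_into U \<phi>"
    let ?D = "\<lambda>i. pderiv_on ?S i f" and ?gl = "gradient_length A g e"
    have es: "smooth_function A e" using e by (simp add: dirichlet_eigenfunction_def)
    have fs: "smooth_on ?S f" using chart_smooth_function[OF c(1) es] by (simp add: f_def)
    note oS = chart_image_open[OF c(1)]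
    have qU: "q \<in> U" and qb: "\<phi> q \<in> ball (\<phi> p) R" using q by (auto simp: Y_def)
    have qN: "q \<in> topspace N" using qU chart_subset[OF c(1)] by blast
    have qH: "\<phi> q \<in> half_space" using chart_image_half_space[OF c(1)] qU by blast
    have fq: "f (\<phi> q) = e q" using chart_inv[OF c(1) qU] by (simp add: f_def)
    have dir: "dirichlet_half_ball \<theta> \<Lambda> a b R (\<phi> q) lam f"
      unfolding f_def R_def
      by (rule eigenfunction_half_ball[OF c(1) loc _ e]) (use co qb qH in \<open>auto simp: R_def\<close>)
    have sub: "ball (\<phi> q) R \<subseteq> ball (\<phi> p) (r / 2)"
    proof
      fix x assume "x \<in> ball (\<phi> q) R"
      then show "x \<in> ball (\<phi> p) (r / 2)" using qb dist_triangle[of "\<phi> p" x "\<phi> q"] by (auto simp: R_def)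
    qed
    have subr: "ball (\<phi> p) (r / 2) \<subseteq> ball (\<phi> p) r" using r by auto
    have HS: "ball (\<phi> q) R \<inter> half_space \<subseteq> ?S"
      using loc sub subr unfolding local_coefficients_def by blast
    have pt: "inv_into U \<phi> x \<in> U" "\<phi> (inv_into U \<phi> x) = x" "inv_into U \<phi> x \<in> topspace N"
      "elliptic_at \<theta> \<Lambda> a b x" "coeff_derivs_le \<Lambda> a b x"
      "(?gl (inv_into U \<phi> x))\<^sup>2 = (\<Sum>i\<in>UNIV. \<Sum>j\<in>UNIV. a i j x * (?D i x * ?D j x))"
      if x: "x \<in> ball (\<phi> q) R \<inter> half_space" for x
    proof -
      have xS: "x \<in> ?S" using x HS by blast
      then show U: "inv_into U \<phi> x \<in> U" and eq: "\<phi> (inv_into U \<phi> x) = x"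
        by (auto intro: inv_into_into f_inv_into_f)
      then show "inv_into U \<phi> x \<in> topspace N" using chart_subset[OF c(1)] by blast
      have "x \<in> cball (\<phi> p) (r / 2) \<inter> half_space" using x sub by force
      then show "elliptic_at \<theta> \<Lambda> a b x" "coeff_derivs_le \<Lambda> a b x" using co by blast+
      have "\<phi> (inv_into U \<phi> x) \<in> ball (\<phi> p) r" unfolding eq using x sub subr by blast
      from gradient_length_local[OF es c(1) loc U this]
      show "(?gl (inv_into U \<phi> x))\<^sup>2 = (\<Sum>i\<in>UNIV. \<Sum>j\<in>UNIV. a i j x * (?D i x * ?D j x))"
        by (simp add: eq f_def)
    qed
    have qB: "\<phi> q \<in> ball (\<phi> q) R \<inter> half_space" using qH R by simp
    have der: "(f has_derivative (\<lambda>v. \<Sum>i\<in>UNIV. v $ i * ?D i x)) (at x within ?S)" if "x \<in> ?S" for x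
      by (rule has_derivative_pderiv_on[OF oS fs that])
    have glq: "(?gl q)\<^sup>2 = (\<Sum>i\<in>UNIV. \<Sum>j\<in>UNIV. a i j (\<phi> q) * (?D i (\<phi> q) * ?D j (\<phi> q)))"
      using pt(6)[OF qB] chart_inv[OF c(1) qU] by simp
    show "(?gl q)\<^sup>2 \<le> K * lam\<^sup>2 * (e q)\<^sup>2"
      if K: "C \<le> K" and int: "q \<in> mfd_interior N A"
        and max: "\<forall>p\<in>topspace N. (?gl p)\<^sup>2 + K * lam\<^sup>2 * (e p)\<^sup>2 \<le> (?gl q)\<^sup>2 + K * lam\<^sup>2 * (e q)\<^sup>2" for K
    proof -
      have qpos: "0 < \<phi> q $ bdry_coord" using int interior_iff[OF c(1) qU] by blast
      define W where "W = ball (\<phi> q) R \<inter> {x. 0 < x $ bdry_coord}"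
      have W: "open W" "\<phi> q \<in> W" "W \<subseteq> ball (\<phi> q) R \<inter> half_space" "W \<subseteq> ball (\<phi> p) r"
        using qpos R sub subr open_half by (auto simp: W_def half_space_def)
      have sa: "smooth_open W (a i j)" "smooth_open W (b i)" for i j
        using loc W smooth_open_subset unfolding local_coefficients_def by blast+
      have sf: "smooth_open W f" using dir unfolding dirichlet_half_ball_def W_def by blast
      have eq: "elliptic_op a b f y = - lam\<^sup>2 * f y" if "y \<in> W" for y
        using dir that unfolding dirichlet_half_ball_def W_def by blast
      have carre: "carre_du_champ a f f y = (?gl (inv_into U \<phi> y))\<^sup>2" if y: "y \<in> W" for y
      proof -
        have "y \<in> ?S" using y W(3) HS by blast
        moreover have "0 < y $ bdry_coord" using y by (simp add: W_def)
        ultimately have "?D i y = pd i f y" for i by (rule pderiv_on_interior[OF oS fs])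
        moreover have "y \<in> ball (\<phi> q) R \<inter> half_space" using y W(3) by blast
        ultimately show ?thesis using pt(6)[of y] by (simp add: carre_du_champ_def)
      qed
      have "carre_du_champ a f f (\<phi> q) \<le> K * lam\<^sup>2 * (f (\<phi> q))\<^sup>2"
      proof (rule bernstein[rule_format, of "\<phi> q" W a b])
        fix y assume y: "y \<in> W"
        then have "inv_into U \<phi> y \<in> topspace N" using pt(3) W(3) by blast
        then have "(?gl (inv_into U \<phi> y))\<^sup>2 + K * lam\<^sup>2 * (f y)\<^sup>2 \<le> (?gl q)\<^sup>2 + K * lam\<^sup>2 * (e q)\<^sup>2"
          using max by (simp add: f_def)
        then show "carre_du_champ a f f y + K * lam\<^sup>2 * (f y)\<^sup>2
            \<le> carre_du_champ a f f (\<phi> q) + K * lam\<^sup>2 * (f (\<phi> q))\<^sup>2"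
          using carre[OF y] carre[OF W(2)] chart_inv[OF c(1) qU] fq by simp
      qed (use W sa sf eq lam K C pt(4,5)[OF qB] in auto)
      then show ?thesis using carre[OF W(2)] chart_inv[OF c(1) qU] fq by simp
    qed
    show "?gl q \<le> C * lam * M"
      if M: "0 < M" and bd: "q \<in> mfd_boundary A" and le: "\<forall>p\<in>topspace N. \<bar>e p\<bar> \<le> M" for M
    proof -
      have zero: "\<phi> q $ bdry_coord = 0"
        using bd interior_iff[OF c(1) qU] qH by (auto simp: mfd_interior_def half_space_def)
      have "\<forall>x\<in>ball (\<phi> q) R \<inter> half_space. \<bar>f x\<bar> \<le> M" using le pt(3) by (simp add: f_def)
      then have 1: "\<bar>\<Sum>i\<in>UNIV. axis bdry_coord 1 $ i * ?D i (\<phi> q)\<bar> \<le> C1 * lam * M"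
        "\<And>k. k \<noteq> bdry_coord \<Longrightarrow> (\<Sum>i\<in>UNIV. axis k 1 $ i * ?D i (\<phi> q)) = 0"
        using boundary[rule_format, OF dir zero lam M _ HS der] qU by blast+
      have ax: "(\<Sum>i\<in>UNIV. axis k 1 $ i * ?D i (\<phi> q)) = ?D k (\<phi> q)" for k
      proof -
        have "axis k 1 $ i * ?D i (\<phi> q) = (if i = k then ?D i (\<phi> q) else 0)" for i by (simp add: axis_def)
        then show ?thesis by simp
      qed
      let ?d = "?D bdry_coord (\<phi> q)"
      have "a i j (\<phi> q) * (?D i (\<phi> q) * ?D j (\<phi> q))
          = (if j = bdry_coord then if i = bdry_coord then a i j (\<phi> q) * ?d\<^sup>2 else 0 else 0)" for i j
        using 1(2) unfolding ax by (auto simp: power2_eq_square)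
      then have "(?gl q)\<^sup>2 = a bdry_coord bdry_coord (\<phi> q) * ?d\<^sup>2" unfolding glq by simp
      also have "\<dots> \<le> \<Lambda>\<^sup>2 * (C1 * lam * M)\<^sup>2"
      proof (intro mult_mono)
        have "a bdry_coord bdry_coord (\<phi> q) \<le> \<Lambda>" using elliptic_atD(3)[OF pt(4)[OF qB], of bdry_coord bdry_coord] by simp
        also have "\<Lambda> \<le> \<Lambda>\<^sup>2" using \<Lambda> by (simp add: power2_eq_square)
        finally show "a bdry_coord bdry_coord (\<phi> q) \<le> \<Lambda>\<^sup>2" .
        show "?d\<^sup>2 \<le> (C1 * lam * M)\<^sup>2" using 1(1) unfolding ax by (rule abs_le_square_iff[THEN iffD1, OF order_trans]) simp
      qed auto
      finally have "(?gl q)\<^sup>2 \<le> (\<Lambda> * C1 * lam * M)\<^sup>2" by (simp add: power_mult_distrib mult_ac)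
      then have "?gl q \<le> \<Lambda> * C1 * lam * M"
        by (rule power2_le_imp_le) (use \<Lambda> C1 lam M in simp)
      also have "\<dots> \<le> C * lam * M" using C lam M by (intro mult_right_mono) auto
      finally show ?thesis .
    qed
    show "lam * \<bar>e q\<bar> \<le> C * Q" if Q: "\<forall>p\<in>topspace N. ?gl p \<le> Q" for Q
    proof -
      have Q0: "0 \<le> Q" using Q gradient_length_nonneg[OF es qN] qN by force
      let ?f' = "\<lambda>x v. \<Sum>i\<in>UNIV. v $ i * ?D i x"
      \<comment> \<open>the sign \<open>s\<close> serves to treat \<open>f\<close> and \<open>-f\<close> alike\<close>
      have on: "onorm (\<lambda>v. s * ?f' x v) \<le> Q / sqrt \<theta>" if x: "x \<in> ball (\<phi> q) R \<inter> half_space" and s: "\<bar>s\<bar> = 1" for x s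
      proof (rule onorm_le)
        fix v :: "real^'n"
        define d where "d = (\<chi> i. ?D i x)"
        have "\<theta> * (\<Sum>i\<in>UNIV. (?D i x)\<^sup>2) \<le> (?gl (inv_into U \<phi> x))\<^sup>2"
          using elliptic_atD(2)[OF pt(4)[OF x], of "\<lambda>i. ?D i x"] pt(6)[OF x] by (simp add: mult.assoc)
        also have "\<dots> \<le> Q\<^sup>2" using Q gradient_length_nonneg[OF es] pt(3)[OF x] by (intro power_mono) auto
        finally have "(norm d)\<^sup>2 \<le> (Q / sqrt \<theta>)\<^sup>2"
          using \<theta> unfolding power2_norm_eq_inner inner_vec_def
          by (simp add: d_def power_divide field_simps power2_eq_square)
        then have nd: "norm d \<le> Q / sqrt \<theta>" by (rule power2_le_imp_le) (use Q0 \<theta> in simp)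
        have "norm (s * ?f' x v) = \<bar>v \<bullet> d\<bar>" using s by (simp add: abs_mult inner_vec_def d_def)
        also have "\<dots> \<le> norm v * norm d" by (rule Cauchy_Schwarz_ineq2)
        also have "\<dots> \<le> norm v * (Q / sqrt \<theta>)" by (intro mult_left_mono nd) simp
        finally show "norm (s * ?f' x v) \<le> Q / sqrt \<theta> * norm v" by (simp add: mult.commute)
      qed
      have derH: "(f has_derivative ?f' x) (at x within ball (\<phi> q) R \<inter> half_space)"
        if "x \<in> ball (\<phi> q) R \<inter> half_space" for x
        using has_derivative_subset[OF der HS] that HS by blast
      have "lam * \<bar>f (\<phi> q)\<bar> \<le> C2 * (Q / sqrt \<theta>)"
      proof (cases "f (\<phi> q)" "0::real" rule: linorder_cases)
        case equal
        then show ?thesis using C2 Q0 \<theta> by simp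
      next
        case greater
        have "lam * f (\<phi> q) \<le> C2 * (Q / sqrt \<theta>)"
          by (rule lower[rule_format, OF dir lam greater, of ?f']) (use on[of _ 1] derH in auto)
        then show ?thesis using greater by simp
      next
        case less
        have "lam * (- f (\<phi> q)) \<le> C2 * (Q / sqrt \<theta>)"
          by (rule lower[rule_format, OF dirichlet_half_ball_minus[OF dir] lam, of "\<lambda>x v. - ?f' x v"])
             (use less on[of _ "-1"] has_derivative_minus[OF derH] in auto)
        then show ?thesis using less by simp
      qed
      also have "\<dots> \<le> C * Q" using mult_right_mono[OF C(4) Q0] by simp
      finally show ?thesis by (simp add: fq)
    qed
  qed
  ultimately show ?thesis by blast
qed

lemma eigenfunction_bounds_uniform:
  assumes "compact_space N"
  shows "\<exists>C>0. \<forall>q\<in>topspace N. eigenfunction_bounds q C"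
proof -
  obtain Y C where OC: "\<And>p. p \<in> topspace N \<Longrightarrow> openin N (Y p) \<and> p \<in> Y p \<and> (\<forall>q\<in>Y p. eigenfunction_bounds q (C p))"
    using eigenfunction_bounds_local by metis
  have "\<exists>F. finite F \<and> F \<subseteq> Y ` topspace N \<and> topspace N \<subseteq> \<Union>F"
    by (rule assms[unfolded compact_space_alt, rule_format]) (use OC in auto)
  then obtain F where F: "finite F" "F \<subseteq> Y ` topspace N" "topspace N \<subseteq> \<Union>F" by blast
  obtain P where P: "finite P" "P \<subseteq> topspace N" "topspace N \<subseteq> \<Union>(Y ` P)"
    using finite_subset_image[OF F(1,2)] F(3) by metis
  define B where "B = Max (insert 1 (C ` P))"
  have "eigenfunction_bounds q B" if q: "q \<in> topspace N" for q
  proof -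
    obtain p where p: "p \<in> P" "q \<in> Y p" using P q by blast
    have "C p \<le> B" unfolding B_def using P p by (intro Max_ge) auto
    then show ?thesis using eigenfunction_bounds_mono[OF _ _ q] OC p P by blast
  qed
  moreover have "1 \<le> B" unfolding B_def using P by (intro Max_ge) auto
  ultimately show ?thesis by (intro exI[of _ B]) auto
qed

text \<open>The lower bound is the third local estimate at a point where \<open>|e|\<close> is maximal. For the upper bound,
  \<open>P = |\<nabla>e|\<^sup>2 + C \<lambda>\<^sup>2 e\<^sup>2\<close> is considered at its maximum over the manifold, which is either an interior point
  or a boundary point.\<close>

lemma gradient_estimate:
  assumes comp: "compact_space N" and C: "0 < C" and bounds: "\<forall>q\<in>topspace N. eigenfunction_bounds q C"
    and lam: "1 \<le> lam" and e: "dirichlet_eigenfunction N A g (lam\<^sup>2) e"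
  shows "lam * Linf_norm N A e / (C + 1) \<le> Linf_norm N A (gradient_length A g e)"
    and "Linf_norm N A (gradient_length A g e) \<le> (C + 1) * lam * Linf_norm N A e"
proof -
  let ?gl = "gradient_length A g e"
  have es: "smooth_function A e" and ne: "\<exists>p\<in>topspace N. e p \<noteq> 0" and bd: "\<forall>p\<in>mfd_boundary A. e p = 0"
    using e by (auto simp: dirichlet_eigenfunction_def)
  have nN: "topspace N \<noteq> {}" using ne by blast
  have ce: "continuous_map N euclideanreal e" by (rule continuous_smooth_function[OF es])
  have cg: "continuous_map N euclideanreal ?gl" by (rule continuous_gradient_length[OF es])
  have g0: "0 \<le> ?gl p" if "p \<in> topspace N" for p by (rule gradient_length_nonneg[OF es that])
  have "continuous_map N euclideanreal (\<lambda>p. \<bar>e p\<bar>)" using ce by (intro continuous_intros)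
  then obtain p1 where p1: "p1 \<in> topspace N" "\<And>q. q \<in> topspace N \<Longrightarrow> \<bar>e q\<bar> \<le> \<bar>e p1\<bar>"
    using attains_max[OF comp _ nN] by blast
  obtain p2 where p2: "p2 \<in> topspace N" "\<And>q. q \<in> topspace N \<Longrightarrow> ?gl q \<le> ?gl p2"
    using attains_max[OF comp cg nN] by blast
  define M where "M = \<bar>e p1\<bar>"
  have M: "M > 0" using ne p1 by (force simp: M_def)
  have LM: "Linf_norm N A e = M"
    using Linf_norm_ge[OF ce p1(1), of M] Linf_norm_le[of e M] p1(2) by (force simp: M_def)
  have LG: "Linf_norm N A ?gl = ?gl p2"
    using Linf_norm_ge[OF cg p2(1), of "?gl p2"] Linf_norm_le[of ?gl "?gl p2"] p2 g0 by force
  have "lam * M \<le> C * ?gl p2"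
    using bounds p1(1) p2(2) lam e unfolding eigenfunction_bounds_def M_def by blast
  also have "\<dots> \<le> (C + 1) * ?gl p2" using g0[OF p2(1)] by (intro mult_right_mono) auto
  finally show "lam * Linf_norm N A e / (C + 1) \<le> Linf_norm N A ?gl"
    unfolding LM LG using C by (simp add: divide_le_eq mult.commute)
  define P where "P p = (?gl p)\<^sup>2 + C * lam\<^sup>2 * (e p)\<^sup>2" for p
  have "continuous_map N euclideanreal P"
    unfolding P_def by (intro continuous_intros ce cg)
  then obtain p3 where p3: "p3 \<in> topspace N" "\<And>q. q \<in> topspace N \<Longrightarrow> P q \<le> P p3"
    using attains_max[OF comp _ nN] by blast
  have e3: "(e p3)\<^sup>2 \<le> M\<^sup>2" using p1(2)[OF p3(1)] unfolding M_def by (simp add: abs_le_square_iff)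
  have "P p3 \<le> ((C + 1) * lam * M)\<^sup>2"
  proof (cases "p3 \<in> mfd_boundary A")
    case True
    then have "?gl p3 \<le> C * lam * M"
      using bounds p3(1) lam e M p1(2) unfolding eigenfunction_bounds_def M_def by blast
    also have "\<dots> \<le> (C + 1) * lam * M" using lam M by (intro mult_right_mono) auto
    finally have "(?gl p3)\<^sup>2 \<le> ((C + 1) * lam * M)\<^sup>2" using g0[OF p3(1)] by (intro power_mono) auto
    then show ?thesis using True bd by (simp add: P_def)
  next
    case False
    then have "p3 \<in> mfd_interior N A" using p3(1) by (simp add: mfd_interior_def)
    then have "(?gl p3)\<^sup>2 \<le> C * lam\<^sup>2 * (e p3)\<^sup>2"
      using bounds p3 lam e unfolding eigenfunction_bounds_def P_def by blast
    then have "P p3 \<le> 2 * C * (lam\<^sup>2 * (e p3)\<^sup>2)" by (simp add: P_def)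
    also have "\<dots> \<le> 2 * C * (lam\<^sup>2 * M\<^sup>2)" using C e3 by (intro mult_left_mono) auto
    also have "\<dots> \<le> (C + 1)\<^sup>2 * (lam\<^sup>2 * M\<^sup>2)"
    proof (rule mult_right_mono)
      show "2 * C \<le> (C + 1)\<^sup>2" using zero_le_power2[of C] by (simp add: power2_sum)
    qed simp
    finally show ?thesis by (simp add: power_mult_distrib mult_ac)
  qed
  then have "P p2 \<le> ((C + 1) * lam * M)\<^sup>2" using p3(2)[OF p2(1)] by linarith
  moreover have "(?gl p2)\<^sup>2 \<le> P p2" using C by (simp add: P_def)
  ultimately have "(?gl p2)\<^sup>2 \<le> ((C + 1) * lam * M)\<^sup>2" by linarith
  then have "?gl p2 \<le> (C + 1) * lam * M"
    by (rule power2_le_imp_le) (use C lam M in simp)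
  then show "Linf_norm N A ?gl \<le> (C + 1) * lam * Linf_norm N A e" unfolding LM LG .
qed

end

theorem theorem1p2:
  fixes N :: "'a topology"
    and A :: "('a, 'n::finite) chart set"
    and g :: "('a, 'n) metric"
  assumes "smooth_manifold_with_boundary N A"
    and "compact_space N"
    and "riemannian_metric A g"
  shows "\<exists>C>0. \<forall>lam\<ge>1. \<forall>e. dirichlet_eigenfunction N A g (lam\<^sup>2) e \<longrightarrow>
           lam * Linf_norm N A e / C \<le> Linf_norm N A (gradient_length A g e) \<and>
           Linf_norm N A (gradient_length A g e) \<le> C * lam * Linf_norm N A e"
proof -
  interpret riemannian_manifold N A g using assms by unfold_locales
  obtain C where C: "C > 0" "\<forall>q\<in>topspace N. eigenfunction_bounds q C"
    using eigenfunction_bounds_uniform[OF assms(2)] by blast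
  show ?thesis
    using gradient_estimate[OF assms(2) C] C(1) by (intro exI[of _ "C + 1"]) auto
qed

end
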